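(* Assume that $\operatorname{supp}\rho_{0,n}\le\operatorname{supp}\rho_{1,n}$ for all $n\in\mathbb N$. Then $$\underline{s}_G(\rho_0\,\|\,\rho_1)=\overline{s}_G(\rho_0\,\|\,\rho_1)=s_G(\rho_0\,\|\,\rho_1)=-S_M(\rho_0\,\|\,\rho_1).$$
   Context: Let $\mathcal H$ be a finite-dimensional complex Hilbert space, $G$ a compact group and $g\mapsto u_g$ a continuous unitary representation of $G$ on $\mathcal H$. For $n\in\mathbb N$ let $\mathcal A_n=\{A\in\mathcal B(\mathcal H^{\otimes n}):Au_g^{\otimes n}=u_g^{\otimes n}A\ \forall g\in G\}$ and $E_{\mathcal A_n}(X)=\int_G u_g^{\otimes n}Xu_g^{*\otimes n}\,dg$ (normalized Haar measure). Let $\rho_0,\rho_1$ be states on $\mathcal B(\mathcal H)$ with density matrices $\hat\rho_0,\hat\rho_1$, and let $\rho_{k,n}$ be the state on $\mathcal B(\mathcal H^{\otimes n})$ with density $\hat\rho_{k,n}:=E_{\mathcal A_n}(\hat\rho_k^{\otimes n})$, $k=0,1$; $\operatorname{supp}\rho_{k,n}$ denotes the support projection of $\hat\rho_{k,n}$. A $G$-invariant test is a sequence $\{T_n\}$ with $T_n\in\mathcal A_n$, $0\le T_n\le I$; its error probabilities are $\beta_{0,n}(T_n)=\operatorname{Tr}\hat\rho_0^{\otimes n}(I-T_n)$ and $\beta_{1,n}(T_n)=\operatorname{Tr}\hat\rho_1^{\otimes n}T_n$. Define $\underline s_G(\rho_0\|\rho_1)$, $\overline s_G(\rho_0\|\rho_1)$,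 $s_G(\rho_0\|\rho_1)$ as the infimum, over all $G$-invariant test sequences with $\lim_{n\to\infty}\beta_{0,n}(T_n)=0$, of respectively $\liminf_n\frac1n\log\beta_{1,n}(T_n)$, $\limsup_n\frac1n\log\beta_{1,n}(T_n)$, and $\lim_n\frac1n\log\beta_{1,n}(T_n)$ (the last infimum being over those sequences for which this limit exists). The relative entropy is $S(\rho\|\sigma)=\operatorname{Tr}\hat\rho(\log\hat\rho-\log\hat\sigma)$ if $\operatorname{supp}\rho\le\operatorname{supp}\sigma$ and $+\infty$ otherwise, and $S_M(\rho_0\|\rho_1):=\lim_{n\to\infty}\frac1n S(\rho_{0,n}\|\rho_{1,n})$ (this limit exists and equals $\sup_n\frac1nS(\rho_{0,n}\|\rho_{1,n})$). *)

theory Defs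
  imports "HOL-Analysis.Analysis" "HOL-Probability.Probability" "Jordan_Normal_Form.Matrix"
begin

text \<open>The Hilbert space H is C^d; B(H^{\<otimes>n}) is the set of (d^n)x(d^n) complex matrices.\<close>

definition adj :: "complex mat \<Rightarrow> complex mat" where
  "adj A = mat (dim_col A) (dim_row A) (\<lambda>(i,j). cnj (A $$ (j,i)))"

definition tr :: "complex mat \<Rightarrow> complex" where
  "tr A = (\<Sum>i<dim_row A. A $$ (i,i))"

definition unitary_mat :: "nat \<Rightarrow> complex mat \<Rightarrow> bool" where
  "unitary_mat n U \<longleftrightarrow> U \<in> carrier_mat n n \<and> adj U * U = 1\<^sub>m n \<and> U * adj U = 1\<^sub>m n"

definition psd :: "nat \<Rightarrow> complex mat \<Rightarrow> bool" where
  "psd n A \<longleftrightarrow> A \<in> carrier_mat n n \<and> adj A = A \<and>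
     (\<forall>v \<in> carrier_vec n. 0 \<le> Re (scalar_prod (map_vec cnj v) (A *\<^sub>v v)))"

definition loewner_le :: "nat \<Rightarrow> complex mat \<Rightarrow> complex mat \<Rightarrow> bool" where
  "loewner_le n A B \<longleftrightarrow> A \<in> carrier_mat n n \<and> B \<in> carrier_mat n n \<and> psd n (B - A)"

definition density :: "nat \<Rightarrow> complex mat \<Rightarrow> bool" where
  "density n A \<longleftrightarrow> psd n A \<and> tr A = 1"

definition kron :: "complex mat \<Rightarrow> complex mat \<Rightarrow> complex mat" where
  "kron A B = mat (dim_row A * dim_row B) (dim_col A * dim_col B)
     (\<lambda>(i,j). A $$ (i div dim_row B, j div dim_col B) * B $$ (i mod dim_row B, j mod dim_col B))"

definition kpow :: "nat \<Rightarrow> complex mat \<Rightarrow> complex mat" where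
  "kpow n A = ((kron A) ^^ n) (1\<^sub>m 1)"

text \<open>Functional calculus for Hermitian matrices via spectral decomposition
  (well defined, since f(A) does not depend on the chosen decomposition).\<close>
definition spectral_decomp :: "nat \<Rightarrow> complex mat \<Rightarrow> complex mat \<Rightarrow> (nat \<Rightarrow> real) \<Rightarrow> bool" where
  "spectral_decomp n A U lam \<longleftrightarrow> unitary_mat n U \<and>
     A = U * mat_diag n (\<lambda>i. complex_of_real (lam i)) * adj U"

definition mfun :: "(real \<Rightarrow> real) \<Rightarrow> complex mat \<Rightarrow> complex mat" where
  "mfun f A = (SOME M. \<exists>U lam. spectral_decomp (dim_row A) A U lam \<and>
       M = U * mat_diag (dim_row A) (\<lambda>i. complex_of_real (f (lam i))) * adj U)"

text \<open>Matrix logarithm restricted to the support (note ln 0 = 0 in Isabelle).\<close>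
definition mlog :: "complex mat \<Rightarrow> complex mat" where
  "mlog A = mfun ln A"

definition supp :: "complex mat \<Rightarrow> complex mat" where
  "supp A = mfun (\<lambda>x. if x = 0 then 0 else 1) A"

definition rel_entropy :: "complex mat \<Rightarrow> complex mat \<Rightarrow> ereal" where
  "rel_entropy \<rho> \<sigma> =
     (if loewner_le (dim_row \<rho>) (supp \<rho>) (supp \<sigma>)
      then ereal (Re (tr (\<rho> * (mlog \<rho> - mlog \<sigma>)))) else \<infinity>)"

definition compact_group :: "'g::{group_add,topological_space} itself \<Rightarrow> bool" where
  "compact_group _ \<longleftrightarrow> compact (UNIV :: 'g set) \<and>
     continuous_on UNIV (\<lambda>p::'g \<times> 'g. fst p + snd p) \<and>
     continuous_on UNIV (uminus :: 'g \<Rightarrow> 'g)"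

definition haar_prob :: "'g::{group_add,topological_space} measure \<Rightarrow> bool" where
  "haar_prob \<mu> \<longleftrightarrow> sets \<mu> = sets borel \<and> prob_space \<mu> \<and>
     (\<forall>g. \<forall>A \<in> sets borel. emeasure \<mu> ((\<lambda>x. g + x) ` A) = emeasure \<mu> A)"

definition cont_unitary_rep :: "nat \<Rightarrow> ('g::{group_add,topological_space} \<Rightarrow> complex mat) \<Rightarrow> bool" where
  "cont_unitary_rep d u \<longleftrightarrow> (\<forall>g. unitary_mat d (u g)) \<and>
     (\<forall>g h. u (g + h) = u g * u h) \<and>
     (\<forall>i<d. \<forall>j<d. continuous_on UNIV (\<lambda>g. u g $$ (i,j)))"

definition twirl :: "'g measure \<Rightarrow> nat \<Rightarrow> ('g \<Rightarrow> complex mat) \<Rightarrow> nat \<Rightarrow> complex mat \<Rightarrow> complex mat" where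
  "twirl \<mu> d u n X = mat (d^n) (d^n) (\<lambda>(i,j).
      integral\<^sup>L \<mu> (\<lambda>g. (kpow n (u g) * X * adj (kpow n (u g))) $$ (i,j)))"

definition inv_test :: "nat \<Rightarrow> ('g \<Rightarrow> complex mat) \<Rightarrow> (nat \<Rightarrow> complex mat) \<Rightarrow> bool" where
  "inv_test d u T \<longleftrightarrow> (\<forall>n. T n \<in> carrier_mat (d^n) (d^n) \<and>
      (\<forall>g. T n * kpow n (u g) = kpow n (u g) * T n) \<and>
      psd (d^n) (T n) \<and> loewner_le (d^n) (T n) (1\<^sub>m (d^n)))"

definition beta0 :: "nat \<Rightarrow> complex mat \<Rightarrow> (nat \<Rightarrow> complex mat) \<Rightarrow> nat \<Rightarrow> real" where
  "beta0 d \<rho>0 T n = Re (tr (kpow n \<rho>0 * (1\<^sub>m (d^n) - T n)))"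

definition beta1 :: "complex mat \<Rightarrow> (nat \<Rightarrow> complex mat) \<Rightarrow> nat \<Rightarrow> real" where
  "beta1 \<rho>1 T n = Re (tr (kpow n \<rho>1 * T n))"

definition elog :: "real \<Rightarrow> ereal" where
  "elog x = (if x \<le> 0 then -\<infinity> else ereal (ln x))"

definition rate :: "complex mat \<Rightarrow> (nat \<Rightarrow> complex mat) \<Rightarrow> nat \<Rightarrow> ereal" where
  "rate \<rho>1 T n = ereal (1 / real n) * elog (beta1 \<rho>1 T n)"

definition s_lower :: "nat \<Rightarrow> ('g \<Rightarrow> complex mat) \<Rightarrow> complex mat \<Rightarrow> complex mat \<Rightarrow> ereal" where
  "s_lower d u \<rho>0 \<rho>1 = Inf {liminf (rate \<rho>1 T) | T. inv_test d u T \<and> beta0 d \<rho>0 T \<longlonglongrightarrow> 0}"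

definition s_upper :: "nat \<Rightarrow> ('g \<Rightarrow> complex mat) \<Rightarrow> complex mat \<Rightarrow> complex mat \<Rightarrow> ereal" where
  "s_upper d u \<rho>0 \<rho>1 = Inf {limsup (rate \<rho>1 T) | T. inv_test d u T \<and> beta0 d \<rho>0 T \<longlonglongrightarrow> 0}"

definition s_lim :: "nat \<Rightarrow> ('g \<Rightarrow> complex mat) \<Rightarrow> complex mat \<Rightarrow> complex mat \<Rightarrow> ereal" where
  "s_lim d u \<rho>0 \<rho>1 = Inf {L. \<exists>T. inv_test d u T \<and> beta0 d \<rho>0 T \<longlonglongrightarrow> 0 \<and> rate \<rho>1 T \<longlonglongrightarrow> L}"

definition S_M :: "'g measure \<Rightarrow> nat \<Rightarrow> ('g \<Rightarrow> complex mat) \<Rightarrow> complex mat \<Rightarrow> complex mat \<Rightarrow> ereal" where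
  "S_M \<mu> d u \<rho>0 \<rho>1 = lim (\<lambda>n. ereal (1 / real n) *
      rel_entropy (twirl \<mu> d u n (kpow n \<rho>0)) (twirl \<mu> d u n (kpow n \<rho>1)))"

end

(*
  Put omega_{k,n} for the twirled n-fold states and a_n = S(omega_{0,n} || omega_{1,n}) / n.

  Converse.  Let r_i, x_i and s_j, y_j be the eigenvalues and eigenvectors of omega_{0,n} and
  omega_{1,n}, and w_ij = |<x_i, y_j>|^2.  The relative entropy is the classical divergence of
  r_i w_ij from s_j w_ij, and every test satisfies the Nussbaum-Szkola bound
  beta_0 + lam * beta_1 >= (1/2) sum_ij min(r_i, lam s_j) w_ij.  A Markov estimate of the
  log-likelihood ratio then gives beta_1 >= c exp(-n (a + e)) whenever a_n <= a and n is large.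

  Direct part.  Fix m and let P and Q be the spectral projections of the k-fold tensor powers of
  omega_{0,m} and omega_{1,m} onto the eigenvalues >= exp(k (tr omega_0 log omega_0 - e)) and
  <= exp(k (tr omega_0 log omega_1 + e)).  By Chebyshev's inequality both have almost full mass
  under the first state, so T = Q P Q has vanishing first error, while its second error is at most
  (rank P) exp(k (tr omega_0 log omega_1 + e)) <= exp(-k (m a_m - 2e)).  T commutes with the group
  action at each of the k blocks separately, so the untwirled and the twirled states assign it the
  same errors.  Mixing in exp(-n r) times the identity makes the rate converge to exactly -r,
  for any 0 <= r < a_m.

  Comparing the two parts also shows that a_n converges to sup_m a_m, so no monotonicity theorem
  for the quantum relative entropy is needed.
*)
theory Submission
  imports "Jordan_Normal_Form.Spectral_Radius" Defs
begin

unbundle no vec_syntax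

section \<open>Matrices, adjoints and positivity\<close>

text \<open>The spectral projections of the direct part belong to different eigenbases and in
  general do not commute, so there is no projection onto both events. \<open>Q P Q\<close> is the
  substitute, and a parallelogram identity bounds its complement by those of \<open>P\<close> and
  \<open>Q\<close>. The twirl of an n-fold power is in general not a product state, so the law of
  large numbers is applied to k-fold powers of one fixed block instead. Commuting with the group at
  every block separately is a stronger condition than invariance, and it is what carries the errors
  back to the untwirled product states. \<open>S_M\<close> is defined with \<open>lim\<close>, which
  carries information only once convergence is proved. The converse is therefore stated for those
  \<open>n\<close> with \<open>a_n <= a\<close>: it can then be used along a subsequence and
  contradict the block test. Mixing in the identity excludes second errors equal to zero, whose rate
  would be minus infinity, and turns an upper bound on the rate into a genuine limit, as
  \<open>s_lim\<close> demands.\<close>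

lemma adj_carrier [simp]: "A \<in> carrier_mat n m \<Longrightarrow> adj A \<in> carrier_mat m n"
  by (auto simp: adj_def)

lemma dim_adj [simp]: "dim_row (adj A) = dim_col A" "dim_col (adj A) = dim_row A"
  by (simp_all add: adj_def)

lemma index_adj [simp]:
  "i < dim_col A \<Longrightarrow> j < dim_row A \<Longrightarrow> adj A $$ (i,j) = cnj (A $$ (j,i))"
  by (simp add: adj_def)

lemma adj_adj [simp]: "adj (adj A) = A"
  by (rule eq_matI) auto

lemma adj_one [simp]: "adj (1\<^sub>m n) = 1\<^sub>m n"
  by (rule eq_matI) auto

lemma index_mult_sum:
  assumes "A \<in> carrier_mat n m" "B \<in> carrier_mat m k" "i < n" "j < k"
  shows "(A * B) $$ (i,j) = (\<Sum>l<m. A $$ (i,l) * B $$ (l,j))"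
  using assms by (simp add: scalar_prod_def lessThan_atLeast0)

lemma square_mult_carrier [simp]:
  "A \<in> carrier_mat n n \<Longrightarrow> B \<in> carrier_mat n n \<Longrightarrow> A * B \<in> carrier_mat n n"
  by (rule mult_carrier_mat)

lemma square_assoc:
  "A \<in> carrier_mat n n \<Longrightarrow> B \<in> carrier_mat n n \<Longrightarrow> C \<in> carrier_mat n n \<Longrightarrow>
    A * B * C = A * (B * C)"
  by (rule assoc_mult_mat)

lemma adj_mult:
  assumes "A \<in> carrier_mat n m" "B \<in> carrier_mat m k"
  shows "adj (A * B) = adj B * adj A"
proof (rule eq_matI)
  fix i j assume "i < dim_row (adj B * adj A)" "j < dim_col (adj B * adj A)"
  then have ij: "i < k" "j < n" using assms by auto
  have "adj (A * B) $$ (i,j) = cnj ((A * B) $$ (j,i))"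
    using ij assms by simp
  also have "\<dots> = (\<Sum>l<m. adj B $$ (i,l) * adj A $$ (l,j))"
    using ij assms by (subst index_mult_sum[OF assms]) (auto simp: mult.commute)
  also have "\<dots> = (adj B * adj A) $$ (i,j)"
    using ij assms by (subst index_mult_sum[of _ k m _ n]) auto
  finally show "adj (A * B) $$ (i,j) = (adj B * adj A) $$ (i,j)" .
qed (use assms in auto)

lemma adj_minus:
  assumes "A \<in> carrier_mat n m" "B \<in> carrier_mat n m"
  shows "adj (A - B) = adj A - adj B"
  using assms by (intro eq_matI) auto

lemma adj_add:
  assumes "A \<in> carrier_mat n m" "B \<in> carrier_mat n m"
  shows "adj (A + B) = adj A + adj B"
  using assms by (intro eq_matI) auto

lemma tr_mult:
  assumes "A \<in> carrier_mat n m" "B \<in> carrier_mat m n"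
  shows "tr (A * B) = (\<Sum>i<n. \<Sum>l<m. A $$ (i,l) * B $$ (l,i))"
  using assms unfolding tr_def
  by (auto intro!: sum.cong simp: index_mult_sum[OF assms] simp del: index_mult_mat(1))

lemma tr_mult_comm:
  assumes "A \<in> carrier_mat n m" "B \<in> carrier_mat m n"
  shows "tr (A * B) = tr (B * A)"
  unfolding tr_mult[OF assms] tr_mult[OF assms(2,1)]
  by (subst sum.swap) (simp add: mult.commute)

lemma tr_add: "A \<in> carrier_mat n n \<Longrightarrow> B \<in> carrier_mat n n \<Longrightarrow> tr (A + B) = tr A + tr B"
  by (simp add: tr_def sum.distrib)

lemma tr_minus: "A \<in> carrier_mat n n \<Longrightarrow> B \<in> carrier_mat n n \<Longrightarrow> tr (A - B) = tr A - tr B"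
  by (simp add: tr_def sum_subtractf)

lemma tr_smult: "tr (c \<cdot>\<^sub>m A) = c * tr A" if "A \<in> carrier_mat n n"
  using that by (simp add: tr_def sum_distrib_left)

lemma tr_adj_mult_self:
  assumes "B \<in> carrier_mat m n"
  shows "tr (adj B * B) = of_real (\<Sum>i<n. \<Sum>l<m. (cmod (B $$ (l,i)))\<^sup>2)"
  using assms by (subst tr_mult[of _ n m])
    (auto intro!: sum.cong simp: complex_norm_square mult.commute simp del: of_real_power)

lemma unitary_adj: "unitary_mat n U \<Longrightarrow> unitary_mat n (adj U)"
  by (simp add: unitary_mat_def)

lemma unitary_mult:
  assumes "unitary_mat n U" "unitary_mat n V"
  shows "unitary_mat n (U * V)"
proof -
  have c: "U \<in> carrier_mat n n" "V \<in> carrier_mat n n" 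
    and u: "adj U * U = 1\<^sub>m n" "U * adj U = 1\<^sub>m n" "adj V * V = 1\<^sub>m n" "V * adj V = 1\<^sub>m n"
    using assms by (auto simp: unitary_mat_def)
  have ad: "adj (U * V) = adj V * adj U" using adj_mult[OF c] .
  have "adj V * adj U * (U * V) = adj V * ((adj U * U) * V)"
    using c by (simp add: square_assoc[of _ n])
  moreover have "U * V * (adj V * adj U) = U * ((V * adj V) * adj U)"
    using c by (simp add: square_assoc[of _ n])
  ultimately show ?thesis using c by (simp add: unitary_mat_def ad u)
qed

lemma index_conj_diag:
  assumes "U \<in> carrier_mat n m" "i < n" "j < n"
  shows "(U * mat_diag m f * adj U) $$ (i,j) = (\<Sum>k<m. U $$ (i,k) * f k * cnj (U $$ (j,k)))"
  using assms
  by (subst mat_diag_mult_right[of _ n]) (auto simp: scalar_prod_def lessThan_atLeast0 intro!: sum.cong)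

lemma quadratic_form:
  assumes "A \<in> carrier_mat n n" "v \<in> carrier_vec n"
  shows "scalar_prod (map_vec cnj v) (A *\<^sub>v v) = (\<Sum>i<n. \<Sum>j<n. cnj (v $ i) * A $$ (i,j) * v $ j)"
  using assms 
  by (auto simp: scalar_prod_def lessThan_atLeast0 sum_distrib_left mult.assoc intro!: sum.cong)

text \<open>The quadratic form at \<open>v\<close> is the squared norm of \<open>B v\<close>.
  Products such as \<open>Q P Q\<close> or the conjugates of a state are recognised as positive
  through this form.\<close>

lemma psd_adj_mult_self:
  assumes B: "B \<in> carrier_mat m n"
  shows "psd n (adj B * B)"
  unfolding psd_def
proof (intro conjI ballI)
  show c: "adj B * B \<in> carrier_mat n n" using B by auto
  show "adj (adj B * B) = adj B * B" using B by (subst adj_mult[of _ n m _ n]) auto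
  fix v :: "complex Matrix.vec" assume v: "v \<in> carrier_vec n"
  have "scalar_prod (map_vec cnj v) ((adj B * B) *\<^sub>v v)
      = (\<Sum>i<n. \<Sum>j<n. cnj (v $ i) * (\<Sum>l<m. cnj (B $$ (l,i)) * B $$ (l,j)) * v $ j)"
    unfolding quadratic_form[OF c v] using B
    by (intro sum.cong refl) (simp add: index_mult_sum[of _ n m _ n] del: index_mult_mat(1))
  also have "\<dots> = (\<Sum>l<m. \<Sum>i<n. \<Sum>j<n. cnj (B $$ (l,i) * v $ i) * (B $$ (l,j) * v $ j))"
    unfolding sum_distrib_left sum_distrib_right
    by (subst (2) sum.swap, subst sum.swap) (simp add: mult_ac)
  also have "\<dots> = (\<Sum>l<m. cnj (\<Sum>i<n. B $$ (l,i) * v $ i) * (\<Sum>j<n. B $$ (l,j) * v $ j))"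
    by (simp add: sum_product)
  also have "\<dots> = of_real (\<Sum>l<m. (cmod (\<Sum>i<n. B $$ (l,i) * v $ i))\<^sup>2)"
    by (simp only: of_real_sum complex_norm_square mult.commute)
  finally show "0 \<le> Re (scalar_prod (map_vec cnj v) ((adj B * B) *\<^sub>v v))"
    by (simp add: sum_nonneg)
qed

lemma psd_add:
  assumes "psd n A" "psd n B"
  shows "psd n (A + B)"
proof -
  have c: "A \<in> carrier_mat n n" "B \<in> carrier_mat n n" using assms by (auto simp: psd_def)
  show ?thesis
    unfolding psd_def
  proof (intro conjI ballI)
    fix v :: "complex Matrix.vec" assume v: "v \<in> carrier_vec n"
    have "scalar_prod (map_vec cnj v) ((A + B) *\<^sub>v v)
      = scalar_prod (map_vec cnj v) (A *\<^sub>v v) + scalar_prod (map_vec cnj v) (B *\<^sub>v v)"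
      using c v by (simp add: add_mult_distrib_mat_vec scalar_prod_add_distrib[of _ n])
    then show "0 \<le> Re (scalar_prod (map_vec cnj v) ((A + B) *\<^sub>v v))"
      using assms v by (auto simp: psd_def)
  qed (use assms c adj_add[OF c] in \<open>auto simp: psd_def\<close>)
qed

lemma psd_smult:
  assumes "psd n A" "0 \<le> c"
  shows "psd n (complex_of_real c \<cdot>\<^sub>m A)"
proof -
  have A: "A \<in> carrier_mat n n" using assms by (auto simp: psd_def)
  show ?thesis
    unfolding psd_def
  proof (intro conjI ballI)
    show "adj (complex_of_real c \<cdot>\<^sub>m A) = complex_of_real c \<cdot>\<^sub>m A"
    proof (rule eq_matI)
      fix i j assume ij: "i < dim_row (complex_of_real c \<cdot>\<^sub>m A)" "j < dim_col (complex_of_real c \<cdot>\<^sub>m A)"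
      have "adj A $$ (i,j) = A $$ (i,j)" using assms by (simp add: psd_def)
      then show "adj (complex_of_real c \<cdot>\<^sub>m A) $$ (i,j) = (complex_of_real c \<cdot>\<^sub>m A) $$ (i,j)"
        using ij A by simp
    qed (use A in auto)
    fix v :: "complex Matrix.vec" assume v: "v \<in> carrier_vec n"
    have "scalar_prod (map_vec cnj v) ((of_real c \<cdot>\<^sub>m A) *\<^sub>v v)
      = of_real c * scalar_prod (map_vec cnj v) (A *\<^sub>v v)"
      using A v by (simp add: quadratic_form[of _ n] sum_distrib_left mult_ac)
    then show "0 \<le> Re (scalar_prod (map_vec cnj v) ((of_real c \<cdot>\<^sub>m A) *\<^sub>v v))"
      using assms v by (auto simp: psd_def)
  qed (use A in auto)
qed

text \<open>The entry is the quadratic form of \<open>A\<close> at column \<open>i\<close> of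
  \<open>U\<close>. In an eigenbasis of \<open>A\<close> it reads off an eigenvalue, in another
  orthonormal basis the weight of a measurement outcome.\<close>

lemma psd_conj_index:
  assumes "psd n A" "U \<in> carrier_mat n m" "i < m"
  shows "0 \<le> Re ((adj U * A * U) $$ (i,i))"
proof -
  have A: "A \<in> carrier_mat n n" using assms by (auto simp: psd_def)
  have c: "adj U * A \<in> carrier_mat m n" using A assms by auto
  have "(adj U * A * U) $$ (i,i) = (\<Sum>k<n. (\<Sum>l<n. cnj (U $$ (l,i)) * A $$ (l,k)) * U $$ (k,i))"
    using assms A unfolding index_mult_sum[OF c assms(2,3,3)] 
    by (intro sum.cong refl) (simp add: index_mult_sum[of _ m n _ n] del: index_mult_mat(1))
  also have "\<dots> = (\<Sum>l<n. \<Sum>k<n. cnj (U $$ (l,i)) * A $$ (l,k) * U $$ (k,i))"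
    unfolding sum_distrib_right by (rule sum.swap)
  also have "\<dots> = scalar_prod (map_vec cnj (col U i)) (A *\<^sub>v col U i)"
    using assms A by (subst quadratic_form[of _ n]) auto
  finally show ?thesis using assms by (auto simp: psd_def)
qed

section \<open>Spectral decomposition\<close>

text \<open>Deflation needs a unitary whose first column spans a given line. A single reflection
  achieves this without orthonormalizing a whole basis; that the column is only a nonzero multiple
  of \<open>x\<close> is harmless, since eigenvectors may be rescaled.\<close>

lemma householder_unitary:
  fixes x :: "nat \<Rightarrow> complex"
  assumes n: "0 < n" and x: "(\<Sum>i<n. (cmod (x i))\<^sup>2) = 1"
  obtains W c where "unitary_mat n W" "c \<noteq> 0" "\<And>i. i < n \<Longrightarrow> W $$ (i,0) = c * x i"
proof -
  define c where "c = (if x 0 = 0 then 1 else - cnj (x 0) / of_real (cmod (x 0)))"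
  have c1: "cmod c = 1" by (simp add: c_def norm_divide)
  define y where "y i = c * x i" for i
  have y0: "y 0 = - of_real (cmod (x 0))"
    by (simp add: y_def c_def field_simps complex_norm_square[symmetric] power2_eq_square)
  define t where "t = 1 + cmod (x 0)"
  have t: "t > 0" by (simp add: t_def add_pos_nonneg)
  define w where "w i = y i - (if i = 0 then 1 else 0)" for i :: nat
  have w0: "w 0 = - of_real t" by (simp add: w_def y0 t_def)
  have sy: "(\<Sum>k<n. (cmod (y k))\<^sup>2) = 1" using x by (simp add: y_def norm_mult c1)
  have sw: "(\<Sum>k<n. cnj (w k) * w k) = of_real (2 * t)"
  proof -
    have "(\<Sum>k<n. cnj (w k) * w k) = of_real (\<Sum>k<n. (cmod (w k))\<^sup>2)"
      by (simp only: of_real_sum complex_norm_square mult.commute)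
    also have "(\<Sum>k<n. (cmod (w k))\<^sup>2) = (\<Sum>k<n. (cmod (y k))\<^sup>2 + (if k = 0 then 2 * t - 1 else 0))"
    proof (intro sum.cong refl)
      fix k
      show "(cmod (w k))\<^sup>2 = (cmod (y k))\<^sup>2 + (if k = 0 then 2 * t - 1 else 0)"
      proof (cases "k = 0")
        case True
        have "(cmod (w 0))\<^sup>2 = t\<^sup>2" "(cmod (y 0))\<^sup>2 = (cmod (x 0))\<^sup>2"
          by (simp_all add: w0 y0)
        then show ?thesis using True by (simp add: t_def power2_eq_square algebra_simps)
      qed (simp add: w_def)
    qed
    also have "\<dots> = 2 * t" using n by (simp add: sum.distrib sy)
    finally show ?thesis .
  qed
  \<comment> \<open>the reflection exchanging the first unit vector with c x, which is unitary because the
    phase c makes the first entry of c x real and nonpositive\<close>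
  define W where "W = Matrix.mat n n (\<lambda>(i,j). (if i = j then 1 else 0) - w i * cnj (w j) / of_real t)"
  have Wc: "W \<in> carrier_mat n n" by (simp add: W_def)
  have Wadj: "adj W = W" by (rule eq_matI) (auto simp: W_def)
  have WW: "W * W = 1\<^sub>m n"
  proof (rule eq_matI)
    fix i j assume "i < dim_row (1\<^sub>m n :: complex mat)" "j < dim_col (1\<^sub>m n :: complex mat)"
    then have ij: "i < n" "j < n" by auto
    have "(W * W) $$ (i,j) = (\<Sum>k<n. ((if i = k then 1 else 0) - w i * cnj (w k) / of_real t) *
        ((if k = j then 1 else 0) - w k * cnj (w j) / of_real t))"
      using ij unfolding index_mult_sum[OF Wc Wc ij] by (simp add: W_def)
    also have "\<dots> = (\<Sum>k<n. (if i = k then (if i = j then 1 else 0) - w i * cnj (w j) / of_real t else 0)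
        - (if k = j then w i * cnj (w j) / of_real t else 0) + (w i * cnj (w j) / (of_real t)\<^sup>2) * (cnj (w k) * w k))"
      by (intro sum.cong refl) (auto simp: algebra_simps power2_eq_square)
    also have "\<dots> = (if i = j then 1 else 0) - w i * cnj (w j) / of_real t - w i * cnj (w j) / of_real t
        + (w i * cnj (w j) / (of_real t)\<^sup>2) * of_real (2 * t)"
      using ij by (simp add: sum.distrib sum_subtractf sum_distrib_left[symmetric] sum_divide_distrib[symmetric] sw)
    also have "\<dots> = (1\<^sub>m n :: complex mat) $$ (i,j)"
      using t ij by (simp add: field_simps power2_eq_square)
    finally show "(W * W) $$ (i,j) = (1\<^sub>m n :: complex mat) $$ (i,j)" .
  qed (use Wc in auto)
  have "unitary_mat n W" using Wc by (simp add: unitary_mat_def Wadj WW)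
  moreover have "c \<noteq> 0" using c1 by auto
  moreover have "W $$ (i,0) = c * x i" if "i < n" for i
  proof -
    have "W $$ (i,0) = (if i = 0 then 1 else 0) + w i" using that n t by (simp add: W_def w0)
    then show ?thesis by (simp add: w_def y_def)
  qed
  ultimately show ?thesis using that by blast
qed

text \<open>Deflation by induction on the dimension: an eigenvector moved to the first coordinate
  clears the first column below the diagonal, and Hermitian symmetry clears the first row as well.
  What is left is an eigenvalue, real as a diagonal entry, and a smaller Hermitian block
  \<open>B'\<close>.\<close>

lemma hermitian_spectral_decomp:
  assumes "A \<in> carrier_mat n n" "adj A = A"
  obtains U lam where "spectral_decomp n A U lam"
proof -
  have "\<exists>U lam. spectral_decomp n A U lam"
    using assms
  proof (induction n arbitrary: A)
    case 0
    show ?case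
      by (rule exI[of _ "1\<^sub>m 0"], rule exI) (use 0 in \<open>auto simp: spectral_decomp_def unitary_mat_def\<close>)
  next
    case (Suc n)
    let ?N = "Suc n"
    have A: "A \<in> carrier_mat ?N ?N" and Ah: "adj A = A" using Suc.prems by auto
    obtain k where "eigenvalue A k"
      using spectrum_non_empty[OF A] by (auto simp: spectrum_def)
    then obtain v where "eigenvector A v k" by (auto simp: eigenvalue_def)
    then have v: "v \<in> carrier_vec ?N" "v \<noteq> 0\<^sub>v ?N" "A *\<^sub>v v = k \<cdot>\<^sub>v v"
      using A by (auto simp: eigenvector_def)
    define s where "s = (\<Sum>i<?N. (cmod (v $ i))\<^sup>2)"
    have "s > 0"
    proof -
      obtain i where "i < ?N" "v $ i \<noteq> 0" using v(1,2) by (metis carrier_vecD eq_vecI index_zero_vec)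
      then show ?thesis unfolding s_def by (intro sum_pos2[of _ i]) auto
    qed
    define x where "x i = v $ i / of_real (sqrt s)" for i
    have "(\<Sum>i<?N. (cmod (x i))\<^sup>2) = 1"
      using \<open>s > 0\<close> by (simp add: x_def norm_divide power_divide sum_divide_distrib[symmetric] s_def[symmetric]
        del: sum.lessThan_Suc)
    then obtain W c where W: "unitary_mat ?N W" "c \<noteq> 0" and W0: "\<And>i. i < ?N \<Longrightarrow> W $$ (i,0) = c * x i"
      by (rule householder_unitary[rotated]) auto
    have Wc: "W \<in> carrier_mat ?N ?N" and WW: "adj W * W = 1\<^sub>m ?N" "W * adj W = 1\<^sub>m ?N"
      using W by (auto simp: unitary_mat_def)
    define B where "B = adj W * A * W"
    have Bc: "B \<in> carrier_mat ?N ?N" using Wc A by (simp add: B_def)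
    have Bh: "adj B = B"
      using Wc A by (simp add: B_def adj_mult[of _ ?N ?N _ ?N] square_assoc[of _ ?N] Ah)
    have Bherm: "B $$ (i,j) = cnj (B $$ (j,i))" if "i < ?N" "j < ?N" for i j
      using that Bc index_adj[of i B j] by (simp add: Bh)
    have B0: "B $$ (i,0) = (if i = 0 then k else 0)" if i: "i < ?N" for i
    proof -
      have AW: "(A * W) $$ (l,0) = k * W $$ (l,0)" if l: "l < ?N" for l
      proof -
        have "(A * W) $$ (l,0) = (\<Sum>j<?N. A $$ (l,j) * W $$ (j,0))"
          using l by (intro index_mult_sum[OF A Wc]) auto
        also have "\<dots> = c / of_real (sqrt s) * (\<Sum>j<?N. A $$ (l,j) * v $ j)"
          unfolding sum_distrib_left by (intro sum.cong refl) (simp add: W0 x_def)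
        also have "(\<Sum>j<?N. A $$ (l,j) * v $ j) = (A *\<^sub>v v) $ l"
          using A v(1) l by (simp add: scalar_prod_def lessThan_atLeast0)
        also have "\<dots> = k * v $ l" using v l by simp
        finally show ?thesis using l by (simp add: W0 x_def)
      qed
      have "B $$ (i,0) = (adj W * (A * W)) $$ (i,0)"
        using Wc A by (simp add: B_def square_assoc[of _ ?N])
      also have "\<dots> = (\<Sum>l<?N. adj W $$ (i,l) * (A * W) $$ (l,0))"
        using Wc A i by (intro index_mult_sum[of _ ?N ?N _ ?N]) auto
      also have "\<dots> = k * (\<Sum>l<?N. adj W $$ (i,l) * W $$ (l,0))"
        unfolding sum_distrib_left by (intro sum.cong refl) (simp only: AW lessThan_iff mult_ac)
      also have "(\<Sum>l<?N. adj W $$ (i,l) * W $$ (l,0)) = (adj W * W) $$ (i,0)"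
        using Wc i by (intro index_mult_sum[of _ ?N ?N _ ?N, symmetric]) auto
      finally show ?thesis using i by (simp add: WW)
    qed
    have kreal: "k = of_real (Re k)"
      using Bherm[of 0 0] B0[of 0] by (simp add: complex_eq_iff)
    have B0': "B $$ (0,j) = (if j = 0 then k else 0)" if j: "j < ?N" for j
      using Bherm[of 0 j] B0[of j] B0[of 0] j by (auto split: if_splits)
    define B' where "B' = Matrix.mat n n (\<lambda>(i,j). B $$ (Suc i, Suc j))"
    have "adj B' = B'"
      by (rule eq_matI) (auto simp: B'_def intro: Bherm[symmetric])
    moreover have "B' \<in> carrier_mat n n" by (simp add: B'_def)
    ultimately obtain U' lam' where U': "spectral_decomp n B' U' lam'" using Suc.IH by blast
    then have U'c: "U' \<in> carrier_mat n n" and UU: "adj U' * U' = 1\<^sub>m n" "U' * adj U' = 1\<^sub>m n"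
      and B'eq: "B' = U' * mat_diag n (\<lambda>i. complex_of_real (lam' i)) * adj U'"
      by (auto simp: spectral_decomp_def unitary_mat_def)
    define V where "V = Matrix.mat ?N ?N (\<lambda>(i,j). if i = 0 then (if j = 0 then 1 else 0)
       else if j = 0 then 0 else U' $$ (i - 1, j - 1))"
    have Vc: "V \<in> carrier_mat ?N ?N" by (simp add: V_def)
    define lam where "lam = case_nat (Re k) lam'"
    have V1: "V * adj V = 1\<^sub>m ?N"
    proof (rule eq_matI)
      fix i j assume "i < dim_row (1\<^sub>m ?N :: complex mat)" "j < dim_col (1\<^sub>m ?N :: complex mat)"
      then have ij: "i < ?N" "j < ?N" by auto
      have *: "(V * adj V) $$ (i,j) = (\<Sum>l<?N. V $$ (i,l) * cnj (V $$ (j,l)))"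
        using ij Vc by (subst index_mult_sum[of _ ?N ?N _ ?N]) auto
      have **: "(\<Sum>l<n. U' $$ (i',l) * cnj (U' $$ (j',l))) = (if i' = j' then 1 else 0)" if "i' < n" "j' < n" for i' j'
      proof -
        have "(U' * adj U') $$ (i',j') = (\<Sum>l<n. U' $$ (i',l) * cnj (U' $$ (j',l)))"
          using that U'c by (subst index_mult_sum[of _ n n _ n]) auto
        then show ?thesis using that by (simp add: UU)
      qed
      show "(V * adj V) $$ (i,j) = (1\<^sub>m ?N :: complex mat) $$ (i,j)"
        unfolding * sum.lessThan_Suc_shift using ij
        by (cases i; cases j) (auto simp: V_def **)
    qed (use Vc in auto)
    then have V2: "adj V * V = 1\<^sub>m ?N"
      using Vc mat_mult_left_right_inverse[of V ?N "adj V"] by simp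
    have BV: "B = V * mat_diag ?N (\<lambda>i. complex_of_real (lam i)) * adj V"
    proof (rule eq_matI)
      fix i j assume "i < dim_row (V * mat_diag ?N (\<lambda>i. complex_of_real (lam i)) * adj V)"
        "j < dim_col (V * mat_diag ?N (\<lambda>i. complex_of_real (lam i)) * adj V)"
      then have ij: "i < ?N" "j < ?N" using Vc by auto
      have **: "B $$ (Suc i', Suc j') = (\<Sum>l<n. U' $$ (i',l) * of_real (lam' l) * cnj (U' $$ (j',l)))"
        if "i' < n" "j' < n" for i' j'
        using index_conj_diag[OF U'c that, of "\<lambda>i. complex_of_real (lam' i)"] that
        by (simp add: B'eq[symmetric]) (simp add: B'_def)
      show "B $$ (i,j) = (V * mat_diag ?N (\<lambda>i. complex_of_real (lam i)) * adj V) $$ (i,j)"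
        unfolding index_conj_diag[OF Vc ij] sum.lessThan_Suc_shift using ij
        by (cases i; cases j) (auto simp: V_def ** B0 B0' lam_def kreal[symmetric])
    qed (use Bc Vc in auto)
    have VU: "unitary_mat ?N V" using Vc V1 V2 by (simp add: unitary_mat_def)
    have "W * B * adj W = (W * adj W) * A * (W * adj W)"
      unfolding B_def using Wc A by (simp add: square_assoc[of _ ?N])
    then have "A = W * B * adj W" using WW A by simp
    also have "\<dots> = (W * V) * mat_diag ?N (\<lambda>i. complex_of_real (lam i)) * adj (W * V)"
      unfolding BV using Wc Vc by (simp add: square_assoc[of _ ?N] adj_mult[of _ ?N ?N _ ?N])
    finally show ?case using unitary_mult[OF W(1) VU] unfolding spectral_decomp_def by blast
  qed
  then show ?thesis using that by blast
qed

section \<open>Functional calculus and commutation\<close>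

lemma intertwine_diag_function:
  fixes lam :: "nat \<Rightarrow> real" and mu :: "nat \<Rightarrow> real" and f :: "real \<Rightarrow> real"
  assumes X: "X \<in> carrier_mat n m"
    and eq: "mat_diag n (\<lambda>i. complex_of_real (lam i)) * X = X * mat_diag m (\<lambda>i. complex_of_real (mu i))"
  shows "mat_diag n (\<lambda>i. complex_of_real (f (lam i))) * X = X * mat_diag m (\<lambda>i. complex_of_real (f (mu i)))"
proof (rule eq_matI)
  fix i j assume "i < dim_row (X * mat_diag m (\<lambda>i. complex_of_real (f (mu i))))" 
    "j < dim_col (X * mat_diag m (\<lambda>i. complex_of_real (f (mu i))))"
  then have ij: "i < n" "j < m" using X by (auto simp: mat_diag_def)
  have "(mat_diag n (\<lambda>i. complex_of_real (lam i)) * X) $$ (i,j) = (X * mat_diag m (\<lambda>i. complex_of_real (mu i))) $$ (i,j)"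
    using eq by simp
  then have "X $$ (i,j) = 0 \<or> lam i = mu j"
    using ij X by (simp add: mat_diag_mult_left[OF X] mat_diag_mult_right[OF X])
  then show "(mat_diag n (\<lambda>i. complex_of_real (f (lam i))) * X) $$ (i,j)
      = (X * mat_diag m (\<lambda>i. complex_of_real (f (mu i)))) $$ (i,j)"
    using ij X by (auto simp: mat_diag_mult_left[OF X] mat_diag_mult_right[OF X])
qed (use X in \<open>auto simp: mat_diag_def\<close>)

text \<open>In the two eigenbases the relation \<open>A * X = X * B\<close> says that the entry
  \<open>(i,j)\<close> of the transformed \<open>X\<close> vanishes unless
  \<open>lam i = mu j\<close>, so it survives applying \<open>f\<close> to both spectra. With
  \<open>X\<close> the identity this gives independence of the decomposition; with
  \<open>A = B\<close> it shows that functions of \<open>A\<close> commute with whatever commutes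
  with \<open>A\<close>.\<close>

lemma spectral_decomp_intertwine:
  assumes A: "spectral_decomp n A U lam" and B: "spectral_decomp n B V mu"
    and X: "X \<in> carrier_mat n n" and eq: "A * X = X * B"
  shows "(U * mat_diag n (\<lambda>i. complex_of_real (f (lam i))) * adj U) * X
       = X * (V * mat_diag n (\<lambda>i. complex_of_real (f (mu i))) * adj V)"
proof -
  have U: "U \<in> carrier_mat n n" "adj U * U = 1\<^sub>m n" "U * adj U = 1\<^sub>m n"
    and V: "V \<in> carrier_mat n n" "adj V * V = 1\<^sub>m n" "V * adj V = 1\<^sub>m n"
    using A B by (auto simp: spectral_decomp_def unitary_mat_def)
  define D where "D g lam = mat_diag n (\<lambda>i. complex_of_real (g (lam i)))" 
    for g :: "real \<Rightarrow> real" and lam :: "nat \<Rightarrow> real"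
  have D: "D g l \<in> carrier_mat n n" for g l by (simp add: D_def)
  have AD: "A = U * D id lam * adj U" "B = V * D id mu * adj V"
    using A B by (simp_all add: spectral_decomp_def D_def)
  note sa = square_assoc[of _ n]
  have cancel: "adj U * (U * Y) = Y" "U * (adj U * Y) = Y" "adj V * (V * Y) = Y" "V * (adj V * Y) = Y"
    if "Y \<in> carrier_mat n n" for Y
    using that U V by (simp_all add: sa[symmetric])
  have "adj U * (A * X) * V = adj U * (X * B) * V" using eq by simp
  then have "D id lam * (adj U * X * V) = (adj U * X * V) * D id mu"
    using U V X D by (simp add: AD sa cancel right_mult_one_mat[of _ n n])
  then have "D f lam * (adj U * X * V) = (adj U * X * V) * D f mu"
    using intertwine_diag_function[of "adj U * X * V" n n lam mu f] U V X by (simp add: D_def)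
  then have "U * (D f lam * (adj U * X * V)) * adj V = U * ((adj U * X * V) * D f mu) * adj V" by simp
  then show ?thesis
    using U V X D by (simp add: sa cancel right_mult_one_mat[of _ n n]) (simp add: D_def)
qed

text \<open>Discharges the choice in \<open>mfun\<close>: two decompositions of \<open>A\<close> are
  intertwined by the identity matrix and hence yield the same \<open>f(A)\<close>.\<close>

lemma mfun_eq:
  assumes "spectral_decomp n A U lam"
  shows "mfun f A = U * mat_diag n (\<lambda>i. complex_of_real (f (lam i))) * adj U"
proof -
  have U: "U \<in> carrier_mat n n" using assms by (auto simp: spectral_decomp_def unitary_mat_def)
  have A: "A \<in> carrier_mat n n" using assms U by (auto simp: spectral_decomp_def)
  then have n: "dim_row A = n" by auto
  show ?thesis
    unfolding mfun_def n
  proof (rule someI2_ex)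
    show "\<exists>M V mu. spectral_decomp n A V mu \<and> M = V * mat_diag n (\<lambda>i. complex_of_real (f (mu i))) * adj V"
      using assms by blast
    fix M assume "\<exists>V mu. spectral_decomp n A V mu \<and> M = V * mat_diag n (\<lambda>i. complex_of_real (f (mu i))) * adj V"
    then obtain V mu where V: "spectral_decomp n A V mu" 
      and M: "M = V * mat_diag n (\<lambda>i. complex_of_real (f (mu i))) * adj V" by blast
    have Vc: "V \<in> carrier_mat n n" using V by (auto simp: spectral_decomp_def unitary_mat_def)
    show "M = U * mat_diag n (\<lambda>i. complex_of_real (f (lam i))) * adj U"
      using spectral_decomp_intertwine[OF V assms, of "1\<^sub>m n" f] A Vc U M by simp
  qed
qed

lemma spectral_decomp_carrier:
  assumes "spectral_decomp n A U lam"
  shows "U \<in> carrier_mat n n" "A \<in> carrier_mat n n"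
  using assms by (auto simp: spectral_decomp_def unitary_mat_def)

lemma psd_spectral_decomp:
  assumes "psd n A"
  obtains U lam where "spectral_decomp n A U lam" "\<And>i. i < n \<Longrightarrow> 0 \<le> lam i"
proof -
  obtain U lam where d: "spectral_decomp n A U lam"
    using hermitian_spectral_decomp[of A n] assms by (auto simp: psd_def)
  have U: "U \<in> carrier_mat n n" "adj U * U = 1\<^sub>m n" 
    and A: "A = U * mat_diag n (\<lambda>i. complex_of_real (lam i)) * adj U"
    using d by (auto simp: spectral_decomp_def unitary_mat_def)
  have "adj U * A * U = (adj U * U) * mat_diag n (\<lambda>i. complex_of_real (lam i)) * (adj U * U)"
    unfolding A using U(1) by (simp add: square_assoc[of _ n])
  then have "adj U * A * U = mat_diag n (\<lambda>i. complex_of_real (lam i))" 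
    using U by (metis left_mult_one_mat mat_diag_dim right_mult_one_mat)
  then have "0 \<le> lam i" if "i < n" for i
    using psd_conj_index[OF assms U(1) that] that by (simp add: mat_diag_def)
  then show ?thesis using that d by blast
qed

section \<open>Positive matrices as Gram matrices\<close>

lemma adj_mat_diag: "adj (mat_diag n (\<lambda>i. complex_of_real (f i))) = mat_diag n (\<lambda>i. complex_of_real (f i))"
  by (rule eq_matI) (auto simp: mat_diag_def)

lemma psd_conj_diag:
  assumes U: "U \<in> carrier_mat n n" and "\<And>i. i < n \<Longrightarrow> 0 \<le> lam i"
  obtains B where "B \<in> carrier_mat n n" "U * mat_diag n (\<lambda>i. complex_of_real (lam i)) * adj U = adj B * B"
proof -
  define E where "E = mat_diag n (\<lambda>i. complex_of_real (sqrt (lam i)))"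
  have E: "E \<in> carrier_mat n n" by (simp add: E_def)
  have EE: "E * E = mat_diag n (\<lambda>i. complex_of_real (lam i))"
    unfolding E_def mat_diag_diag using assms(2)
    by (intro eq_matI) (auto simp: mat_diag_def of_real_mult[symmetric] simp del: of_real_mult)
  have "adj (E * adj U) * (E * adj U) = U * (E * E) * adj U"
    using U E by (simp add: adj_mult[of _ n n _ n] square_assoc[of _ n]) (simp add: E_def adj_mat_diag)
  then show ?thesis using that[of "E * adj U"] U E by (simp add: EE)
qed

lemma psd_factor:
  assumes "psd n A"
  obtains B where "B \<in> carrier_mat n n" "A = adj B * B"
proof -
  obtain U lam where d: "spectral_decomp n A U lam" "\<And>i. i < n \<Longrightarrow> 0 \<le> lam i"
    using psd_spectral_decomp[OF assms] by blast
  obtain B where "B \<in> carrier_mat n n" "U * mat_diag n (\<lambda>i. complex_of_real (lam i)) * adj U = adj B * B"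
    using psd_conj_diag[of U n lam] d spectral_decomp_carrier[OF d(1)] by blast
  then show ?thesis using that[of B] d(1) by (auto simp: spectral_decomp_def)
qed

text \<open>With Gram factors \<open>C\<close> of \<open>A\<close> and \<open>D\<close> of
  \<open>B\<close>, cyclicity turns the trace into the squared Hilbert-Schmidt norm of
  \<open>C * adj D\<close>.\<close>

lemma tr_psd_mult_nonneg:
  assumes "psd n A" "psd n B"
  shows "0 \<le> Re (tr (A * B))"
proof -
  obtain C D where C: "C \<in> carrier_mat n n" "A = adj C * C" and D: "D \<in> carrier_mat n n" "B = adj D * D"
    using psd_factor assms by metis
  have "tr (A * B) = tr ((adj C * C * adj D) * D)" using C D by (simp add: square_assoc[of _ n])
  also have "\<dots> = tr (D * (adj C * C * adj D))" using C D by (intro tr_mult_comm[of _ n n]) auto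
  also have "D * (adj C * C * adj D) = adj (C * adj D) * (C * adj D)"
    using C D by (simp add: adj_mult[of _ n n _ n] square_assoc[of _ n])
  finally show ?thesis using C D by (simp add: tr_adj_mult_self[of _ n n] sum_nonneg)
qed

section \<open>Kronecker powers\<close>

text \<open>Row-major reading of an index of a tensor product as a pair of indices. It is what
  factorizes sums over the basis of a Kronecker product.\<close>

lemma sum_div_mod:
  fixes f :: "nat \<Rightarrow> nat \<Rightarrow> 'a::comm_monoid_add"
  shows "(\<Sum>k<m * q. f (k div q) (k mod q)) = (\<Sum>a<m. \<Sum>b<q. f a b)"
proof -
  have lt: "a * q + b < m * q" if "a < m" "b < q" for a b
  proof -
    have "a * q + b < Suc a * q" using that by simp
    also have "\<dots> \<le> m * q" using that by (intro mult_le_mono1) simp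
    finally show ?thesis .
  qed
  have "(\<Sum>a<m. \<Sum>b<q. f a b) = (\<Sum>(a,b)\<in>{..<m} \<times> {..<q}. f a b)"
    by (rule sum.cartesian_product)
  also have "\<dots> = (\<Sum>k<m * q. f (k div q) (k mod q))"
    by (rule sum.reindex_bij_witness[where j = "\<lambda>(a,b). a * q + b" and i = "\<lambda>k. (k div q, k mod q)"])
       (auto simp: lt less_mult_imp_div_less intro!: mod_less_divisor intro: gr0I)
  finally show ?thesis by simp
qed

lemma dim_kron [simp]:
  "dim_row (kron A B) = dim_row A * dim_row B" "dim_col (kron A B) = dim_col A * dim_col B"
  by (simp_all add: kron_def)

lemma kron_carrier [simp]:
  "A \<in> carrier_mat n m \<Longrightarrow> B \<in> carrier_mat p q \<Longrightarrow> kron A B \<in> carrier_mat (n * p) (m * q)"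
  by (auto simp: kron_def)

lemma index_kron:
  "A \<in> carrier_mat n m \<Longrightarrow> B \<in> carrier_mat p q \<Longrightarrow> i < n * p \<Longrightarrow> j < m * q \<Longrightarrow>
    kron A B $$ (i,j) = A $$ (i div p, j div q) * B $$ (i mod p, j mod q)"
  by (auto simp: kron_def)

lemma mod_less_of_less_mult: "i < n * p \<Longrightarrow> i mod p < p" for i n p :: nat
  by (cases "p = 0") auto

lemma kron_mult:
  assumes "A \<in> carrier_mat n m" "B \<in> carrier_mat p q" "C \<in> carrier_mat m k" "D \<in> carrier_mat q l"
  shows "kron A B * kron C D = kron (A * C) (B * D)"
proof (rule eq_matI)
  fix i j assume "i < dim_row (kron (A * C) (B * D))" "j < dim_col (kron (A * C) (B * D))"
  then have ij: "i < n * p" "j < k * l" using assms by auto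
  have ij': "i div p < n" "i mod p < p" "j div l < k" "j mod l < l"
    using ij by (auto simp: less_mult_imp_div_less mod_less_of_less_mult)
  have "(kron A B * kron C D) $$ (i,j) = (\<Sum>x<m * q. kron A B $$ (i,x) * kron C D $$ (x,j))"
    using ij assms by (intro index_mult_sum) auto
  also have "\<dots> = (\<Sum>x<m * q. (A $$ (i div p, x div q) * B $$ (i mod p, x mod q)) *
      (C $$ (x div q, j div l) * D $$ (x mod q, j mod l)))"
    using ij by (intro sum.cong refl) (simp add: index_kron[OF assms(1,2)] index_kron[OF assms(3,4)])
  also have "\<dots> = (\<Sum>a<m. \<Sum>b<q. (A $$ (i div p, a) * B $$ (i mod p, b)) *
      (C $$ (a, j div l) * D $$ (b, j mod l)))"
    by (rule sum_div_mod)
  also have "\<dots> = (\<Sum>a<m. A $$ (i div p, a) * C $$ (a, j div l)) * (\<Sum>b<q. B $$ (i mod p, b) * D $$ (b, j mod l))"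
    unfolding sum_product by (intro sum.cong refl) (simp add: mult_ac)
  also have "\<dots> = (A * C) $$ (i div p, j div l) * (B * D) $$ (i mod p, j mod l)"
    using index_mult_sum[OF assms(1,3) ij'(1,3)] index_mult_sum[OF assms(2,4) ij'(2,4)] by simp
  also have "\<dots> = kron (A * C) (B * D) $$ (i,j)"
    using ij assms by (subst index_kron[of _ n k _ p l]) auto
  finally show "(kron A B * kron C D) $$ (i,j) = kron (A * C) (B * D) $$ (i,j)" .
qed (use assms in auto)

lemma kron_assoc: "kron (kron A B) C = kron A (kron B C)"
proof (rule eq_matI)
  fix i j assume "i < dim_row (kron A (kron B C))" "j < dim_col (kron A (kron B C))"
  then have i: "i < dim_row A * dim_row B * dim_row C" and j: "j < dim_col A * dim_col B * dim_col C"
    by (auto simp: mult_ac)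
  have *: "i div c < a * b" "i div (b * c) = i div c div b" "i mod (b * c) div c = i div c mod b"
    "i mod (b * c) mod c = i mod c" "i mod (b * c) < b * c"
    if "i < a * b * c" for a b c i :: nat
  proof -
    have c: "c > 0" "b > 0" using that by (auto intro: gr0I)
    show "i div c < a * b" using that by (rule less_mult_imp_div_less)
    show "i div (b * c) = i div c div b" by (metis div_mult2_eq mult.commute)
    have "i mod (b * c) = c * (i div c mod b) + i mod c" by (metis mod_mult2_eq mult.commute)
    then show "i mod (b * c) div c = i div c mod b" "i mod (b * c) mod c = i mod c"
      using c by auto
    show "i mod (b * c) < b * c" using c by simp
  qed
  show "kron (kron A B) C $$ (i,j) = kron A (kron B C) $$ (i,j)"
    using i j *[OF i] *[OF j] by (simp add: kron_def mult_ac)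
qed (auto simp: mult_ac)

lemma kron_one_right [simp]: "kron A (1\<^sub>m (Suc 0)) = A"
  by (rule eq_matI) (auto simp: kron_def)

lemma kron_one_left [simp]: "kron (1\<^sub>m (Suc 0)) A = A"
  by (rule eq_matI) (auto simp: kron_def)

lemma kron_one_one: "kron (1\<^sub>m n) (1\<^sub>m m) = 1\<^sub>m (n * m)"
proof (rule eq_matI)
  fix i j assume "i < dim_row (1\<^sub>m (n * m) :: complex mat)" "j < dim_col (1\<^sub>m (n * m) :: complex mat)"
  then have ij: "i < n * m" "j < n * m" by auto
  have "i = j \<longleftrightarrow> i div m = j div m \<and> i mod m = j mod m"
    by (metis div_mult_mod_eq)
  then show "kron (1\<^sub>m n) (1\<^sub>m m) $$ (i,j) = (1\<^sub>m (n * m) :: complex mat) $$ (i,j)"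
    using ij by (auto simp: kron_def less_mult_imp_div_less mod_less_of_less_mult)
qed auto

lemma adj_kron: "adj (kron A B) = kron (adj A) (adj B)"
  by (rule eq_matI) (auto simp: kron_def less_mult_imp_div_less mod_less_of_less_mult)

lemma tr_kron:
  assumes "A \<in> carrier_mat n n" "B \<in> carrier_mat m m"
  shows "tr (kron A B) = tr A * tr B"
proof -
  have "tr (kron A B) = (\<Sum>i<n * m. A $$ (i div m, i div m) * B $$ (i mod m, i mod m))"
    using assms unfolding tr_def by (intro sum.cong) (auto simp: index_kron[OF assms])
  also have "\<dots> = (\<Sum>a<n. \<Sum>b<m. A $$ (a,a) * B $$ (b,b))" by (rule sum_div_mod)
  finally show ?thesis using assms by (simp add: tr_def sum_product)
qed

lemma kron_mat_diag:
  "kron (mat_diag n f) (mat_diag m g) = mat_diag (n * m) (\<lambda>i. f (i div m) * g (i mod m))"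
proof (rule eq_matI)
  fix i j assume "i < dim_row (mat_diag (n * m) (\<lambda>i. f (i div m) * g (i mod m)))" 
    "j < dim_col (mat_diag (n * m) (\<lambda>i. f (i div m) * g (i mod m)))"
  then have ij: "i < n * m" "j < n * m" by (auto simp: mat_diag_def)
  have "i = j \<longleftrightarrow> i div m = j div m \<and> i mod m = j mod m"
    by (metis div_mult_mod_eq)
  then show "kron (mat_diag n f) (mat_diag m g) $$ (i,j) = mat_diag (n * m) (\<lambda>i. f (i div m) * g (i mod m)) $$ (i,j)"
    using ij by (auto simp: kron_def mat_diag_def less_mult_imp_div_less mod_less_of_less_mult)
qed (auto simp: mat_diag_def)

lemma kron_minus_left:
  assumes "A \<in> carrier_mat n m" "B \<in> carrier_mat n m"
  shows "kron (A - B) C = kron A C - kron B C"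
  using assms
  by (intro eq_matI) (auto simp: kron_def less_mult_imp_div_less mod_less_of_less_mult algebra_simps)

lemma kpow_0 [simp]: "kpow 0 A = 1\<^sub>m 1"
  by (simp add: kpow_def)

lemma kpow_Suc [simp]: "kpow (Suc n) A = kron A (kpow n A)"
  by (simp add: kpow_def)

lemma kpow_carrier [simp]: "A \<in> carrier_mat d d \<Longrightarrow> kpow n A \<in> carrier_mat (d ^ n) (d ^ n)"
  by (induction n) auto

lemma kpow_mult:
  assumes "A \<in> carrier_mat d d" "B \<in> carrier_mat d d"
  shows "kpow n (A * B) = kpow n A * kpow n B"
proof (induction n)
  case (Suc n)
  show ?case
    using assms by (simp add: Suc kron_mult[of _ d d _ "d ^ n" "d ^ n" _ d _ "d ^ n"])
qed simp

lemma adj_kpow: "adj (kpow n A) = kpow n (adj A)"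
  by (induction n) (auto simp: adj_kron)

lemma kpow_one: "kpow n (1\<^sub>m d) = 1\<^sub>m (d ^ n)"
  by (induction n) (auto simp: kron_one_one)

lemma kpow_add: "kpow (m + n) A = kron (kpow m A) (kpow n A)"
  by (induction m) (auto simp: kron_assoc)

text \<open>Grouping of copies: \<open>m * k\<close> copies of a system are \<open>k\<close> copies
  of a block of \<open>m\<close>. This is a literal equality of matrices because the row-major
  Kronecker product is strictly associative.\<close>

lemma kpow_kpow: "kpow k (kpow m A) = kpow (m * k) A"
  by (induction k) (auto simp: kpow_add)

lemma tr_kpow: "A \<in> carrier_mat d d \<Longrightarrow> tr (kpow n A) = tr A ^ n"
proof (induction n)
  case (Suc n)
  then show ?case by (simp add: tr_kron[of _ d _ "d ^ n"])
qed (simp add: tr_def)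

lemma unitary_kpow: "unitary_mat d U \<Longrightarrow> unitary_mat (d ^ n) (kpow n U)"
  by (simp add: unitary_mat_def adj_kpow kpow_mult[of _ d, symmetric] kpow_one)

text \<open>A basis index \<open>i < d ^ k\<close> of the \<open>k\<close>-fold tensor power is the word of its \<open>k\<close> base-\<open>d\<close> digits.\<close>

fun digit_prod :: "nat \<Rightarrow> nat \<Rightarrow> (nat \<Rightarrow> real) \<Rightarrow> nat \<Rightarrow> real" where
  "digit_prod d 0 f i = 1"
| "digit_prod d (Suc k) f i = f (i div d ^ k) * digit_prod d k f (i mod d ^ k)"

fun digit_sum :: "nat \<Rightarrow> nat \<Rightarrow> (nat \<Rightarrow> real) \<Rightarrow> nat \<Rightarrow> real" where
  "digit_sum d 0 f i = 0"
| "digit_sum d (Suc k) f i = f (i div d ^ k) + digit_sum d k f (i mod d ^ k)"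

lemma kpow_mat_diag:
  "kpow k (mat_diag d (\<lambda>i. complex_of_real (f i))) = mat_diag (d ^ k) (\<lambda>i. complex_of_real (digit_prod d k f i))"
proof (induction k)
  case 0
  show ?case by (rule eq_matI) (auto simp: mat_diag_def)
qed (simp add: kron_mat_diag)

text \<open>A diagonal entry of a Kronecker product is a product of diagonal entries of the factors.
  This is how a measurement of a product state yields independent digits even in a basis that does
  not diagonalize the state.\<close>

lemma kpow_index_diag:
  assumes A: "A \<in> carrier_mat d d" and f: "\<And>i. i < d \<Longrightarrow> A $$ (i,i) = complex_of_real (f i)" and "i < d ^ k"
  shows "kpow k A $$ (i,i) = complex_of_real (digit_prod d k f i)"
  using assms(3)
proof (induction k arbitrary: i)
  case (Suc k)
  then have i: "i < d * d ^ k" by simp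
  then have "i div d ^ k < d" "i mod d ^ k < d ^ k"
    by (auto simp: less_mult_imp_div_less mod_less_of_less_mult)
  then show ?case
    using index_kron[OF A kpow_carrier[OF A, of k] i i] Suc.IH f by simp
qed simp

lemma spectral_decomp_kpow:
  assumes "spectral_decomp d A U lam"
  shows "spectral_decomp (d ^ k) (kpow k A) (kpow k U) (digit_prod d k lam)"
proof -
  have U: "unitary_mat d U" "U \<in> carrier_mat d d" 
    and A: "A = U * mat_diag d (\<lambda>i. complex_of_real (lam i)) * adj U"
    using assms by (auto simp: spectral_decomp_def unitary_mat_def)
  have "kpow k A = kpow k U * kpow k (mat_diag d (\<lambda>i. complex_of_real (lam i))) * kpow k (adj U)"
    unfolding A using U by (simp add: kpow_mult[of _ d])
  then show ?thesis
    using unitary_kpow[OF U(1)] by (simp add: spectral_decomp_def kpow_mat_diag adj_kpow)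
qed

lemma digit_prod_nonneg:
  "(\<And>i. i < d \<Longrightarrow> 0 \<le> f i) \<Longrightarrow> i < d ^ k \<Longrightarrow> 0 \<le> digit_prod d k f i"
proof (induction k arbitrary: i)
  case (Suc k)
  then have i: "i < d * d ^ k" by simp
  then have "i div d ^ k < d" "i mod d ^ k < d ^ k"
    by (auto simp: less_mult_imp_div_less mod_less_of_less_mult)
  then show ?case using Suc by simp
qed simp

text \<open>Positivity of the product forces every factor to be positive, and then \<open>ln\<close>
  splits; a zero factor would contribute the default value \<open>ln 0 = 0\<close>.\<close>

lemma ln_digit_prod:
  "(\<And>i. i < d \<Longrightarrow> 0 \<le> f i) \<Longrightarrow> i < d ^ k \<Longrightarrow> 0 < digit_prod d k f i \<Longrightarrow>
    ln (digit_prod d k f i) = digit_sum d k (\<lambda>i. ln (f i)) i"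
proof (induction k arbitrary: i)
  case (Suc k)
  then have i: "i < d * d ^ k" by simp
  then have *: "i div d ^ k < d" "i mod d ^ k < d ^ k"
    by (auto simp: less_mult_imp_div_less mod_less_of_less_mult)
  have "0 \<le> f (i div d ^ k)" "0 \<le> digit_prod d k f (i mod d ^ k)"
    using Suc * by (auto intro: digit_prod_nonneg)
  then have "0 < f (i div d ^ k)" "0 < digit_prod d k f (i mod d ^ k)"
    using Suc.prems(3) by (auto simp: less_le)
  then show ?case using Suc.IH[OF Suc.prems(1) *(2)] by (simp add: ln_mult)
qed simp

lemma psd_kpow:
  assumes "psd d A"
  shows "psd (d ^ k) (kpow k A)"
proof -
  obtain U lam where d: "spectral_decomp d A U lam" "\<And>i. i < d \<Longrightarrow> 0 \<le> lam i"
    using psd_spectral_decomp[OF assms] by blast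
  note dk = spectral_decomp_kpow[OF d(1), of k]
  obtain B where B: "B \<in> carrier_mat (d ^ k) (d ^ k)" 
    "kpow k U * mat_diag (d ^ k) (\<lambda>i. complex_of_real (digit_prod d k lam i)) * adj (kpow k U) = adj B * B"
    using psd_conj_diag[of "kpow k U" "d ^ k" "digit_prod d k lam"] spectral_decomp_carrier[OF dk] digit_prod_nonneg d(2)
    by blast
  then show ?thesis using dk psd_adj_mult_self[OF B(1)] by (simp add: spectral_decomp_def)
qed

section \<open>Moments of a word of independent digits\<close>

lemma digit_prod_sum: "(\<Sum>i<d ^ k. digit_prod d k p i) = (\<Sum>i<d. p i) ^ k"
proof (induction k)
  case (Suc k)
  have "(\<Sum>i<d * d ^ k. p (i div d ^ k) * digit_prod d k p (i mod d ^ k))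
      = (\<Sum>a<d. \<Sum>b<d ^ k. p a * digit_prod d k p b)"
    by (rule sum_div_mod)
  then show ?case by (simp add: sum_product[symmetric] Suc.IH)
qed simp

text \<open>Under the weight \<open>digit_prod d k p\<close> the digits of a word are independent
  with law \<open>p\<close>, so their variances add. The auxiliary identity \<open>first\<close>,
  the vanishing of the centred mean, removes the cross term when a digit is split off.\<close>

lemma digit_variance:
  assumes p: "(\<Sum>i<d. p i) = 1" and mu: "(\<Sum>i<d. p i * L i) = mu"
  shows "(\<Sum>i<d ^ k. digit_prod d k p i * (digit_sum d k L i - real k * mu)\<^sup>2)
        = real k * (\<Sum>i<d. p i * (L i - mu)\<^sup>2)"
proof -
  have c0: "(\<Sum>i<d. p i * (L i - mu)) = 0"
    using p mu by (simp add: right_diff_distrib sum_subtractf sum_distrib_right[symmetric])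
  have one: "(\<Sum>i<d ^ k. digit_prod d k p i) = 1" for k
    by (simp add: digit_prod_sum p)
  have first: "(\<Sum>i<d ^ k. digit_prod d k p i * (digit_sum d k L i - real k * mu)) = 0" for k
  proof (induction k)
    case (Suc k)
    have "(\<Sum>i<d ^ Suc k. digit_prod d (Suc k) p i * (digit_sum d (Suc k) L i - real (Suc k) * mu))
       = (\<Sum>i<d * d ^ k. (p (i div d ^ k) * digit_prod d k p (i mod d ^ k)) *
           ((L (i div d ^ k) + digit_sum d k L (i mod d ^ k)) - real (Suc k) * mu))" by simp
    also have "\<dots> = (\<Sum>a<d. \<Sum>b<d ^ k. (p a * digit_prod d k p b) * ((L a + digit_sum d k L b) - real (Suc k) * mu))"
      by (rule sum_div_mod)
    also have "\<dots> = (\<Sum>a<d. \<Sum>b<d ^ k. (p a * (L a - mu)) * digit_prod d k p b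
        + p a * (digit_prod d k p b * (digit_sum d k L b - real k * mu)))"
      by (intro sum.cong refl) (simp add: algebra_simps)
    also have "\<dots> = 0"
      by (simp add: sum.distrib sum_product[symmetric] c0 Suc.IH)
    finally show ?case .
  qed simp
  show "(\<Sum>i<d ^ k. digit_prod d k p i * (digit_sum d k L i - real k * mu)\<^sup>2)
        = real k * (\<Sum>i<d. p i * (L i - mu)\<^sup>2)"
  proof (induction k)
    case (Suc k)
    have "(\<Sum>i<d ^ Suc k. digit_prod d (Suc k) p i * (digit_sum d (Suc k) L i - real (Suc k) * mu)\<^sup>2)
       = (\<Sum>i<d * d ^ k. (p (i div d ^ k) * digit_prod d k p (i mod d ^ k)) *
           ((L (i div d ^ k) + digit_sum d k L (i mod d ^ k)) - real (Suc k) * mu)\<^sup>2)" by simp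
    also have "\<dots> = (\<Sum>a<d. \<Sum>b<d ^ k. (p a * digit_prod d k p b) * ((L a + digit_sum d k L b) - real (Suc k) * mu)\<^sup>2)"
      by (rule sum_div_mod)
    also have "\<dots> = (\<Sum>a<d. \<Sum>b<d ^ k. (p a * (L a - mu)\<^sup>2) * digit_prod d k p b
        + p a * (digit_prod d k p b * (digit_sum d k L b - real k * mu)\<^sup>2)
        + (2 * (p a * (L a - mu))) * (digit_prod d k p b * (digit_sum d k L b - real k * mu)))"
      by (intro sum.cong refl) (simp add: algebra_simps power2_eq_square)
    also have "\<dots> = (\<Sum>i<d. p i * (L i - mu)\<^sup>2) + real k * (\<Sum>i<d. p i * (L i - mu)\<^sup>2)"
      by (simp add: sum.distrib sum_product[symmetric] p one first Suc.IH)
    finally show ?case by (simp add: algebra_simps)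
  qed simp
qed

text \<open>Chebyshev's inequality with the variance of a sum of \<open>k\<close> independent terms.
  The deviation is demanded on words of positive weight only, so words containing a zero eigenvalue
  of the measured state, where \<open>ln\<close> has its default value, call for no
  estimate.\<close>

lemma digit_chebyshev:
  assumes p0: "\<And>i. i < d \<Longrightarrow> 0 \<le> p i" and p: "(\<Sum>i<d. p i) = 1" and e: "0 < e" and k: "0 < k"
    and far: "\<And>i. i < d ^ k \<Longrightarrow> i \<in> F \<Longrightarrow> 0 < digit_prod d k p i \<Longrightarrow>
        real k * e \<le> \<bar>digit_sum d k L i - real k * (\<Sum>i<d. p i * L i)\<bar>"
  shows "(\<Sum>i<d ^ k. if i \<in> F then digit_prod d k p i else 0)
     \<le> (\<Sum>i<d. p i * (L i - (\<Sum>i<d. p i * L i))\<^sup>2) / (e\<^sup>2 * real k)"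
proof -
  define mu where "mu = (\<Sum>i<d. p i * L i)"
  define V where "V = (\<Sum>i<d. p i * (L i - mu)\<^sup>2)"
  have "(\<Sum>i<d ^ k. if i \<in> F then digit_prod d k p i else 0) * (real k * e)\<^sup>2
      \<le> (\<Sum>i<d ^ k. digit_prod d k p i * (digit_sum d k L i - real k * mu)\<^sup>2)"
    unfolding sum_distrib_right
  proof (rule sum_mono)
    fix i assume i: "i \<in> {..<d ^ k}"
    then have nn: "0 \<le> digit_prod d k p i" using p0 by (auto intro: digit_prod_nonneg)
    show "(if i \<in> F then digit_prod d k p i else 0) * (real k * e)\<^sup>2
        \<le> digit_prod d k p i * (digit_sum d k L i - real k * mu)\<^sup>2"
    proof (cases "i \<in> F \<and> 0 < digit_prod d k p i")
      case True
      then have "real k * e \<le> \<bar>digit_sum d k L i - real k * mu\<bar>"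
        using far i by (simp add: mu_def)
      then have "(real k * e)\<^sup>2 \<le> (digit_sum d k L i - real k * mu)\<^sup>2"
        using e by (subst abs_le_square_iff[symmetric]) (simp add: abs_mult)
      then show ?thesis using True nn by (simp add: mult_left_mono)
    qed (use nn in \<open>auto simp: less_le\<close>)
  qed
  also have "\<dots> = real k * V" unfolding V_def by (rule digit_variance[OF p]) (simp add: mu_def)
  finally have "(\<Sum>i<d ^ k. if i \<in> F then digit_prod d k p i else 0) \<le> real k * V / (real k * e)\<^sup>2"
    using e k by (simp add: pos_le_divide_eq)
  also have "\<dots> = V / (e\<^sup>2 * real k)" using e k by (simp add: field_simps power2_eq_square)
  finally show ?thesis by (simp add: V_def mu_def)
qed

section \<open>Twirling\<close>

text \<open>Cyclicity brings \<open>K\<close> next to \<open>T\<close>, where it commutes through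
  and cancels against \<open>adj K\<close>.\<close>

lemma tr_unitary_conj:
  assumes K: "unitary_mat N K" and M: "M \<in> carrier_mat N N" and T: "T \<in> carrier_mat N N"
    and comm: "T * K = K * T"
  shows "tr (K * M * adj K * T) = tr (M * T)"
proof -
  have Kc: "K \<in> carrier_mat N N" "adj K * K = 1\<^sub>m N" using K by (auto simp: unitary_mat_def)
  have "tr (K * M * adj K * T) = tr (K * (M * adj K * T))" using Kc M T by (simp add: square_assoc[of _ N])
  also have "\<dots> = tr ((M * adj K * T) * K)" using Kc M T by (intro tr_mult_comm[of _ N N]) auto
  also have "(M * adj K * T) * K = M * (adj K * (T * K))" using Kc M T by (simp add: square_assoc[of _ N])
  also have "\<dots> = M * ((adj K * K) * T)" using square_assoc[of "adj K" N K T] Kc T by (simp only: comm adj_carrier)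
  finally show ?thesis using Kc T by simp
qed

section \<open>Trace functionals of a single tensor factor\<close>

lemma sum_swap_pairs:
  fixes G :: "'a \<Rightarrow> 'b \<Rightarrow> 'c \<Rightarrow> 'e \<Rightarrow> 'f::comm_monoid_add"
  shows "(\<Sum>i\<in>A. \<Sum>l\<in>B. \<Sum>p\<in>C. \<Sum>q\<in>E. G i l p q) = (\<Sum>p\<in>C. \<Sum>q\<in>E. \<Sum>i\<in>A. \<Sum>l\<in>B. G i l p q)"
proof -
  have *: "(\<Sum>l\<in>S. \<Sum>p\<in>C. \<Sum>q\<in>E. H l p q) = (\<Sum>p\<in>C. \<Sum>q\<in>E. \<Sum>l\<in>S. H l p q)"
    for S :: "'x set" and H :: "'x \<Rightarrow> 'c \<Rightarrow> 'e \<Rightarrow> 'f"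
    by (subst sum.swap) (intro sum.cong refl sum.swap)
  show ?thesis unfolding * ..
qed

text \<open>Exhibits the trace as a linear functional of the middle factor with explicit
  coefficients. A twirl of that factor is an entrywise integral, and a finite combination of entries
  can be moved under the integral.\<close>

lemma tr_kron_linear:
  assumes A: "A \<in> carrier_mat a a" and B: "B \<in> carrier_mat b b" and T: "T \<in> carrier_mat (a * (D * b)) (a * (D * b))"
  obtains c :: "nat \<Rightarrow> nat \<Rightarrow> complex" where
    "\<And>X. X \<in> carrier_mat D D \<Longrightarrow> tr (kron A (kron X B) * T) = (\<Sum>p<D. \<Sum>q<D. c p q * X $$ (p,q))"
proof -
  define N where "N = a * (D * b)"
  \<comment> \<open>An index of the triple product consists of three digits:
    \<open>i div (D * b)\<close> belongs to the first factor, \<open>f i\<close> to the middle one,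
    and the remainder modulo \<open>b\<close> to the last.\<close>
  define f where "f i = i mod (D * b) div b" for i
  define w where "w i l = A $$ (i div (D * b), l div (D * b)) * B $$ (i mod (D * b) mod b, l mod (D * b) mod b) * T $$ (l,i)" for i l
  define c where "c p q = (\<Sum>i<N. \<Sum>l<N. if f i = p \<and> f l = q then w i l else 0)" for p q
  have fD: "f i < D" if "i < N" for i
  proof -
    have "i mod (D * b) < D * b" using that unfolding N_def by (rule mod_less_of_less_mult)
    then show ?thesis unfolding f_def by (rule less_mult_imp_div_less)
  qed
  have "tr (kron A (kron X B) * T) = (\<Sum>p<D. \<Sum>q<D. c p q * X $$ (p,q))" if X: "X \<in> carrier_mat D D" for X
  proof -
    have "tr (kron A (kron X B) * T) = (\<Sum>i<N. \<Sum>l<N. kron A (kron X B) $$ (i,l) * T $$ (l,i))"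
      unfolding N_def by (rule tr_mult) (use A B X T in auto)
    also have "\<dots> = (\<Sum>i<N. \<Sum>l<N. w i l * X $$ (f i, f l))"
    proof (intro sum.cong refl)
      fix i l assume "i \<in> {..<N}" "l \<in> {..<N}"
      then have il: "i < a * (D * b)" "l < a * (D * b)" by (auto simp: N_def)
      have "kron A (kron X B) $$ (i,l) = A $$ (i div (D * b), l div (D * b)) * kron X B $$ (i mod (D * b), l mod (D * b))"
        using il by (intro index_kron[OF A kron_carrier[OF X B]])
      also have "kron X B $$ (i mod (D * b), l mod (D * b)) = X $$ (f i, f l) * B $$ (i mod (D * b) mod b, l mod (D * b) mod b)"
        unfolding f_def using il by (intro index_kron[OF X B] mod_less_of_less_mult) auto
      finally show "kron A (kron X B) $$ (i,l) * T $$ (l,i) = w i l * X $$ (f i, f l)" by (simp add: w_def)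
    qed
    also have "\<dots> = (\<Sum>i<N. \<Sum>l<N. \<Sum>p<D. \<Sum>q<D. (if f i = p \<and> f l = q then w i l else 0) * X $$ (p,q))"
    proof (intro sum.cong refl)
      fix i l assume il: "i \<in> {..<N}" "l \<in> {..<N}"
      have "(\<Sum>p<D. \<Sum>q<D. (if f i = p \<and> f l = q then w i l else 0) * X $$ (p,q))
        = (\<Sum>p<D. if f i = p then (\<Sum>q<D. if f l = q then w i l * X $$ (p,q) else 0) else 0)"
      proof (intro sum.cong refl)
        fix p
        show "(\<Sum>q<D. (if f i = p \<and> f l = q then w i l else 0) * X $$ (p,q))
          = (if f i = p then (\<Sum>q<D. if f l = q then w i l * X $$ (p,q) else 0) else 0)"
        proof (cases "f i = p")
          case True
          then have "(if f i = p \<and> f l = q then w i l else 0) * X $$ (p,q) = (if f l = q then w i l * X $$ (p,q) else 0)" for q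
            by simp
          then show ?thesis using True by (simp only: if_True simp_thms)
        qed simp
      qed
      also have "\<dots> = w i l * X $$ (f i, f l)"
        using il fD[of i] fD[of l] by (simp only: sum.delta' finite_lessThan lessThan_iff if_True)
      finally show "w i l * X $$ (f i, f l) = (\<Sum>p<D. \<Sum>q<D. (if f i = p \<and> f l = q then w i l else 0) * X $$ (p,q))" ..
    qed
    also have "\<dots> = (\<Sum>p<D. \<Sum>q<D. \<Sum>i<N. \<Sum>l<N. (if f i = p \<and> f l = q then w i l else 0) * X $$ (p,q))"
      by (rule sum_swap_pairs)
    also have "\<dots> = (\<Sum>p<D. \<Sum>q<D. c p q * X $$ (p,q))"
      by (simp only: c_def sum_distrib_right)
    finally show ?thesis .
  qed
  then show ?thesis using that by blast
qed

text \<open>The single-site operator on \<open>k\<close> copies, with sites counted from 0. The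
  subtraction \<open>k - Suc i\<close> is truncated, so the size is \<open>D ^ k\<close> under the
  side condition \<open>i < k\<close>.\<close>

definition site :: "nat \<Rightarrow> nat \<Rightarrow> nat \<Rightarrow> complex mat \<Rightarrow> complex mat" where
  "site D k i X = kron (1\<^sub>m (D ^ i)) (kron X (1\<^sub>m (D ^ (k - Suc i))))"

lemma site_carrier: "X \<in> carrier_mat D D \<Longrightarrow> i < k \<Longrightarrow> site D k i X \<in> carrier_mat (D ^ k) (D ^ k)"
proof -
  assume X: "X \<in> carrier_mat D D" and "i < k"
  then have "D ^ k = D ^ (i + Suc (k - Suc i))" by simp
  then have "D ^ k = D ^ i * (D * D ^ (k - Suc i))" by (simp only: power_add power_Suc)
  then show ?thesis using X by (simp add: site_def)
qed

lemma site_commute_kpow: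
  assumes "X \<in> carrier_mat D D" "R \<in> carrier_mat D D" "X * R = R * X" "i < k"
  shows "site D k i X * kpow k R = kpow k R * site D k i X"
proof -
  define j where "j = k - Suc i"
  have k: "k = i + Suc j" using assms(4) by (simp add: j_def)
  have s: "site D k i X = kron (1\<^sub>m (D ^ i)) (kron X (1\<^sub>m (D ^ j)))" by (simp add: site_def j_def)
  have r: "kpow k R = kron (kpow i R) (kron R (kpow j R))" unfolding k kpow_add by simp
  have c: "kpow i R \<in> carrier_mat (D ^ i) (D ^ i)" "kpow j R \<in> carrier_mat (D ^ j) (D ^ j)" using assms by auto
  show ?thesis
    unfolding s r using assms c
    by (simp add: kron_mult[of _ "D ^ i" "D ^ i" _ "D * D ^ j" "D * D ^ j" _ "D ^ i" _ "D * D ^ j"]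
        kron_mult[of _ D D _ "D ^ j" "D ^ j" _ D _ "D ^ j"]
        left_mult_one_mat[OF c(1)] right_mult_one_mat[OF c(1)] left_mult_one_mat[OF c(2)] right_mult_one_mat[OF c(2)])
qed

lemma index_conj:
  assumes "X \<in> carrier_mat D D" "V \<in> carrier_mat D D" "i < D" "j < D"
  shows "(V * X * adj V) $$ (i,j) = (\<Sum>l<D. (\<Sum>k<D. V $$ (i,k) * X $$ (k,l)) * cnj (V $$ (j,l)))"
proof -
  have "V * X \<in> carrier_mat D D" using assms by simp
  then show ?thesis
    using assms by (simp add: index_mult_sum[of _ D D _ D] del: index_mult_mat(1))
qed

section \<open>Haar integration and the twirl\<close>

lemma integrable_continuous_compact:
  fixes f :: "'g::topological_space \<Rightarrow> complex"
  assumes "compact (UNIV :: 'g set)" "sets \<mu> = sets borel" "prob_space \<mu>" "continuous_on UNIV f"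
  shows "integrable \<mu> f"
proof -
  interpret prob_space \<mu> by fact
  have "bounded (range f)"
    using assms by (intro compact_imp_bounded compact_continuous_image)
  then obtain B where "\<And>x. norm (f x) \<le> B" by (auto simp: bounded_iff)
  moreover have "f \<in> borel_measurable \<mu>"
    using borel_measurable_continuous_onI[OF assms(4)] by (simp add: measurable_cong_sets[OF assms(2) refl])
  ultimately show ?thesis by (intro integrable_const_bound[of _ B]) auto
qed

locale compact_group_rep =
  fixes d :: nat and u :: "'g::{group_add,topological_space} \<Rightarrow> complex mat" and \<mu> :: "'g measure"
  assumes group: "compact_group TYPE('g)"
    and haar: "haar_prob \<mu>"
    and rep: "cont_unitary_rep d u"
begin

abbreviation "rep_pow n g \<equiv> kpow n (u g)"

lemma u_carrier [simp]: "u g \<in> carrier_mat d d"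
  using rep by (auto simp: cont_unitary_rep_def unitary_mat_def)

lemma unitary_rep_pow: "unitary_mat (d ^ n) (rep_pow n g)"
  using rep by (auto simp: cont_unitary_rep_def intro: unitary_kpow)

lemma rep_pow_carrier [simp]: "rep_pow n g \<in> carrier_mat (d ^ n) (d ^ n)"
  by simp

lemma dim_rep_pow [simp]: "dim_row (rep_pow n g) = d ^ n" "dim_col (rep_pow n g) = d ^ n"
  using carrier_matD[OF kpow_carrier[OF u_carrier]] by auto

lemma rep_pow_plus: "rep_pow n (g + h) = rep_pow n g * rep_pow n h"
  using rep by (simp add: cont_unitary_rep_def kpow_mult[of _ d])

lemma continuous_rep_pow:
  "i < d ^ n \<Longrightarrow> j < d ^ n \<Longrightarrow> continuous_on UNIV (\<lambda>g. rep_pow n g $$ (i,j))"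
proof (induction n arbitrary: i j)
  case (Suc n)
  have lt: "i < d * d ^ n" "j < d * d ^ n" using Suc.prems by auto
  then have "i div d ^ n < d" "i mod d ^ n < d ^ n" "j div d ^ n < d" "j mod d ^ n < d ^ n"
    by (auto simp: less_mult_imp_div_less mod_less_of_less_mult)
  moreover have "continuous_on UNIV (\<lambda>g. u g $$ (i', j'))" if "i' < d" "j' < d" for i' j'
    using rep that by (auto simp: cont_unitary_rep_def)
  ultimately show ?case
    using Suc.IH by (simp add: index_kron[OF u_carrier rep_pow_carrier lt] continuous_on_mult)
qed simp

lemma continuous_conj:
  assumes "X \<in> carrier_mat (d ^ n) (d ^ n)" "i < d ^ n" "j < d ^ n"
  shows "continuous_on UNIV (\<lambda>g. (rep_pow n g * X * adj (rep_pow n g)) $$ (i,j))"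
  using assms by (simp only: index_conj[OF assms(1) rep_pow_carrier assms(2,3)])
    (intro continuous_intros continuous_rep_pow; simp)

lemma integrable_conj:
  assumes "X \<in> carrier_mat (d ^ n) (d ^ n)" "i < d ^ n" "j < d ^ n"
  shows "integrable \<mu> (\<lambda>g. (rep_pow n g * X * adj (rep_pow n g)) $$ (i,j))"
  using group haar continuous_conj[OF assms]
  by (intro integrable_continuous_compact) (auto simp: compact_group_def haar_prob_def)

text \<open>Invariance in \<open>haar_prob\<close> speaks of images of Borel sets, a push-forward
  measure of preimages. The two meet because the preimage under translation by \<open>h\<close> is
  the image under translation by \<open>- h\<close>.\<close>

lemma integral_translate:
  fixes f :: "'g \<Rightarrow> complex"
  assumes "continuous_on UNIV f"
  shows "(\<integral>g. f (h + g) \<partial>\<mu>) = (\<integral>g. f g \<partial>\<mu>)"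
proof -
  have sb: "sets \<mu> = sets borel" and sp: "space \<mu> = UNIV"
    using haar sets_eq_imp_space_eq[of \<mu> borel] by (auto simp: haar_prob_def)
  have cont: "continuous_on UNIV (\<lambda>x::'g. h + x)"
  proof -
    have "continuous_on UNIV ((\<lambda>p::'g \<times> 'g. fst p + snd p) \<circ> (\<lambda>x. (h, x)))"
      using group unfolding compact_group_def
      by (intro continuous_on_compose continuous_intros) (auto intro: continuous_on_subset)
    then show ?thesis by (simp add: o_def)
  qed
  have meas: "(\<lambda>x. h + x) \<in> measurable \<mu> \<mu>"
    using borel_measurable_continuous_onI[OF cont] by (simp add: measurable_cong_sets[OF sb sb])
  have "distr \<mu> \<mu> (\<lambda>x. h + x) = \<mu>"
  proof (rule measure_eqI)
    fix A assume "A \<in> sets (distr \<mu> \<mu> (\<lambda>x. h + x))"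
    then have A: "A \<in> sets \<mu>" by simp
    have "(\<lambda>x. h + x) -` A = (\<lambda>x. - h + x) ` A"
    proof (rule Set.set_eqI, rule iffI)
      fix x assume "x \<in> (\<lambda>x. h + x) -` A"
      then show "x \<in> (\<lambda>x. - h + x) ` A" by (intro image_eqI[of _ _ "h + x"]) (auto simp: add.assoc[symmetric])
    qed (auto simp: add.assoc[symmetric])
    then show "emeasure (distr \<mu> \<mu> (\<lambda>x. h + x)) A = emeasure \<mu> A"
      using A haar by (simp add: emeasure_distr[OF meas A] sp haar_prob_def sb)
  qed simp
  moreover have "f \<in> borel_measurable \<mu>"
    using borel_measurable_continuous_onI[OF assms] by (simp add: measurable_cong_sets[OF sb refl])
  ultimately show ?thesis
    using integral_distr[OF meas, of f] by simp
qed

lemma twirl_carrier [simp]: "twirl \<mu> d u n X \<in> carrier_mat (d ^ n) (d ^ n)"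
  by (simp add: twirl_def)

lemma twirl_linear:
  assumes X: "X \<in> carrier_mat (d ^ n) (d ^ n)"
  shows "(\<Sum>p<d ^ n. \<Sum>q<d ^ n. c p q * twirl \<mu> d u n X $$ (p,q))
    = (\<integral>g. (\<Sum>p<d ^ n. \<Sum>q<d ^ n. c p q * (rep_pow n g * X * adj (rep_pow n g)) $$ (p,q)) \<partial>\<mu>)"
proof -
  have "(\<integral>g. (\<Sum>p<d ^ n. \<Sum>q<d ^ n. c p q * (rep_pow n g * X * adj (rep_pow n g)) $$ (p,q)) \<partial>\<mu>)
    = (\<Sum>p<d ^ n. \<Sum>q<d ^ n. c p q * (\<integral>g. (rep_pow n g * X * adj (rep_pow n g)) $$ (p,q) \<partial>\<mu>))"
  proof (subst Bochner_Integration.integral_sum)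
    show "integrable \<mu> (\<lambda>g. \<Sum>q<d ^ n. c p q * (rep_pow n g * X * adj (rep_pow n g)) $$ (p,q))"
      if "p \<in> {..<d ^ n}" for p
      using integrable_conj[OF X] that by (intro Bochner_Integration.integrable_sum integrable_mult_right) auto
    show "(\<Sum>p<d ^ n. \<integral>g. (\<Sum>q<d ^ n. c p q * (rep_pow n g * X * adj (rep_pow n g)) $$ (p,q)) \<partial>\<mu>)
      = (\<Sum>p<d ^ n. \<Sum>q<d ^ n. c p q * (\<integral>g. (rep_pow n g * X * adj (rep_pow n g)) $$ (p,q) \<partial>\<mu>))"
      using integrable_conj[OF X]
      by (intro sum.cong refl, subst Bochner_Integration.integral_sum)
         (auto intro!: integrable_mult_right simp del: index_mult_mat)
  qed
  then show ?thesis by (simp add: twirl_def del: index_mult_mat)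
qed

text \<open>This is the normalization of the Haar measure: a linear functional that is constant
  along the orbit of \<open>X\<close> takes the same value at its average.\<close>

lemma twirl_functional_eq:
  assumes X: "X \<in> carrier_mat (d ^ n) (d ^ n)"
    and "\<And>g. (\<Sum>p<d ^ n. \<Sum>q<d ^ n. c p q * (rep_pow n g * X * adj (rep_pow n g)) $$ (p,q)) = z"
  shows "(\<Sum>p<d ^ n. \<Sum>q<d ^ n. c p q * twirl \<mu> d u n X $$ (p,q)) = z"
proof -
  interpret prob_space \<mu> using haar by (simp add: haar_prob_def)
  show ?thesis unfolding twirl_linear[OF X] assms(2) by (simp add: prob_space)
qed

text \<open>The functional of \<open>tr_kron_linear\<close> is constant along the orbit of
  \<open>X\<close>, because conjugating this one factor is a unitary conjugation of the whole
  product by an operator that commutes with \<open>T\<close>. The neighbours \<open>A\<close> and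
  \<open>B\<close> are arbitrary so that factors can be untwirled one at a time.\<close>

lemma tr_site_twirl:
  assumes A: "A \<in> carrier_mat a a" and B: "B \<in> carrier_mat b b" and X: "X \<in> carrier_mat (d ^ n) (d ^ n)"
    and T: "T \<in> carrier_mat (a * (d ^ n * b)) (a * (d ^ n * b))"
    and comm: "\<And>g. T * kron (1\<^sub>m a) (kron (rep_pow n g) (1\<^sub>m b)) = kron (1\<^sub>m a) (kron (rep_pow n g) (1\<^sub>m b)) * T"
  shows "tr (kron A (kron (twirl \<mu> d u n X) B) * T) = tr (kron A (kron X B) * T)"
proof -
  let ?D = "d ^ n"
  obtain c where c: "\<And>X. X \<in> carrier_mat ?D ?D \<Longrightarrow> tr (kron A (kron X B) * T) = (\<Sum>p<?D. \<Sum>q<?D. c p q * X $$ (p,q))"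
    using tr_kron_linear[OF A B T] by blast
  show ?thesis
    unfolding c[OF twirl_carrier]
  proof (rule twirl_functional_eq[OF X])
    fix g
    let ?V = "rep_pow n g"
    let ?K = "kron (1\<^sub>m a) (kron ?V (1\<^sub>m b))"
    have V: "?V \<in> carrier_mat ?D ?D" "adj ?V * ?V = 1\<^sub>m ?D" "?V * adj ?V = 1\<^sub>m ?D"
      using unitary_rep_pow[of n g] by (auto simp: unitary_mat_def)
    note km = kron_mult[of _ a a _ "?D * b" "?D * b" _ a _ "?D * b"] kron_mult[of _ ?D ?D _ b b _ ?D _ b]
    have K: "unitary_mat (a * (?D * b)) ?K"
      using V by (simp add: unitary_mat_def adj_kron km kron_one_one)
    have "(\<Sum>p<?D. \<Sum>q<?D. c p q * (?V * X * adj ?V) $$ (p,q)) = tr (kron A (kron (?V * X * adj ?V) B) * T)"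
      using X V by (intro c[symmetric]) simp
    also have "kron A (kron (?V * X * adj ?V) B) = ?K * kron A (kron X B) * adj ?K"
      using V X A B by (simp add: adj_kron km)
    also have "tr (?K * kron A (kron X B) * adj ?K * T) = tr (kron A (kron X B) * T)"
      using A B X T by (intro tr_unitary_conj[OF K] comm) auto
    finally show "(\<Sum>p<?D. \<Sum>q<?D. c p q * (?V * X * adj ?V) $$ (p,q)) = tr (kron A (kron X B) * T)" .
  qed
qed

lemma tr_twirl:
  assumes X: "X \<in> carrier_mat (d ^ n) (d ^ n)" and T: "T \<in> carrier_mat (d ^ n) (d ^ n)"
    and comm: "\<And>g. T * rep_pow n g = rep_pow n g * T"
  shows "tr (twirl \<mu> d u n X * T) = tr (X * T)"
  using tr_site_twirl[of "1\<^sub>m (Suc 0)" "Suc 0" "1\<^sub>m (Suc 0)" "Suc 0" X n T] assms by simp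

text \<open>The induction untwirls the leftmost copy and absorbs it into the prefix
  \<open>A\<close>, which is why \<open>a\<close> and \<open>A\<close> are general. Commutation is
  demanded at every copy separately: the swap of two copies commutes with the simultaneous action,
  yet it can distinguish the twirled from the untwirled product.\<close>

lemma tr_kpow_twirl:
  assumes X: "X \<in> carrier_mat (d ^ m) (d ^ m)"
    and "A \<in> carrier_mat a a" "T \<in> carrier_mat (a * (d ^ m) ^ k) (a * (d ^ m) ^ k)"
    and "\<And>i g. i < k \<Longrightarrow> T * kron (1\<^sub>m a) (site (d ^ m) k i (rep_pow m g)) = kron (1\<^sub>m a) (site (d ^ m) k i (rep_pow m g)) * T"
  shows "tr (kron A (kpow k (twirl \<mu> d u m X)) * T) = tr (kron A (kpow k X) * T)"
  using assms(2-)
proof (induction k arbitrary: a A)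
  case (Suc k)
  let ?R = "twirl \<mu> d u m X"
  let ?D = "d ^ m"
  have T1: "T \<in> carrier_mat (a * (?D * ?D ^ k)) (a * (?D * ?D ^ k))" using Suc.prems(2) by simp
  have T2: "T \<in> carrier_mat (a * ?D * ?D ^ k) (a * ?D * ?D ^ k)" using Suc.prems(2) by (simp add: mult_ac)
  have s0: "site ?D (Suc k) 0 V = kron V (1\<^sub>m (?D ^ k))" for V by (simp add: site_def)
  have sS: "kron (1\<^sub>m a) (site ?D (Suc k) (Suc i) V) = kron (1\<^sub>m (a * ?D)) (site ?D k i V)" for i V
    by (simp add: site_def kron_one_one[symmetric] kron_assoc)
  have "tr (kron A (kpow (Suc k) ?R) * T) = tr (kron A (kron ?R (kpow k ?R)) * T)" by simp
  also have "\<dots> = tr (kron A (kron X (kpow k ?R)) * T)"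
    using Suc.prems(3)[of 0] by (intro tr_site_twirl[OF Suc.prems(1) _ X T1]) (auto simp: s0)
  also have "\<dots> = tr (kron (kron A X) (kpow k ?R) * T)" by (simp add: kron_assoc)
  also have "\<dots> = tr (kron (kron A X) (kpow k X) * T)"
    using Suc.prems(3)[of "Suc _"] by (intro Suc.IH[OF _ T2]) (auto simp: sS X Suc.prems(1))
  finally show ?case by (simp add: kron_assoc)
qed simp

text \<open>Conjugation by \<open>h\<close> replaces \<open>g\<close> by \<open>h + g\<close> under
  the integral, and translation invariance undoes this. The average is thus fixed by conjugation,
  which for a unitary is commutation.\<close>

lemma twirl_commute:
  assumes X: "X \<in> carrier_mat (d ^ n) (d ^ n)"
  shows "twirl \<mu> d u n X * rep_pow n h = rep_pow n h * twirl \<mu> d u n X"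
proof -
  let ?D = "d ^ n"
  let ?V = "rep_pow n h"
  let ?R = "twirl \<mu> d u n X"
  have V: "?V \<in> carrier_mat ?D ?D" "adj ?V * ?V = 1\<^sub>m ?D"
    using unitary_rep_pow[of n h] by (auto simp: unitary_mat_def)
  have ind: "(?V * Y * adj ?V) $$ (i,j) = (\<Sum>p<?D. \<Sum>q<?D. (?V $$ (i,p) * cnj (?V $$ (j,q))) * Y $$ (p,q))"
    if "i < ?D" "j < ?D" "Y \<in> carrier_mat ?D ?D" for i j Y
    unfolding index_conj[OF that(3) V(1) that(1,2)]
    by (subst sum.swap) (auto simp: sum_distrib_right sum_distrib_left mult_ac intro!: sum.cong)
  have "?V * ?R * adj ?V = ?R"
  proof (rule eq_matI)
    fix i j assume "i < dim_row ?R" "j < dim_col ?R"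
    then have ij: "i < ?D" "j < ?D" by (auto simp: twirl_def)
    have "(?V * ?R * adj ?V) $$ (i,j) = (\<integral>g. (\<Sum>p<?D. \<Sum>q<?D. (?V $$ (i,p) * cnj (?V $$ (j,q))) *
       (rep_pow n g * X * adj (rep_pow n g)) $$ (p,q)) \<partial>\<mu>)"
      unfolding ind[OF ij twirl_carrier] by (rule twirl_linear[OF X])
    also have "\<dots> = (\<integral>g. (rep_pow n (h + g) * X * adj (rep_pow n (h + g))) $$ (i,j) \<partial>\<mu>)"
    proof (rule Bochner_Integration.integral_cong[OF refl])
      fix g
      have "(\<Sum>p<?D. \<Sum>q<?D. (?V $$ (i,p) * cnj (?V $$ (j,q))) * (rep_pow n g * X * adj (rep_pow n g)) $$ (p,q))
         = (?V * (rep_pow n g * X * adj (rep_pow n g)) * adj ?V) $$ (i,j)"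
        using X by (intro ind[OF ij, symmetric]) simp
      also have "?V * (rep_pow n g * X * adj (rep_pow n g)) * adj ?V
          = rep_pow n (h + g) * X * adj (rep_pow n (h + g))"
        using X by (simp add: rep_pow_plus square_assoc[of _ ?D] adj_mult[of _ ?D ?D _ ?D])
      finally show "(\<Sum>p<?D. \<Sum>q<?D. (?V $$ (i,p) * cnj (?V $$ (j,q))) * (rep_pow n g * X * adj (rep_pow n g)) $$ (p,q))
        = (rep_pow n (h + g) * X * adj (rep_pow n (h + g))) $$ (i,j)" .
    qed
    also have "\<dots> = (\<integral>g. (rep_pow n g * X * adj (rep_pow n g)) $$ (i,j) \<partial>\<mu>)"
      by (rule integral_translate[OF continuous_conj[OF X ij]])
    finally show "(?V * ?R * adj ?V) $$ (i,j) = ?R $$ (i,j)"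
      using ij by (simp add: twirl_def del: index_mult_mat)
  qed (use V in \<open>auto simp: twirl_def\<close>)
  then have "?R * ?V = ?V * ?R * adj ?V * ?V" by simp
  also have "\<dots> = ?V * ?R * (adj ?V * ?V)" using V by (simp add: square_assoc[of _ ?D])
  finally show ?thesis using V(2) by (simp add: right_mult_one_mat[of _ ?D ?D])
qed

text \<open>The quadratic form of the average is the integral of the quadratic forms of the
  conjugates \<open>?W g\<close>, each of which is nonnegative.\<close>

lemma psd_twirl:
  assumes "psd (d ^ n) X"
  shows "psd (d ^ n) (twirl \<mu> d u n X)"
proof -
  let ?D = "d ^ n"
  let ?W = "\<lambda>g. rep_pow n g * X * adj (rep_pow n g)"
  have X: "X \<in> carrier_mat ?D ?D" using assms by (simp add: psd_def)
  obtain B where B: "B \<in> carrier_mat ?D ?D" "X = adj B * B" using psd_factor[OF assms] by blast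
  have W: "psd ?D (?W g)" for g
  proof -
    have "?W g = adj (B * adj (rep_pow n g)) * (B * adj (rep_pow n g))"
      using B by (simp add: adj_mult[of _ ?D ?D _ ?D] square_assoc[of _ ?D])
    then show ?thesis using B by (simp add: psd_adj_mult_self[of _ ?D])
  qed
  show ?thesis
    unfolding psd_def
  proof (intro conjI ballI)
    show "adj (twirl \<mu> d u n X) = twirl \<mu> d u n X"
    proof (rule eq_matI)
      fix i j assume "i < dim_row (twirl \<mu> d u n X)" "j < dim_col (twirl \<mu> d u n X)"
      then have ij: "i < ?D" "j < ?D" by (auto simp: twirl_def)
      have *: "cnj (?W g $$ (j,i)) = ?W g $$ (i,j)" for g
      proof -
        have "adj (?W g) $$ (i,j) = cnj (?W g $$ (j,i))"
          using ij X by (intro index_adj) auto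
        then show ?thesis using W[of g] by (simp add: psd_def del: index_mult_mat)
      qed
      have "cnj (\<integral>g. ?W g $$ (j,i) \<partial>\<mu>) = (\<integral>g. cnj (?W g $$ (j,i)) \<partial>\<mu>)"
        by (rule Bochner_Integration.integral_cnj[symmetric])
      then have "cnj (\<integral>g. ?W g $$ (j,i) \<partial>\<mu>) = (\<integral>g. ?W g $$ (i,j) \<partial>\<mu>)"
        by (simp only: *)
      then show "adj (twirl \<mu> d u n X) $$ (i,j) = twirl \<mu> d u n X $$ (i,j)"
        using ij by (simp add: twirl_def del: index_mult_mat)
    qed (auto simp: twirl_def)
    fix v :: "complex Matrix.vec" assume v: "v \<in> carrier_vec ?D"
    have q: "scalar_prod (map_vec cnj v) (Y *\<^sub>v v) = (\<Sum>p<?D. \<Sum>q<?D. (cnj (v $ p) * v $ q) * Y $$ (p,q))"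
      if "Y \<in> carrier_mat ?D ?D" for Y
      unfolding quadratic_form[OF that v] by (simp add: mult_ac)
    let ?Q = "\<lambda>g. \<Sum>p<?D. \<Sum>q<?D. (cnj (v $ p) * v $ q) * ?W g $$ (p,q)"
    have "integrable \<mu> ?Q"
      using integrable_conj[OF X] by (intro Bochner_Integration.integrable_sum integrable_mult_right) auto
    moreover have "0 \<le> Re (?Q g)" for g
    proof -
      have "?Q g = scalar_prod (map_vec cnj v) (?W g *\<^sub>v v)" using X by (intro q[symmetric]) simp
      then show ?thesis using W[of g] v by (simp add: psd_def del: index_mult_mat)
    qed
    ultimately have "0 \<le> Re (\<integral>g. ?Q g \<partial>\<mu>)"
      by (simp only: integral_Re[symmetric]) (intro integral_nonneg_AE AE_I2; simp del: index_mult_mat)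
    then show "0 \<le> Re (scalar_prod (map_vec cnj v) (twirl \<mu> d u n X *\<^sub>v v))"
      unfolding q[OF twirl_carrier] twirl_linear[OF X] .
  qed simp
qed

lemma density_twirl:
  assumes "density d \<rho>"
  shows "density (d ^ n) (twirl \<mu> d u n (kpow n \<rho>))"
proof -
  have r: "psd d \<rho>" "tr \<rho> = 1" "\<rho> \<in> carrier_mat d d" using assms by (auto simp: density_def psd_def)
  have "tr (twirl \<mu> d u n (kpow n \<rho>) * 1\<^sub>m (d ^ n)) = tr (kpow n \<rho> * 1\<^sub>m (d ^ n))"
    using r by (intro tr_twirl) (auto simp: left_mult_one_mat[of _ "d ^ n" "d ^ n"] right_mult_one_mat[of _ "d ^ n" "d ^ n"])
  then have "tr (twirl \<mu> d u n (kpow n \<rho>)) = 1"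
    using r by (simp add: right_mult_one_mat[of _ "d ^ n" "d ^ n"] tr_kpow[of _ d])
  then show ?thesis using psd_twirl[OF psd_kpow[OF r(1)]] by (simp add: density_def)
qed

end

section \<open>The converse inequality\<close>

definition conj_diag :: "nat \<Rightarrow> complex mat \<Rightarrow> (nat \<Rightarrow> real) \<Rightarrow> complex mat" where
  "conj_diag n V f = V * mat_diag n (\<lambda>i. complex_of_real (f i)) * adj V"

lemma spectral_decomp_conj_diag: "spectral_decomp n A U lam \<longleftrightarrow> unitary_mat n U \<and> A = conj_diag n U lam"
  by (simp add: spectral_decomp_def conj_diag_def)

lemma conj_diag_carrier [simp]: "V \<in> carrier_mat n n \<Longrightarrow> conj_diag n V f \<in> carrier_mat n n"
  by (simp add: conj_diag_def)

lemma adj_conj_diag: "V \<in> carrier_mat n n \<Longrightarrow> adj (conj_diag n V f) = conj_diag n V f"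
  by (simp add: conj_diag_def adj_mult[of _ n n _ n] adj_mat_diag square_assoc[of _ n])

lemma conj_diag_mult:
  assumes "unitary_mat n V"
  shows "conj_diag n V f * conj_diag n V g = conj_diag n V (\<lambda>i. f i * g i)"
proof -
  have V: "V \<in> carrier_mat n n" "adj V * V = 1\<^sub>m n" using assms by (auto simp: unitary_mat_def)
  let ?D = "\<lambda>f::nat\<Rightarrow>real. mat_diag n (\<lambda>i. complex_of_real (f i))"
  have "conj_diag n V f * conj_diag n V g = V * ?D f * (adj V * V) * (?D g * adj V)"
    using V(1) by (simp add: conj_diag_def square_assoc[of _ n])
  also have "\<dots> = V * (?D f * ?D g) * adj V"
    using V by (simp add: square_assoc[of _ n] right_mult_one_mat[of _ n n] left_mult_one_mat[of _ n n]
        del: mat_diag_diag)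
  finally show ?thesis by (simp add: conj_diag_def)
qed

lemma conj_diag_one: "unitary_mat n V \<Longrightarrow> conj_diag n V (\<lambda>_. 1) = 1\<^sub>m n"
  by (simp add: conj_diag_def unitary_mat_def right_mult_one_mat[of _ n n])

lemma conj_diag_minus:
  assumes "V \<in> carrier_mat n n"
  shows "conj_diag n V f - conj_diag n V g = conj_diag n V (\<lambda>i. f i - g i)"
  using assms unfolding conj_diag_def
  by (intro eq_matI) (simp_all add: index_conj_diag[of _ n n] sum_subtractf[symmetric] algebra_simps del: index_mult_mat(1))

lemma conj_diag_smult:
  assumes "V \<in> carrier_mat n n"
  shows "complex_of_real c \<cdot>\<^sub>m conj_diag n V f = conj_diag n V (\<lambda>i. c * f i)"
  using assms unfolding conj_diag_def
  by (intro eq_matI) (simp_all add: index_conj_diag[of _ n n] sum_distrib_left mult_ac del: index_mult_mat(1))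

lemma psd_conj_diag_nonneg:
  assumes "V \<in> carrier_mat n n" "\<And>i. i < n \<Longrightarrow> 0 \<le> f i"
  shows "psd n (conj_diag n V f)"
proof -
  obtain B where "B \<in> carrier_mat n n" "conj_diag n V f = adj B * B"
    using psd_conj_diag[of V n f] assms unfolding conj_diag_def by blast
  then show ?thesis using psd_adj_mult_self by simp
qed

text \<open>Expectation of a function of the outcome when \<open>A\<close> is measured in the basis
  \<open>V\<close>: the diagonal of \<open>adj V * A * V\<close> is the outcome distribution if
  \<open>A\<close> is a state.\<close>

lemma tr_mult_conj_diag:
  assumes "A \<in> carrier_mat n n" "V \<in> carrier_mat n n"
  shows "tr (A * conj_diag n V g) = (\<Sum>j<n. (adj V * A * V) $$ (j,j) * complex_of_real (g j))"
proof -
  let ?D = "mat_diag n (\<lambda>i. complex_of_real (g i))"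
  have "tr (A * conj_diag n V g) = tr ((A * V * ?D) * adj V)"
    using assms by (simp add: conj_diag_def square_assoc[of _ n])
  also have "\<dots> = tr (adj V * (A * V * ?D))" using assms by (intro tr_mult_comm[of _ n n]) auto
  also have "\<dots> = tr ((adj V * A * V) * ?D)" using assms by (simp add: square_assoc[of _ n])
  also have "\<dots> = (\<Sum>j<n. (adj V * A * V) $$ (j,j) * complex_of_real (g j))"
    unfolding tr_def using assms
    by (intro sum.cong) (auto simp: mat_diag_mult_right[of _ n n] simp del: index_mult_mat(1))
  finally show ?thesis .
qed

lemma conj_diag_cancel:
  assumes "unitary_mat n V"
  shows "adj V * conj_diag n V f * V = mat_diag n (\<lambda>i. complex_of_real (f i))"
proof -
  have V: "V \<in> carrier_mat n n" "adj V * V = 1\<^sub>m n" using assms by (auto simp: unitary_mat_def)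
  let ?D = "mat_diag n (\<lambda>i. complex_of_real (f i))"
  have "adj V * conj_diag n V f * V = (adj V * V) * ?D * (adj V * V)"
    using V(1) by (simp add: conj_diag_def square_assoc[of _ n])
  then show ?thesis unfolding V(2) by (simp add: left_mult_one_mat[of _ n n] right_mult_one_mat[of _ n n])
qed

text \<open>The diagonal of one operator in the eigenbasis of another is a mixture of its
  eigenvalues. The mixing weights are the transition probabilities between the two bases, and they
  carry all the noncommutativity.\<close>

lemma index_cross_conj_diag:
  assumes "U \<in> carrier_mat n n" "V \<in> carrier_mat n n" "j < n"
  shows "(adj V * conj_diag n U f * V) $$ (j,j)
    = complex_of_real (\<Sum>i<n. f i * (cmod ((adj U * V) $$ (i,j)))\<^sup>2)"
proof -
  let ?D = "mat_diag n (\<lambda>i. complex_of_real (f i))"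
  have W: "adj (adj U * V) \<in> carrier_mat n n" using assms by simp
  have "adj V * conj_diag n U f * V = adj (adj U * V) * ?D * adj (adj (adj U * V))"
    using assms by (simp add: conj_diag_def adj_mult[of _ n n _ n] square_assoc[of _ n])
  then have "(adj V * conj_diag n U f * V) $$ (j,j)
      = (\<Sum>k<n. adj (adj U * V) $$ (j,k) * complex_of_real (f k) * cnj (adj (adj U * V) $$ (j,k)))"
    using index_conj_diag[OF W assms(3,3)] by simp
  also have "\<dots> = (\<Sum>k<n. complex_of_real (f k * (cmod ((adj U * V) $$ (k,j)))\<^sup>2))"
    using assms by (intro sum.cong refl)
      (simp add: complex_norm_square mult_ac del: index_mult_mat(1) of_real_power)
  finally show ?thesis by simp
qed

lemma tr_conj_diag_conj_diag:
  assumes "U \<in> carrier_mat n n" "V \<in> carrier_mat n n"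
  shows "tr (conj_diag n U f * conj_diag n V g)
    = complex_of_real (\<Sum>i<n. \<Sum>j<n. f i * g j * (cmod ((adj U * V) $$ (i,j)))\<^sup>2)"
proof -
  have "tr (conj_diag n U f * conj_diag n V g)
     = (\<Sum>j<n. complex_of_real ((\<Sum>i<n. f i * (cmod ((adj U * V) $$ (i,j)))\<^sup>2) * g j))"
    using assms by (subst tr_mult_conj_diag) (auto simp: index_cross_conj_diag simp del: index_mult_mat(1) intro!: sum.cong)
  also have "\<dots> = complex_of_real (\<Sum>j<n. \<Sum>i<n. f i * g j * (cmod ((adj U * V) $$ (i,j)))\<^sup>2)"
    by (simp add: sum_distrib_left sum_distrib_right mult_ac del: index_mult_mat(1))
  finally show ?thesis by (subst sum.swap)
qed

text \<open>Inserting \<open>U * adj U = 1\<close> between \<open>adj Y\<close> and \<open>Y\<close>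
  resolves the expectation into squared matrix elements of \<open>Y\<close> between the two
  eigenbases, which can then be compared with the overlaps term by term.\<close>

lemma tr_conj_diag_adj_mult:
  assumes U: "unitary_mat n U" and V: "V \<in> carrier_mat n n" and Y: "Y \<in> carrier_mat n n"
  shows "tr (conj_diag n V s * (adj Y * Y)) = complex_of_real (\<Sum>j<n. \<Sum>i<n. s j * (cmod ((adj U * Y * V) $$ (i,j)))\<^sup>2)"
proof -
  have Uc: "U \<in> carrier_mat n n" "U * adj U = 1\<^sub>m n" using U by (auto simp: unitary_mat_def)
  let ?Z = "adj U * Y * V"
  have Z: "?Z \<in> carrier_mat n n" using Uc V Y by simp
  have ZZ: "adj V * (adj Y * Y) * V = adj ?Z * ?Z"
  proof -
    have "U * (adj U * (Y * V)) = Y * V"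
      using Uc V Y by (simp add: square_assoc[of U n "adj U" "Y * V", symmetric] left_mult_one_mat[of _ n n])
    then show ?thesis
      using Uc V Y by (simp add: adj_mult[of _ n n _ n] square_assoc[of _ n])
  qed
  have "tr (conj_diag n V s * (adj Y * Y)) = tr ((adj Y * Y) * conj_diag n V s)"
    using V Y by (intro tr_mult_comm[of _ n n]) auto
  also have "\<dots> = (\<Sum>j<n. (adj ?Z * ?Z) $$ (j,j) * complex_of_real (s j))"
    using V Y by (simp add: tr_mult_conj_diag ZZ)
  also have "\<dots> = (\<Sum>j<n. \<Sum>i<n. complex_of_real (s j * (cmod (?Z $$ (i,j)))\<^sup>2))"
  proof (intro sum.cong refl)
    fix j assume j: "j \<in> {..<n}"
    have "(adj ?Z * ?Z) $$ (j,j) = (\<Sum>i<n. cnj (?Z $$ (i,j)) * ?Z $$ (i,j))"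
      using j Z Uc V by (subst index_mult_sum[of _ n n _ n]) (auto intro!: sum.cong simp del: index_mult_mat(1))
    then show "(adj ?Z * ?Z) $$ (j,j) * complex_of_real (s j) = (\<Sum>i<n. complex_of_real (s j * (cmod (?Z $$ (i,j)))\<^sup>2))"
      by (simp add: complex_norm_square sum_distrib_right sum_distrib_left mult_ac del: index_mult_mat(1) of_real_power)
  qed
  finally show ?thesis by simp
qed

text \<open>The eigenvalues \<open>t\<close> of a test lie in \<open>[0,1]\<close>, so
  \<open>t - t * t\<close> is nonnegative. The same function equals
  \<open>(1 - t) - (1 - t) * (1 - t)\<close>, which gives the second bound.\<close>

lemma effect_square_le:
  assumes T: "psd n T" and T1: "loewner_le n T (1\<^sub>m n)" and A: "psd n A"
  shows "Re (tr (A * (T * T))) \<le> Re (tr (A * T))"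
    and "Re (tr (A * ((1\<^sub>m n - T) * (1\<^sub>m n - T)))) \<le> Re (tr (A * (1\<^sub>m n - T)))"
proof -
  obtain Z t where Zt: "spectral_decomp n T Z t" and t0: "\<And>i. i < n \<Longrightarrow> 0 \<le> t i"
    using psd_spectral_decomp[OF T] by blast
  then have Z: "unitary_mat n Z" "Z \<in> carrier_mat n n" and Teq: "T = conj_diag n Z t"
    by (auto simp: spectral_decomp_conj_diag unitary_mat_def)
  have I: "1\<^sub>m n = conj_diag n Z (\<lambda>_. 1)" using conj_diag_one[OF Z(1)] by simp
  have t1: "t i \<le> 1" if "i < n" for i
  proof -
    have "1\<^sub>m n - T = conj_diag n Z (\<lambda>i. 1 - t i)" unfolding I Teq by (rule conj_diag_minus[OF Z(2)])
    then have "psd n (conj_diag n Z (\<lambda>i. 1 - t i))" using T1 by (simp add: loewner_le_def)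
    from psd_conj_index[OF this Z(2) that] show ?thesis
      unfolding conj_diag_cancel[OF Z(1)] using that by (simp add: mat_diag_def)
  qed
  have Ac: "A \<in> carrier_mat n n" using A by (simp add: psd_def)
  have key: "0 \<le> Re (tr (A * conj_diag n Z (\<lambda>i. t i - t i * t i)))"
    using t0 t1 by (intro tr_psd_mult_nonneg[OF A] psd_conj_diag_nonneg[OF Z(2)]) (simp add: mult_left_le)
  have "A * conj_diag n Z (\<lambda>i. t i - t i * t i) = A * T - A * (T * T)"
    unfolding Teq conj_diag_mult[OF Z(1)] using Ac Z
    by (simp add: conj_diag_minus[symmetric] mult_minus_distrib_mat[of _ n n _ n])
  then show "Re (tr (A * (T * T))) \<le> Re (tr (A * T))"
    using key Ac Z by (simp add: Teq tr_minus[of _ n])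
  have "A * conj_diag n Z (\<lambda>i. t i - t i * t i) = A * (1\<^sub>m n - T) - A * ((1\<^sub>m n - T) * (1\<^sub>m n - T))"
  proof -
    have "conj_diag n Z (\<lambda>i. t i - t i * t i) = conj_diag n Z (\<lambda>i. (1 - t i) - (1 - t i) * (1 - t i))"
      by (rule arg_cong[of _ _ "conj_diag n Z"]) (auto simp: algebra_simps)
    also have "\<dots> = conj_diag n Z (\<lambda>i. 1 - t i) - conj_diag n Z (\<lambda>i. (1 - t i) * (1 - t i))"
      by (rule conj_diag_minus[OF Z(2), symmetric])
    finally have *: "A * conj_diag n Z (\<lambda>i. t i - t i * t i)
        = A * conj_diag n Z (\<lambda>i. 1 - t i) - A * conj_diag n Z (\<lambda>i. (1 - t i) * (1 - t i))"
      using Ac Z by (simp only: mult_minus_distrib_mat[of _ n n _ n] conj_diag_carrier)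
    show ?thesis
      unfolding I Teq conj_diag_minus[OF Z(2)] conj_diag_mult[OF Z(1)] by (rule *)
  qed
  then show "Re (tr (A * ((1\<^sub>m n - T) * (1\<^sub>m n - T)))) \<le> Re (tr (A * (1\<^sub>m n - T)))"
    using key Ac Z by (simp add: Teq tr_minus[of _ n] minus_carrier_mat[of _ n n])
qed

lemma mat_diff_add_cancel:
  fixes X :: "'a::ab_group_add mat"
  shows "X \<in> carrier_mat n m \<Longrightarrow> Y \<in> carrier_mat n m \<Longrightarrow> X - Y + Y = X"
  by (intro eq_matI) auto

text \<open>With \<open>a\<close> and \<open>b\<close> the matrix elements of \<open>1 - T\<close>
  and \<open>T\<close> between the two eigenbases, \<open>a + b\<close> is the overlap of the
  eigenvectors. The factor 1/2 is the loss in \<open>|a + b|^2 \<le> 2 * (|a|^2 + |b|^2)\<close>;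
  the minimum lies below both weights, and the squares of \<open>1 - T\<close> and \<open>T\<close>
  are dominated by the operators themselves.\<close>

lemma nussbaum_szkola:
  assumes U: "unitary_mat n U" and V: "unitary_mat n V"
    and r: "\<And>i. i < n \<Longrightarrow> 0 \<le> r i" and s: "\<And>j. j < n \<Longrightarrow> 0 \<le> s j"
    and T: "psd n T" and T1: "loewner_le n T (1\<^sub>m n)" and lam: "0 \<le> lam"
  shows "(\<Sum>i<n. \<Sum>j<n. min (r i) (lam * s j) * (cmod ((adj U * V) $$ (i,j)))\<^sup>2) / 2
    \<le> Re (tr (conj_diag n U r * (1\<^sub>m n - T))) + lam * Re (tr (conj_diag n V s * T))"
proof -
  have c: "U \<in> carrier_mat n n" "V \<in> carrier_mat n n" "T \<in> carrier_mat n n"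
    using U V T by (auto simp: unitary_mat_def psd_def)
  have psd_rs: "psd n (conj_diag n U r)" "psd n (conj_diag n V s)"
    using c r s by (auto intro: psd_conj_diag_nonneg)
  have Th: "adj T = T" using T by (simp add: psd_def)
  let ?T' = "1\<^sub>m n - T"
  have T': "adj ?T' = ?T'" "?T' \<in> carrier_mat n n" using c Th by (auto simp: adj_minus[of _ n n])
  let ?a = "\<lambda>i j. (adj U * ?T' * V) $$ (i,j)"
  let ?b = "\<lambda>i j. (adj U * T * V) $$ (i,j)"
  have ab: "?a i j + ?b i j = (adj U * V) $$ (i,j)" if "i < n" "j < n" for i j
  proof -
    have "adj U * ?T' * V + adj U * T * V = adj U * V"
      using c by (simp add: mult_minus_distrib_mat[of _ n n _ n] minus_mult_distrib_mat[of _ n n _ _ n] right_mult_one_mat[of _ n n]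
          mat_diff_add_cancel[of _ n n])
    moreover have "(adj U * ?T' * V + adj U * T * V) $$ (i,j) = ?a i j + ?b i j"
      using that c by (intro index_add_mat(1)) auto
    ultimately show ?thesis by simp
  qed
  \<comment> \<open>\<open>tr_conj_diag_adj_mult\<close> with the roles of \<open>U\<close> and
    \<open>V\<close> exchanged produces the transposed matrix element. Its modulus is that of
    \<open>?a i j\<close> because \<open>1 - T\<close> is Hermitian.\<close>
  have "Re (tr (conj_diag n U r * (?T' * ?T'))) = (\<Sum>i<n. \<Sum>j<n. r i * (cmod (?a i j))\<^sup>2)"
  proof -
    have "Re (tr (conj_diag n U r * (adj ?T' * ?T'))) = (\<Sum>i<n. \<Sum>j<n. r i * (cmod ((adj V * ?T' * U) $$ (j,i)))\<^sup>2)"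
      using tr_conj_diag_adj_mult[OF V c(1) T'(2), of r] by simp
    moreover have "cmod ((adj V * ?T' * U) $$ (j,i)) = cmod (?a i j)" if "i < n" "j < n" for i j
    proof -
      have "adj V * ?T' * U = adj (adj U * ?T' * V)"
        using c T' by (simp add: adj_mult[of _ n n _ n] square_assoc[of _ n])
      then have "(adj V * ?T' * U) $$ (j,i) = cnj (?a i j)" using that c by (simp del: index_mult_mat(1))
      then show ?thesis by (simp only: complex_mod_cnj)
    qed
    ultimately show ?thesis unfolding T'(1) by (simp del: index_mult_mat(1))
  qed
  then have A: "(\<Sum>i<n. \<Sum>j<n. r i * (cmod (?a i j))\<^sup>2) \<le> Re (tr (conj_diag n U r * ?T'))"
    using effect_square_le(2)[OF T T1 psd_rs(1)] by simp
  have "Re (tr (conj_diag n V s * (T * T))) = (\<Sum>j<n. \<Sum>i<n. s j * (cmod (?b i j))\<^sup>2)"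
    using tr_conj_diag_adj_mult[OF U c(2,3), of s] by (simp add: Th)
  also have "\<dots> = (\<Sum>i<n. \<Sum>j<n. s j * (cmod (?b i j))\<^sup>2)" by (rule sum.swap)
  finally have "(\<Sum>i<n. \<Sum>j<n. s j * (cmod (?b i j))\<^sup>2) \<le> Re (tr (conj_diag n V s * T))"
    using effect_square_le(1)[OF T T1 psd_rs(2)] by simp
  then have B: "(\<Sum>i<n. \<Sum>j<n. lam * (s j * (cmod (?b i j))\<^sup>2)) \<le> lam * Re (tr (conj_diag n V s * T))"
    using lam by (simp only: sum_distrib_left[symmetric] mult_left_mono)
  have "(\<Sum>i<n. \<Sum>j<n. min (r i) (lam * s j) * (cmod ((adj U * V) $$ (i,j)))\<^sup>2) / 2
     \<le> (\<Sum>i<n. \<Sum>j<n. r i * (cmod (?a i j))\<^sup>2 + lam * (s j * (cmod (?b i j))\<^sup>2))"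
    unfolding sum_divide_distrib
  proof (intro sum_mono)
    fix i j assume "i \<in> {..<n}" "j \<in> {..<n}"
    then have ij: "i < n" "j < n" by auto
    define m where "m = min (r i) (lam * s j)"
    have m: "0 \<le> m" "m \<le> r i" "m \<le> lam * s j" using r s ij lam by (auto simp: m_def)
    define a where "a = ?a i j"
    define b where "b = ?b i j"
    have "(cmod (a + b))\<^sup>2 \<le> (cmod a + cmod b)\<^sup>2" by (intro power_mono norm_triangle_ineq) simp
    also have "\<dots> \<le> 2 * ((cmod a)\<^sup>2 + (cmod b)\<^sup>2)"
      using sum_squares_bound[of "cmod a" "cmod b"] by (simp add: power2_sum)
    finally have "m * (cmod (a + b))\<^sup>2 \<le> m * (2 * ((cmod a)\<^sup>2 + (cmod b)\<^sup>2))"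
      using m(1) by (rule mult_left_mono)
    then have "m * (cmod (a + b))\<^sup>2 / 2 \<le> m * ((cmod a)\<^sup>2 + (cmod b)\<^sup>2)" by (simp add: algebra_simps)
    also have "\<dots> \<le> r i * (cmod a)\<^sup>2 + (lam * s j) * (cmod b)\<^sup>2"
      unfolding distrib_left using m by (intro add_mono mult_right_mono) auto
    finally show "min (r i) (lam * s j) * (cmod ((adj U * V) $$ (i,j)))\<^sup>2 / 2
      \<le> r i * (cmod (?a i j))\<^sup>2 + lam * (s j * (cmod (?b i j))\<^sup>2)"
      unfolding ab[OF ij, symmetric] a_def[symmetric] b_def[symmetric] m_def[symmetric] by (simp add: mult.assoc)
  qed
  also have "\<dots> = (\<Sum>i<n. \<Sum>j<n. r i * (cmod (?a i j))\<^sup>2) + (\<Sum>i<n. \<Sum>j<n. lam * (s j * (cmod (?b i j))\<^sup>2))"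
    by (simp only: sum.distrib)
  finally show ?thesis using A B by linarith
qed

section \<open>Relative entropy as a classical divergence\<close>

definition finite_rel_entropy :: "complex mat \<Rightarrow> complex mat \<Rightarrow> real" where
  "finite_rel_entropy \<rho> \<sigma> = Re (tr (\<rho> * (mlog \<rho> - mlog \<sigma>)))"

lemma finite_rel_entropy_eq:
  assumes U: "unitary_mat n U" and V: "unitary_mat n V"
  shows "finite_rel_entropy (conj_diag n U r) (conj_diag n V s)
    = (\<Sum>i<n. \<Sum>j<n. r i * (ln (r i) - ln (s j)) * (cmod ((adj U * V) $$ (i,j)))\<^sup>2)"
proof -
  have c: "U \<in> carrier_mat n n" "V \<in> carrier_mat n n"
    using U V by (auto simp: unitary_mat_def)
  have lr: "mlog (conj_diag n U r) = conj_diag n U (\<lambda>i. ln (r i))"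
    unfolding mlog_def using mfun_eq[of n "conj_diag n U r" U r ln] U
    by (simp add: spectral_decomp_conj_diag) (simp add: conj_diag_def)
  have ls: "mlog (conj_diag n V s) = conj_diag n V (\<lambda>i. ln (s i))"
    unfolding mlog_def using mfun_eq[of n "conj_diag n V s" V s ln] V
    by (simp add: spectral_decomp_conj_diag) (simp add: conj_diag_def)
  \<comment> \<open>The last factor on the right is the identity, written in the basis
    \<open>V\<close>. Inserting it makes the term \<open>\<rho> log \<rho>\<close> a double sum over
    the same overlaps as the cross term.\<close>
  have "conj_diag n U r * conj_diag n U (\<lambda>i. ln (r i)) = conj_diag n U (\<lambda>i. r i * ln (r i)) * conj_diag n V (\<lambda>_. 1)"
    using c by (simp add: conj_diag_mult[OF U] conj_diag_one[OF V] right_mult_one_mat[of _ n n])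
  then have "conj_diag n U r * (mlog (conj_diag n U r) - mlog (conj_diag n V s))
     = conj_diag n U (\<lambda>i. r i * ln (r i)) * conj_diag n V (\<lambda>_. 1) - conj_diag n U r * conj_diag n V (\<lambda>i. ln (s i))"
    unfolding lr ls using c by (simp add: mult_minus_distrib_mat[of _ n n _ n])
  then show ?thesis
    unfolding finite_rel_entropy_def using c
    by (simp add: tr_minus[of _ n] tr_conj_diag_conj_diag sum_subtractf[symmetric] algebra_simps del: index_mult_mat(1))
qed

text \<open>Evaluate the difference of the support projections at an eigenvector of the second
  operator with eigenvalue 0: the larger projection contributes 0 and the smaller one minus a sum of
  squared overlaps, so these all vanish. This keeps the default value \<open>ln 0 = 0\<close> out of
  the entropy.\<close>

lemma supp_overlap_zero:
  assumes U: "unitary_mat n U" and V: "unitary_mat n V"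
    and le: "loewner_le n (supp (conj_diag n U r)) (supp (conj_diag n V s))"
    and ij: "i < n" "j < n" "r i \<noteq> 0" "s j = 0"
  shows "(adj U * V) $$ (i,j) = 0"
proof -
  let ?f = "\<lambda>x::real. if x = 0 then 0 else 1::real"
  have c: "U \<in> carrier_mat n n" "V \<in> carrier_mat n n"
    using U V by (auto simp: unitary_mat_def)
  have lr: "supp (conj_diag n U r) = conj_diag n U (\<lambda>i. ?f (r i))"
    unfolding supp_def using mfun_eq[of n "conj_diag n U r" U r ?f] U
    by (simp add: spectral_decomp_conj_diag) (simp add: conj_diag_def)
  have ls: "supp (conj_diag n V s) = conj_diag n V (\<lambda>i. ?f (s i))"
    unfolding supp_def using mfun_eq[of n "conj_diag n V s" V s ?f] V
    by (simp add: spectral_decomp_conj_diag) (simp add: conj_diag_def)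
  let ?R = "conj_diag n U (\<lambda>i. ?f (r i))"
  let ?S = "conj_diag n V (\<lambda>i. ?f (s i))"
  have "psd n (?S - ?R)" using le by (simp add: loewner_le_def lr ls)
  then have "0 \<le> Re ((adj V * (?S - ?R) * V) $$ (j,j))" by (rule psd_conj_index[OF _ c(2) ij(2)])
  also have "adj V * (?S - ?R) * V = adj V * ?S * V - adj V * ?R * V"
    using c by (simp add: mult_minus_distrib_mat[of _ n n _ n] minus_mult_distrib_mat[of _ n n _ _ n])
  also have "Re ((adj V * ?S * V - adj V * ?R * V) $$ (j,j)) = - (\<Sum>i<n. ?f (r i) * (cmod ((adj U * V) $$ (i,j)))\<^sup>2)"
    using c ij index_cross_conj_diag[OF c ij(2), of "\<lambda>i. ?f (r i)"]
    by (simp add: conj_diag_cancel[OF V] del: index_mult_mat(1)) (simp add: mat_diag_def)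
  finally have "(\<Sum>i<n. ?f (r i) * (cmod ((adj U * V) $$ (i,j)))\<^sup>2) \<le> 0" by simp
  then have "(\<Sum>i<n. ?f (r i) * (cmod ((adj U * V) $$ (i,j)))\<^sup>2) = 0"
    by (intro antisym sum_nonneg) auto
  then have "\<forall>i\<in>{..<n}. ?f (r i) * (cmod ((adj U * V) $$ (i,j)))\<^sup>2 = 0"
    by (rule sum_nonneg_eq_0_iff[THEN iffD1, rotated 2]) auto
  then have "?f (r i) * (cmod ((adj U * V) $$ (i,j)))\<^sup>2 = 0" using ij(1) by blast
  then show ?thesis using ij by (simp del: index_mult_mat(1))
qed

text \<open>Pointwise form of the Markov estimate. The summand \<open>s * w\<close> compensates the
  region where the log-likelihood ratio is negative, since
  \<open>r * (ln r - ln s) + s \<ge> r\<close> by the tangent bound for \<open>ln\<close>.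
  Hypothesis \<open>z\<close> confines the default value of \<open>ln s\<close> at
  \<open>s = 0\<close> to terms that vanish.\<close>

lemma log_likelihood_bound:
  fixes r s lam w :: real
  assumes "0 \<le> r" "0 \<le> s" "0 \<le> w" "1 < lam" and z: "r \<noteq> 0 \<Longrightarrow> s = 0 \<Longrightarrow> w = 0"
  shows "ln lam * (r * w - min r (lam * s) * w) \<le> r * (ln r - ln s) * w + s * w"
    and "r * w - s * w \<le> r * (ln r - ln s) * w"
proof -
  consider "w = 0" | "r = 0" | "w > 0" "r > 0" "s > 0" using assms by fastforce
  then have "(r * w - s * w \<le> r * (ln r - ln s) * w) \<and>
    ln lam * (r * w - min r (lam * s) * w) \<le> r * (ln r - ln s) * w + s * w"
  proof cases
    case 1 then show ?thesis by simp
  next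
    case 2 then show ?thesis using assms by (simp add: min_def)
  next
    case 3
    have "ln (s / r) \<le> s / r - 1" using 3 by (intro ln_le_minus_one) simp
    then have "1 - s / r \<le> ln r - ln s" using 3 by (simp add: ln_div)
    then have "r * (1 - s / r) \<le> r * (ln r - ln s)" using 3 by (intro mult_left_mono) auto
    then have *: "r - s \<le> r * (ln r - ln s)" using 3 by (simp add: right_diff_distrib)
    then have a: "r * w - s * w \<le> r * (ln r - ln s) * w"
      using 3 by (simp only: left_diff_distrib[symmetric] mult_right_mono less_imp_le)
    have "ln lam * (r - min r (lam * s)) \<le> r * (ln r - ln s) + s"
    proof (cases "r \<le> lam * s")
      case True
      then show ?thesis using * 3 by simp
    next
      case False
      then have "ln (lam * s) \<le> ln r" using 3 assms by simp
      then have l: "ln lam \<le> ln r - ln s" using 3 assms by (simp add: ln_mult)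
      have "ln lam * (r - lam * s) \<le> ln lam * r" using 3 assms by (intro mult_left_mono) auto
      also have "\<dots> \<le> (ln r - ln s) * r" using l 3 by (intro mult_right_mono) auto
      finally show ?thesis using False 3 by (simp add: mult.commute)
    qed
    then have "ln lam * (r - min r (lam * s)) * w \<le> (r * (ln r - ln s) + s) * w"
      using 3 by (intro mult_right_mono) auto
    then show ?thesis using a by (simp add: algebra_simps)
  qed
  then show "ln lam * (r * w - min r (lam * s) * w) \<le> r * (ln r - ln s) * w + s * w"
    "r * w - s * w \<le> r * (ln r - ln s) * w" by auto
qed

text \<open>Sums of the pointwise inequalities. The \<open>+ 1\<close> is the total mass of the
  second distribution, picked up by the summand \<open>s * w\<close>; nonnegativity is the classical
  Gibbs inequality. Dividing by \<open>ln lam\<close> bounds \<open>1 - m\<close>, the mass of the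
  first distribution that the minimum cuts off.\<close>

lemma stein_converse:
  assumes \<rho>: "density n \<rho>" and \<sigma>: "density n \<sigma>" and le: "loewner_le n (supp \<rho>) (supp \<sigma>)"
  shows "0 \<le> finite_rel_entropy \<rho> \<sigma>"
    and "psd n T \<Longrightarrow> loewner_le n T (1\<^sub>m n) \<Longrightarrow> 1 < lam \<Longrightarrow>
      (1 - (finite_rel_entropy \<rho> \<sigma> + 1) / ln lam) / 2
        \<le> Re (tr (\<rho> * (1\<^sub>m n - T))) + lam * Re (tr (\<sigma> * T))"
proof -
  obtain U r where "spectral_decomp n \<rho> U r" and r: "\<And>i. i < n \<Longrightarrow> 0 \<le> r i"
    using psd_spectral_decomp[of n \<rho>] \<rho> by (auto simp: density_def)
  then have U: "unitary_mat n U" and \<rho>eq: "\<rho> = conj_diag n U r" by (auto simp: spectral_decomp_conj_diag)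
  obtain V s where "spectral_decomp n \<sigma> V s" and s: "\<And>i. i < n \<Longrightarrow> 0 \<le> s i"
    using psd_spectral_decomp[of n \<sigma>] \<sigma> by (auto simp: density_def)
  then have V: "unitary_mat n V" and \<sigma>eq: "\<sigma> = conj_diag n V s" by (auto simp: spectral_decomp_conj_diag)
  have c: "U \<in> carrier_mat n n" "V \<in> carrier_mat n n"
    using U V by (auto simp: unitary_mat_def)
  define w where "w i j = (cmod ((adj U * V) $$ (i,j)))\<^sup>2" for i j
  have w0: "0 \<le> w i j" for i j by (simp add: w_def)
  have wz: "w i j = 0" if "i < n" "j < n" "r i \<noteq> 0" "s j = 0" for i j
    using supp_overlap_zero[OF U V le[unfolded \<rho>eq \<sigma>eq] that] by (simp add: w_def del: index_mult_mat(1))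
  have "tr (conj_diag n U r * conj_diag n V (\<lambda>_. 1)) = 1"
    using \<rho> c by (simp add: density_def \<rho>eq conj_diag_one[OF V] right_mult_one_mat[of _ n n])
  then have P1: "(\<Sum>i<n. \<Sum>j<n. r i * w i j) = 1"
    by (simp add: tr_conj_diag_conj_diag[OF c] w_def[symmetric] del: of_real_sum index_mult_mat(1))
  have "tr (conj_diag n U (\<lambda>_. 1) * conj_diag n V s) = 1"
    using \<sigma> c by (simp add: density_def \<sigma>eq conj_diag_one[OF U] left_mult_one_mat[of _ n n])
  then have Q1: "(\<Sum>i<n. \<Sum>j<n. s j * w i j) = 1"
    by (simp add: tr_conj_diag_conj_diag[OF c] w_def[symmetric] del: of_real_sum index_mult_mat(1))
  have S: "finite_rel_entropy \<rho> \<sigma> = (\<Sum>i<n. \<Sum>j<n. r i * (ln (r i) - ln (s j)) * w i j)"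
    unfolding \<rho>eq \<sigma>eq finite_rel_entropy_eq[OF U V] w_def ..
  note ll = log_likelihood_bound[OF r s w0 _ wz]
  have "(\<Sum>i<n. \<Sum>j<n. r i * w i j - s j * w i j) \<le> finite_rel_entropy \<rho> \<sigma>"
    unfolding S by (intro sum_mono ll(2)[where lam = 2]) auto
  then show "0 \<le> finite_rel_entropy \<rho> \<sigma>" by (simp add: sum_subtractf P1 Q1)
  assume T: "psd n T" and T1: "loewner_le n T (1\<^sub>m n)" and lam: "1 < lam"
  define m where "m = (\<Sum>i<n. \<Sum>j<n. min (r i) (lam * s j) * w i j)"
  have "ln lam * (1 - m) = ln lam * (\<Sum>i<n. \<Sum>j<n. r i * w i j - min (r i) (lam * s j) * w i j)"
    by (simp only: sum_subtractf P1 m_def)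
  also have "\<dots> = (\<Sum>i<n. \<Sum>j<n. ln lam * (r i * w i j - min (r i) (lam * s j) * w i j))"
    by (simp only: sum_distrib_left)
  also have "\<dots>
      \<le> (\<Sum>i<n. \<Sum>j<n. r i * (ln (r i) - ln (s j)) * w i j + s j * w i j)"
    using lam by (intro sum_mono ll(1)) auto
  also have "\<dots> = finite_rel_entropy \<rho> \<sigma> + 1" by (simp only: sum.distrib S Q1)
  finally have "ln lam * (1 - m) \<le> finite_rel_entropy \<rho> \<sigma> + 1" .
  then have "1 - m \<le> (finite_rel_entropy \<rho> \<sigma> + 1) / ln lam"
    using lam by (simp add: pos_le_divide_eq mult.commute)
  moreover have "m / 2 \<le> Re (tr (\<rho> * (1\<^sub>m n - T))) + lam * Re (tr (\<sigma> * T))"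
    unfolding \<rho>eq \<sigma>eq m_def w_def using lam by (intro nussbaum_szkola[OF U V r s T T1]) auto
  ultimately show "(1 - (finite_rel_entropy \<rho> \<sigma> + 1) / ln lam) / 2
        \<le> Re (tr (\<rho> * (1\<^sub>m n - T))) + lam * Re (tr (\<sigma> * T))" by argo
qed

section \<open>The direct part for independent copies\<close>

lemma psd_kron_one:
  assumes "psd n A"
  shows "psd (n * m) (kron A (1\<^sub>m m))"
proof -
  obtain B where B: "B \<in> carrier_mat n n" "A = adj B * B" using psd_factor[OF assms] by blast
  then have "kron A (1\<^sub>m m) = adj (kron B (1\<^sub>m m)) * kron B (1\<^sub>m m)"
    by (simp add: adj_kron kron_mult[of _ n n _ m m _ n _ m])
  then show ?thesis using B by (simp add: psd_adj_mult_self[of _ "n * m"])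
qed

lemma digit_prod_cong:
  "(\<And>i. i < d \<Longrightarrow> f i = g i) \<Longrightarrow> i < d ^ k \<Longrightarrow> digit_prod d k f i = digit_prod d k g i"
proof (induction k arbitrary: i)
  case (Suc k)
  then have i: "i < d * d ^ k" by simp
  then have "i div d ^ k < d" "i mod d ^ k < d ^ k"
    by (auto simp: less_mult_imp_div_less mod_less_of_less_mult)
  then show ?case using Suc by simp
qed simp

text \<open>The complement splits as \<open>1 - Q P Q = Q' + Q P' Q\<close>. The parallelogram
  identity with the positive term \<open>R P' R\<close> dropped gives
  \<open>Q P' Q \<le> 2 P' + 2 Q' P' Q' \<le> 2 P' + 2 Q'\<close>. Together with the leading
  \<open>Q'\<close> this accounts for the constants 2 and 3.\<close>

lemma gentle_product:
  assumes A: "psd n A" and P: "P \<in> carrier_mat n n" "adj P = P" "P * P = P"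
    and Q: "Q \<in> carrier_mat n n" "adj Q = Q" "Q * Q = Q"
  shows "psd n (1\<^sub>m n - Q * P * Q)"
    and "Re (tr (A * (1\<^sub>m n - Q * P * Q)))
      \<le> 2 * Re (tr (A * (1\<^sub>m n - P))) + 3 * Re (tr (A * (1\<^sub>m n - Q)))"
proof -
  have Ac: "A \<in> carrier_mat n n" using A by (simp add: psd_def)
  define P' where "P' = 1\<^sub>m n - P"
  define Q' where "Q' = 1\<^sub>m n - Q"
  have sub: "(1\<^sub>m n - R) * (1\<^sub>m n - R) = 1\<^sub>m n - R" if "R \<in> carrier_mat n n" "R * R = R" for R :: "complex mat"
  proof -
    have "(1\<^sub>m n - R) * (1\<^sub>m n - R) = 1\<^sub>m n - R - (R - R)"
      using that by (simp add: mult_minus_distrib_mat[of _ n n _ n] minus_mult_distrib_mat[of _ n n _ _ n]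
          minus_carrier_mat[of _ n n])
    also have "\<dots> = 1\<^sub>m n - R" using that by (intro eq_matI) auto
    finally show ?thesis .
  qed
  have P': "P' \<in> carrier_mat n n" "adj P' = P'" "P' * P' = P'"
    using P sub by (auto simp: P'_def adj_minus[of _ n n] minus_carrier_mat[of _ n n])
  have Q': "Q' \<in> carrier_mat n n" "adj Q' = Q'" "Q' * Q' = Q'"
    using Q sub by (auto simp: Q'_def adj_minus[of _ n n] minus_carrier_mat[of _ n n])
  note dist = mult_minus_distrib_mat[of _ n n _ n] minus_mult_distrib_mat[of _ n n _ _ n]
      mult_add_distrib_mat[of _ n n _ n] add_mult_distrib_mat[of _ n n _ _ n]
  have sandwich: "R * E * R = adj (E * R) * (E * R)"
    if "R \<in> carrier_mat n n" "E \<in> carrier_mat n n" "adj R = R" "adj E = E" "E * E = E" for R E :: "complex mat"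
  proof -
    have "E * (E * R) = E * R" using that by (simp add: square_assoc[of E n E R, symmetric])
    then show ?thesis using that by (simp add: adj_mult[of _ n n _ n] square_assoc[of _ n])
  qed
  have QPQ: "1\<^sub>m n - Q * P * Q = Q' + Q * P' * Q"
  proof -
    have "Q * P' * Q = Q - Q * P * Q" unfolding P'_def using P Q by (simp add: dist)
    then show ?thesis unfolding Q'_def using P Q by (intro eq_matI) auto
  qed
  have "psd n Q'" using psd_adj_mult_self[OF Q'(1)] Q' by simp
  moreover have "psd n (Q * P' * Q)"
    using psd_adj_mult_self[of "P' * Q" n n] sandwich[of Q P'] P' Q by simp
  ultimately show "psd n (1\<^sub>m n - Q * P * Q)" unfolding QPQ by (rule psd_add)
  define R where "R = 1\<^sub>m n + Q'"
  have R: "R \<in> carrier_mat n n" "adj R = R" using Q' by (auto simp: R_def adj_add[of _ n n])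
  \<comment> \<open>parallelogram identity, with R = 1 + Q' and Q = 1 - Q'\<close>
  have "R * P' * R + Q * P' * Q = P' + P' + (Q' * P' * Q' + Q' * P' * Q')"
  proof -
    have "Q = 1\<^sub>m n - Q'" unfolding Q'_def using Q by (intro eq_matI) auto
    then have "Q * P' * Q = P' - Q' * P' - (P' * Q' - Q' * P' * Q')"
      using P' Q' by (simp add: dist minus_carrier_mat[of _ n n])
    moreover have "R * P' * R = P' + Q' * P' + (P' * Q' + Q' * P' * Q')"
      unfolding R_def using P' Q' by (simp add: dist add_carrier_mat[of _ n n])
    ultimately show ?thesis using P' Q' by (intro eq_matI) auto
  qed
  moreover have "Q' * P' * Q' = Q' - Q' * P * Q'" 
    unfolding P'_def using P Q' by (simp add: dist)
  ultimately have eq: "R * P' * R + Q * P' * Q = P' + P' + (Q' - Q' * P * Q' + (Q' - Q' * P * Q'))" by simp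
  have "0 \<le> Re (tr (A * (R * P' * R)))"
    using sandwich[of R P'] R P' psd_adj_mult_self[of "P' * R" n n] by (intro tr_psd_mult_nonneg[OF A]) simp
  moreover have "0 \<le> Re (tr (A * (Q' * P * Q')))"
    using sandwich[of Q' P] Q' P psd_adj_mult_self[of "P * Q'" n n] by (intro tr_psd_mult_nonneg[OF A]) simp
  moreover have "tr (A * (R * P' * R)) + tr (A * (Q * P' * Q))
      = 2 * tr (A * P') + 2 * tr (A * Q') - 2 * tr (A * (Q' * P * Q'))"
  proof -
    have "tr (A * (R * P' * R)) + tr (A * (Q * P' * Q)) = tr (A * (R * P' * R + Q * P' * Q))"
      using Ac R P' Q by (simp add: dist tr_add[of _ n])
    also have "\<dots> = 2 * tr (A * P') + 2 * tr (A * Q') - 2 * tr (A * (Q' * P * Q'))"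
      unfolding eq using Ac P P' Q' by (simp add: dist tr_add[of _ n] tr_minus[of _ n] minus_carrier_mat[of _ n n])
    finally show ?thesis .
  qed
  moreover have "tr (A * (1\<^sub>m n - Q * P * Q)) = tr (A * Q') + tr (A * (Q * P' * Q))"
    unfolding QPQ using Ac Q P' Q' by (simp add: dist tr_add[of _ n])
  ultimately show "Re (tr (A * (1\<^sub>m n - Q * P * Q)))
      \<le> 2 * Re (tr (A * (1\<^sub>m n - P))) + 3 * Re (tr (A * (1\<^sub>m n - Q)))"
    unfolding P'_def[symmetric] Q'_def[symmetric] by (simp add: complex_eq_iff)
qed

text \<open>Measuring \<open>kpow k \<rho>\<close> in a product basis produces \<open>k\<close>
  independent outcomes with law \<open>p\<close>, whether or not \<open>\<rho>\<close> is diagonal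
  in that basis. One statement therefore serves the eigenbases of both states.\<close>

lemma kpow_measure_chebyshev:
  assumes \<rho>: "density M \<rho>" and V: "unitary_mat M V" and e: "0 < e"
    and p_def: "p = (\<lambda>j. Re ((adj V * \<rho> * V) $$ (j,j)))"
    and k: "0 < k" and far: "\<And>J. J < M ^ k \<Longrightarrow> J \<in> F \<Longrightarrow> 0 < digit_prod M k p J \<Longrightarrow>
      real k * e \<le> \<bar>digit_sum M k L J - real k * (\<Sum>j<M. p j * L j)\<bar>"
  shows "Re (tr (kpow k \<rho> * conj_diag (M ^ k) (kpow k V) (indicator F)))
     \<le> (\<Sum>j<M. p j * (L j - (\<Sum>j<M. p j * L j))\<^sup>2) / (e\<^sup>2 * real k)"
proof -
  have psd: "psd M \<rho>" and \<rho>c: "\<rho> \<in> carrier_mat M M" and tr1: "tr \<rho> = 1" 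
    using \<rho> by (auto simp: density_def psd_def)
  have Vc: "V \<in> carrier_mat M M" using V by (simp add: unitary_mat_def)
  have B: "adj V * \<rho> * V \<in> carrier_mat M M" using Vc \<rho>c by simp
  have diag: "(adj V * \<rho> * V) $$ (j,j) = complex_of_real (p j)" if "j < M" for j
  proof -
    have "adj (adj V * \<rho> * V) = adj V * \<rho> * V"
      using Vc \<rho>c psd by (simp add: adj_mult[of _ M M _ M] square_assoc[of _ M] psd_def)
    then have "cnj ((adj V * \<rho> * V) $$ (j,j)) = (adj V * \<rho> * V) $$ (j,j)"
      using index_adj[of j "adj V * \<rho> * V" j] that Vc by (simp del: index_mult_mat(1))
    then show ?thesis unfolding p_def by (metis Reals_cnj_iff of_real_Re)
  qed
  have p0: "0 \<le> p j" if "j < M" for j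
    unfolding p_def by (rule psd_conj_index[OF psd Vc that])
  have "tr (\<rho> * conj_diag M V (\<lambda>_. 1)) = complex_of_real (\<Sum>j<M. p j)"
    using tr_mult_conj_diag[OF \<rho>c Vc, of "\<lambda>_. 1"] diag by (simp del: index_mult_mat(1))
  then have "complex_of_real (\<Sum>j<M. p j) = 1"
    using \<rho>c tr1 by (simp add: conj_diag_one[OF V] right_mult_one_mat[of _ M M])
  then have p1: "(\<Sum>j<M. p j) = 1" by (metis of_real_eq_1_iff)
  have "adj (kpow k V) * kpow k \<rho> * kpow k V = kpow k (adj V * \<rho> * V)"
    using Vc \<rho>c by (simp add: adj_kpow kpow_mult[of _ M])
  then have "tr (kpow k \<rho> * conj_diag (M ^ k) (kpow k V) (indicator F))
     = (\<Sum>J<M ^ k. kpow k (adj V * \<rho> * V) $$ (J,J) * complex_of_real (indicator F J))"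
    using tr_mult_conj_diag[of "kpow k \<rho>" "M ^ k" "kpow k V" "indicator F"] Vc \<rho>c by simp
  also have "\<dots> = (\<Sum>J<M ^ k. complex_of_real (if J \<in> F then digit_prod M k p J else 0))"
    using kpow_index_diag[OF B diag, of _ k] by (intro sum.cong refl) (auto simp: indicator_def)
  finally have "Re (tr (kpow k \<rho> * conj_diag (M ^ k) (kpow k V) (indicator F)))
     = (\<Sum>J<M ^ k. if J \<in> F then digit_prod M k p J else 0)" by (simp del: of_real_sum add: of_real_sum[symmetric])
  also have "\<dots> \<le> (\<Sum>j<M. p j * (L j - (\<Sum>j<M. p j * L j))\<^sup>2) / (e\<^sup>2 * real k)"
    by (rule digit_chebyshev[OF p0 p1 e k far])
  finally show ?thesis .
qed

lemma conj_diag_indicator: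
  assumes "unitary_mat n V"
  shows "adj (conj_diag n V (indicator F)) = conj_diag n V (indicator F)"
    and "conj_diag n V (indicator F) * conj_diag n V (indicator F) = conj_diag n V (indicator F)"
    and "1\<^sub>m n - conj_diag n V (indicator F) = conj_diag n V (indicator (- F))"
proof -
  have V: "V \<in> carrier_mat n n" using assms by (simp add: unitary_mat_def)
  show "adj (conj_diag n V (indicator F)) = conj_diag n V (indicator F)" by (rule adj_conj_diag[OF V])
  have "(\<lambda>i. indicator F i * indicator F i) = (indicator F :: nat \<Rightarrow> real)" by (auto simp: indicator_def)
  then show "conj_diag n V (indicator F) * conj_diag n V (indicator F) = conj_diag n V (indicator F)"
    by (simp add: conj_diag_mult[OF assms])
  have "1\<^sub>m n - conj_diag n V (indicator F) = conj_diag n V (\<lambda>i. 1 - indicator F i)"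
    unfolding conj_diag_one[OF assms, symmetric] by (rule conj_diag_minus[OF V])
  also have "(\<lambda>i. 1 - indicator F i) = (indicator (- F) :: nat \<Rightarrow> real)" by (auto simp: indicator_def)
  finally show "1\<^sub>m n - conj_diag n V (indicator F) = conj_diag n V (indicator (- F))" .
qed

text \<open>The third property holds because \<open>T k\<close> is built from spectral functions of
  the two powers. It is the source of invariance later on: the group commutes with these powers both
  when acting on one copy and when acting on all. Each of the two thresholds gives up
  \<open>e\<close> in the exponent, whence \<open>2 * e\<close>.\<close>

lemma stein_direct:
  assumes \<rho>: "density M \<rho>" and \<sigma>: "density M \<sigma>" and e: "0 < e"
  obtains C T where
    "\<And>k. psd (M ^ k) (T k)" "\<And>k. psd (M ^ k) (1\<^sub>m (M ^ k) - T k)"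
    "\<And>k X. X \<in> carrier_mat (M ^ k) (M ^ k) \<Longrightarrow> X * kpow k \<rho> = kpow k \<rho> * X \<Longrightarrow>
        X * kpow k \<sigma> = kpow k \<sigma> * X \<Longrightarrow> X * T k = T k * X"
    "\<And>k. 0 < k \<Longrightarrow> Re (tr (kpow k \<rho> * (1\<^sub>m (M ^ k) - T k))) \<le> C / real k"
    "\<And>k. Re (tr (kpow k \<sigma> * T k)) \<le> exp (- real k * (finite_rel_entropy \<rho> \<sigma> - 2 * e))"
proof -
  obtain U r where Ur: "spectral_decomp M \<rho> U r" and r: "\<And>i. i < M \<Longrightarrow> 0 \<le> r i"
    using psd_spectral_decomp[of M \<rho>] \<rho> by (auto simp: density_def)
  then have U: "unitary_mat M U" and \<rho>eq: "\<rho> = conj_diag M U r" by (auto simp: spectral_decomp_conj_diag)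
  obtain V s where Vs: "spectral_decomp M \<sigma> V s" and s: "\<And>i. i < M \<Longrightarrow> 0 \<le> s i"
    using psd_spectral_decomp[of M \<sigma>] \<sigma> by (auto simp: density_def)
  then have V: "unitary_mat M V" and \<sigma>eq: "\<sigma> = conj_diag M V s" by (auto simp: spectral_decomp_conj_diag)
  have c: "U \<in> carrier_mat M M" "V \<in> carrier_mat M M"
    using U V by (auto simp: unitary_mat_def)
  have \<rho>c: "\<rho> \<in> carrier_mat M M" "psd M \<rho>" using \<rho> by (auto simp: density_def psd_def)
  define p where "p = (\<lambda>j. Re ((adj V * \<rho> * V) $$ (j,j)))"
  \<comment> \<open>On indices below \<open>M\<close> this is \<open>r\<close> again, written as the
    outcome law of \<open>\<rho>\<close> in its own eigenbasis so that the same Chebyshev bound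
    covers \<open>P\<close> and \<open>Q\<close>.\<close>
  define p' where "p' = (\<lambda>j. Re ((adj U * \<rho> * U) $$ (j,j)))"
  have p'r: "p' i = r i" if "i < M" for i
    using that unfolding p'_def \<rho>eq conj_diag_cancel[OF U] by (simp add: mat_diag_def)
  have p_eq: "p j = (\<Sum>i<M. r i * (cmod ((adj U * V) $$ (i,j)))\<^sup>2)" if "j < M" for j
    unfolding p_def \<rho>eq index_cross_conj_diag[OF c that] by simp
  define h where "h = (\<Sum>i<M. p' i * ln (r i))"
  define b where "b = (\<Sum>j<M. p j * ln (s j))"
  have S: "finite_rel_entropy \<rho> \<sigma> = h - b"
  proof -
    \<comment> \<open>A row of the unitary \<open>adj U * V\<close> has norm 1, so summing out
      \<open>j\<close> reduces the first double sum to \<open>h\<close>.\<close>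
    have wr: "(\<Sum>j<M. (cmod ((adj U * V) $$ (i,j)))\<^sup>2) = 1" if i: "i < M" for i
    proof -
      have "unitary_mat M (adj U * V)" by (intro unitary_mult unitary_adj U V)
      then have W: "adj U * V \<in> carrier_mat M M" "(adj U * V) * adj (adj U * V) = 1\<^sub>m M" by (auto simp: unitary_mat_def)
      have "1 = ((adj U * V) * adj (adj U * V)) $$ (i,i)" using W(2) i by simp
      also have "\<dots> = (\<Sum>j<M. (adj U * V) $$ (i,j) * cnj ((adj U * V) $$ (i,j)))"
        using W(1) i c by (subst index_mult_sum[of _ M M _ M]) (auto intro!: sum.cong simp del: index_mult_mat(1))
      also have "\<dots> = complex_of_real (\<Sum>j<M. (cmod ((adj U * V) $$ (i,j)))\<^sup>2)"
        by (simp only: of_real_sum complex_norm_square)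
      finally show ?thesis by (metis of_real_eq_1_iff)
    qed
    have "finite_rel_entropy \<rho> \<sigma> = (\<Sum>i<M. \<Sum>j<M. r i * ln (r i) * (cmod ((adj U * V) $$ (i,j)))\<^sup>2)
       - (\<Sum>i<M. \<Sum>j<M. r i * (cmod ((adj U * V) $$ (i,j)))\<^sup>2 * ln (s j))"
      unfolding \<rho>eq \<sigma>eq finite_rel_entropy_eq[OF U V]
      by (simp add: sum_subtractf[symmetric] algebra_simps del: index_mult_mat(1))
    also have "(\<Sum>i<M. \<Sum>j<M. r i * ln (r i) * (cmod ((adj U * V) $$ (i,j)))\<^sup>2) = h"
      unfolding h_def sum_distrib_left[symmetric] by (intro sum.cong refl) (simp add: wr p'r del: index_mult_mat(1))
    also have "(\<Sum>i<M. \<Sum>j<M. r i * (cmod ((adj U * V) $$ (i,j)))\<^sup>2 * ln (s j)) = b"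
      unfolding b_def by (subst sum.swap) (simp add: p_eq sum_distrib_right del: index_mult_mat(1))
    finally show ?thesis .
  qed
  \<comment> \<open>zero eigenvalues, where ln is the junk value 0, lie outside FP and inside FQ\<close>
  define FP where "FP k = {I. exp (real k * (h - e)) \<le> digit_prod M k r I}" for k
  define FQ where "FQ k = {J. digit_prod M k s J \<le> exp (real k * (b + e))}" for k
  define P where "P k = conj_diag (M ^ k) (kpow k U) (indicator (FP k))" for k
  define Q where "Q k = conj_diag (M ^ k) (kpow k V) (indicator (FQ k))" for k
  have Uk: "unitary_mat (M ^ k) (kpow k U)" "kpow k U \<in> carrier_mat (M ^ k) (M ^ k)"
    and Vk: "unitary_mat (M ^ k) (kpow k V)" "kpow k V \<in> carrier_mat (M ^ k) (M ^ k)" for k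
    using U V c by (auto intro: unitary_kpow)
  have \<rho>k: "spectral_decomp (M ^ k) (kpow k \<rho>) (kpow k U) (digit_prod M k r)" for k
    by (rule spectral_decomp_kpow[OF Ur])
  have \<sigma>k: "spectral_decomp (M ^ k) (kpow k \<sigma>) (kpow k V) (digit_prod M k s)" for k
    by (rule spectral_decomp_kpow[OF Vs])
  have Pk: "P k \<in> carrier_mat (M ^ k) (M ^ k)" "adj (P k) = P k" "P k * P k = P k"
    and Qk: "Q k \<in> carrier_mat (M ^ k) (M ^ k)" "adj (Q k) = Q k" "Q k * Q k = Q k" for k
    using Uk Vk by (simp_all add: P_def Q_def conj_diag_indicator)
  define T where "T k = Q k * P k * Q k" for k
  \<comment> \<open>The two variances over \<open>e\<close> squared, with the factors 2 and 3 of
    \<open>gentle_product\<close>; Chebyshev's inequality supplies the remaining factor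
    \<open>1 / k\<close>.\<close>
  define C where "C = 2 * ((\<Sum>j<M. p' j * (ln (r j) - h)\<^sup>2) / e\<^sup>2) + 3 * ((\<Sum>j<M. p j * (ln (s j) - b)\<^sup>2) / e\<^sup>2)"
  have "psd (M ^ k) (T k)" for k
  proof -
    have "P k * (P k * Q k) = P k * Q k" using Pk Qk by (simp add: square_assoc[of "P k" "M ^ k" "P k" "Q k", symmetric])
    then have "T k = adj (P k * Q k) * (P k * Q k)"
      using Pk Qk by (simp add: T_def adj_mult[of _ "M ^ k" "M ^ k" _ "M ^ k"] square_assoc[of _ "M ^ k"])
    then show ?thesis using psd_adj_mult_self[of "P k * Q k" "M ^ k" "M ^ k"] Pk Qk by simp
  qed
  moreover have "psd (M ^ k) (1\<^sub>m (M ^ k) - T k)" for k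
    unfolding T_def by (rule gentle_product(1)[OF psd_kpow[OF \<rho>c(2)] Pk Qk])
  moreover have "X * T k = T k * X"
    if X: "X \<in> carrier_mat (M ^ k) (M ^ k)" and "X * kpow k \<rho> = kpow k \<rho> * X" "X * kpow k \<sigma> = kpow k \<sigma> * X" for k X
  proof -
    have "conj_diag (M ^ k) (kpow k U) (\<lambda>i. indicator {exp (real k * (h - e))..} (digit_prod M k r i)) = P k"
      unfolding P_def by (rule arg_cong[of _ _ "conj_diag _ _"]) (auto simp: FP_def indicator_def)
    then have PX: "P k * X = X * P k"
      using spectral_decomp_intertwine[OF \<rho>k \<rho>k X that(2)[symmetric], of "indicator {exp (real k * (h - e))..}"]
      by (simp add: conj_diag_def)
    have "conj_diag (M ^ k) (kpow k V) (\<lambda>i. indicator {..exp (real k * (b + e))} (digit_prod M k s i)) = Q k"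
      unfolding Q_def by (rule arg_cong[of _ _ "conj_diag _ _"]) (auto simp: FQ_def indicator_def)
    then have QX: "Q k * X = X * Q k"
      using spectral_decomp_intertwine[OF \<sigma>k \<sigma>k X that(3)[symmetric], of "indicator {..exp (real k * (b + e))}"]
      by (simp add: conj_diag_def)
    note sa = square_assoc[of _ "M ^ k"]
    have "X * T k = (X * Q k) * (P k * Q k)" using X Pk Qk by (simp add: T_def sa)
    also have "\<dots> = Q k * ((X * P k) * Q k)" unfolding QX[symmetric] using X Pk Qk by (simp add: sa)
    also have "\<dots> = Q k * (P k * (X * Q k))" unfolding PX[symmetric] using X Pk Qk by (simp add: sa)
    also have "\<dots> = T k * X" unfolding QX[symmetric] using X Pk Qk by (simp add: T_def sa)
    finally show ?thesis .
  qed
  moreover have "Re (tr (kpow k \<rho> * (1\<^sub>m (M ^ k) - T k))) \<le> C / real k" if k: "0 < k" for k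
  proof -
    have "Re (tr (kpow k \<rho> * (1\<^sub>m (M ^ k) - P k)))
        \<le> (\<Sum>j<M. p' j * (ln (r j) - (\<Sum>j<M. p' j * ln (r j)))\<^sup>2) / (e\<^sup>2 * real k)"
      unfolding P_def conj_diag_indicator(3)[OF Uk(1)]
    proof (rule kpow_measure_chebyshev[OF \<rho> U e p'_def k])
      fix J assume J: "J < M ^ k" "J \<in> - FP k" "0 < digit_prod M k p' J"
      have "digit_prod M k p' J = digit_prod M k r J" by (rule digit_prod_cong[OF p'r J(1)])
      then have pos: "0 < digit_prod M k r J" using J(3) by simp
      have "digit_prod M k r J < exp (real k * (h - e))" using J(2) by (auto simp: FP_def)
      then have "ln (digit_prod M k r J) < real k * (h - e)" using pos by (metis exp_less_cancel_iff exp_ln)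
      then have "digit_sum M k (\<lambda>i. ln (r i)) J < real k * (h - e)"
        using ln_digit_prod[OF r J(1) pos] by simp
      then show "real k * e \<le> \<bar>digit_sum M k (\<lambda>i. ln (r i)) J - real k * (\<Sum>j<M. p' j * ln (r j))\<bar>"
        by (simp add: h_def[symmetric] algebra_simps)
    qed
    moreover have "Re (tr (kpow k \<rho> * (1\<^sub>m (M ^ k) - Q k)))
        \<le> (\<Sum>j<M. p j * (ln (s j) - (\<Sum>j<M. p j * ln (s j)))\<^sup>2) / (e\<^sup>2 * real k)"
      unfolding Q_def conj_diag_indicator(3)[OF Vk(1)]
    proof (rule kpow_measure_chebyshev[OF \<rho> V e p_def k])
      fix J assume J: "J < M ^ k" "J \<in> - FQ k" "0 < digit_prod M k p J"
      have big: "exp (real k * (b + e)) < digit_prod M k s J" using J(2) by (auto simp: FQ_def)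
      then have pos: "0 < digit_prod M k s J" by (rule less_trans[OF exp_gt_zero])
      then have "real k * (b + e) < ln (digit_prod M k s J)" using big by (metis exp_less_cancel_iff exp_ln)
      then have "real k * (b + e) < digit_sum M k (\<lambda>i. ln (s i)) J"
        using ln_digit_prod[OF s J(1) pos] by simp
      then show "real k * e \<le> \<bar>digit_sum M k (\<lambda>i. ln (s i)) J - real k * (\<Sum>j<M. p j * ln (s j))\<bar>"
        by (simp add: b_def[symmetric] algebra_simps)
    qed
    moreover note gentle_product(2)[OF psd_kpow[OF \<rho>c(2)] Pk Qk, of k]
    moreover have "C / real k = 2 * ((\<Sum>j<M. p' j * (ln (r j) - h)\<^sup>2) / (e\<^sup>2 * real k))
        + 3 * ((\<Sum>j<M. p j * (ln (s j) - b)\<^sup>2) / (e\<^sup>2 * real k))"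
      by (simp add: C_def add_divide_distrib)
    ultimately show ?thesis
      unfolding T_def h_def[symmetric] b_def[symmetric] by linarith
  qed
  moreover have "Re (tr (kpow k \<sigma> * T k)) \<le> exp (- real k * (finite_rel_entropy \<rho> \<sigma> - 2 * e))" for k
  proof -
    let ?n = "M ^ k"
    define y where "y = exp (real k * (b + e))"
    define x where "x = exp (real k * (h - e))"
    have \<sigma>kc: "kpow k \<sigma> = conj_diag ?n (kpow k V) (digit_prod M k s)" "kpow k \<sigma> \<in> carrier_mat ?n ?n"
      using \<sigma>k[of k] Vk by (auto simp: spectral_decomp_conj_diag)
    \<comment> \<open>\<open>G\<close> keeps the eigenvalues of \<open>kpow k \<sigma>\<close> that
      do not exceed the threshold \<open>y\<close>. Hence \<open>G \<le> y\<close>, and the trace of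
      \<open>G * P k\<close> is at most \<open>y\<close> times the rank of
      \<open>P k\<close>.\<close>
    define G where "G = conj_diag ?n (kpow k V) (\<lambda>J. indicator (FQ k) J * digit_prod M k s J)"
    have Gc: "G \<in> carrier_mat ?n ?n" using Vk by (simp add: G_def)
    have QsQ: "Q k * kpow k \<sigma> * Q k = G"
      unfolding Q_def \<sigma>kc conj_diag_mult[OF Vk(1)] G_def
      by (rule arg_cong[of _ _ "conj_diag _ _"]) (auto simp: indicator_def)
    have "tr (kpow k \<sigma> * T k) = tr ((kpow k \<sigma> * Q k * P k) * Q k)"
      using \<sigma>kc(2) Pk Qk by (simp add: T_def square_assoc[of _ ?n])
    also have "\<dots> = tr (Q k * (kpow k \<sigma> * Q k * P k))"
      using \<sigma>kc(2) Pk Qk by (intro tr_mult_comm[of _ ?n ?n]) auto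
    also have "Q k * (kpow k \<sigma> * Q k * P k) = G * P k"
      unfolding QsQ[symmetric] using \<sigma>kc(2) Pk Qk by (simp add: square_assoc[of _ ?n])
    finally have t1: "tr (kpow k \<sigma> * T k) = tr (G * P k)" .
    have "psd ?n (complex_of_real y \<cdot>\<^sub>m 1\<^sub>m ?n - G)"
      unfolding conj_diag_one[OF Vk(1), symmetric] conj_diag_smult[OF Vk(2)] G_def conj_diag_minus[OF Vk(2)]
      by (intro psd_conj_diag_nonneg Vk(2)) (auto simp: indicator_def y_def FQ_def)
    moreover have "psd ?n (P k)" using psd_adj_mult_self[OF Pk(1)] Pk by simp
    ultimately have "0 \<le> Re (tr ((complex_of_real y \<cdot>\<^sub>m 1\<^sub>m ?n - G) * P k))" by (rule tr_psd_mult_nonneg)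
    also have "(complex_of_real y \<cdot>\<^sub>m 1\<^sub>m ?n - G) * P k = complex_of_real y \<cdot>\<^sub>m P k - G * P k"
      using Gc Pk[of k] by (simp add: minus_mult_distrib_mat[of _ ?n ?n _ _ ?n] left_mult_one_mat[of _ ?n ?n] mult_smult_assoc_mat[of _ ?n ?n _ ?n])
    also have "tr \<dots> = complex_of_real y * tr (P k) - tr (G * P k)"
      using Gc Pk[of k] by (simp add: tr_minus[of _ ?n] tr_smult[of _ ?n])
    finally have t2: "Re (tr (G * P k)) \<le> y * Re (tr (P k))" by simp
    have "tr (P k) = tr (1\<^sub>m ?n * P k)" using Pk by (simp add: left_mult_one_mat[of _ ?n ?n] mult_smult_assoc_mat[of _ ?n ?n _ ?n])
    also have "\<dots> = (\<Sum>J<?n. complex_of_real (indicator (FP k) J))"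
      unfolding P_def using Uk[of k] by (subst tr_mult_conj_diag[of _ ?n])
        (auto simp: unitary_mat_def right_mult_one_mat[of _ ?n ?n] intro!: sum.cong simp del: index_mult_mat(1))
    finally have "Re (tr (P k)) = (\<Sum>J<?n. indicator (FP k) J)" by simp
    \<comment> \<open>Counting by Markov: every word in \<open>FP k\<close> has eigenvalue at least
      \<open>x\<close>, and all eigenvalues together sum to 1, so the rank of \<open>P k\<close> is
      at most \<open>1 / x\<close>.\<close>
    also have "\<dots> \<le> (\<Sum>J<?n. digit_prod M k r J / x)"
    proof (rule sum_mono)
      fix J assume "J \<in> {..<?n}"
      then have "0 \<le> digit_prod M k r J" using digit_prod_nonneg[of M r J k] r by simp
      then show "indicator (FP k) J \<le> digit_prod M k r J / x"
        by (auto simp: indicator_def FP_def x_def)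
    qed
    also have "\<dots> = (\<Sum>i<M. r i) ^ k / x" by (simp add: sum_divide_distrib[symmetric] digit_prod_sum)
    also have "(\<Sum>i<M. r i) = 1"
    proof -
      have "tr (1\<^sub>m M * \<rho>) = complex_of_real (\<Sum>i<M. r i)"
        unfolding \<rho>eq using U c by (subst tr_mult_conj_diag[of _ M])
          (auto simp: unitary_mat_def right_mult_one_mat[of _ M M] intro!: sum.cong simp del: index_mult_mat(1))
      then show ?thesis using \<rho> \<rho>c by (simp add: density_def left_mult_one_mat[of _ M M] del: of_real_sum)
    qed
    finally have "Re (tr (P k)) \<le> 1 / x" by simp
    then have "y * Re (tr (P k)) \<le> y * (1 / x)" by (intro mult_left_mono) (auto simp: y_def)
    also have "\<dots> = exp (- real k * (finite_rel_entropy \<rho> \<sigma> - 2 * e))"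
      unfolding y_def x_def S by (simp add: exp_diff[symmetric]) (simp add: algebra_simps)
    finally show ?thesis using t1 t2 by simp
  qed
  ultimately show ?thesis using that by blast
qed

section \<open>Symmetric tests\<close>

context compact_group_rep
begin

text \<open>The complement of an invariant test is again invariant, and twirling does not change the
  expectation of an invariant operator. The converse bound for the twirled states thereby applies to
  the original errors.\<close>

lemma beta0_twirl:
  assumes "inv_test d u T" "density d \<rho>"
  shows "beta0 d \<rho> T n = Re (tr (twirl \<mu> d u n (kpow n \<rho>) * (1\<^sub>m (d ^ n) - T n)))"
proof -
  have T: "T n \<in> carrier_mat (d ^ n) (d ^ n)" "T n * rep_pow n g = rep_pow n g * T n" for g
    using assms by (auto simp: inv_test_def)
  have c: "rep_pow n g \<in> carrier_mat (d ^ n) (d ^ n)" for g by simp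
  have "(1\<^sub>m (d ^ n) - T n) * rep_pow n g = rep_pow n g * (1\<^sub>m (d ^ n) - T n)" for g
    using T c[of g] by (simp add: minus_mult_distrib_mat[of _ "d ^ n" "d ^ n" _ _ "d ^ n"]
        mult_minus_distrib_mat[of _ "d ^ n" "d ^ n" _ "d ^ n"] left_mult_one_mat[of _ "d ^ n" "d ^ n"]
        right_mult_one_mat[of _ "d ^ n" "d ^ n"])
  then show ?thesis
    using assms T by (subst tr_twirl) (auto simp: beta0_def density_def psd_def minus_carrier_mat[of _ "d ^ n" "d ^ n"])
qed

lemma beta1_twirl:
  assumes "inv_test d u T" "density d \<rho>"
  shows "beta1 \<rho> T n = Re (tr (twirl \<mu> d u n (kpow n \<rho>) * T n))"
  using assms by (subst tr_twirl) (auto simp: beta1_def density_def psd_def inv_test_def)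

text \<open>The \<open>q\<close> copies left over by the division into blocks meet the identity and
  contribute \<open>tr Y ^ q = 1\<close>. On the blocks, commutation at each site allows every block
  state to be replaced by its twirl.\<close>

lemma tr_kpow_block:
  assumes Y: "density d Y" and Z: "Z \<in> carrier_mat ((d ^ m) ^ k) ((d ^ m) ^ k)"
    and comm: "\<And>i g. i < k \<Longrightarrow> site (d ^ m) k i (rep_pow m g) * Z = Z * site (d ^ m) k i (rep_pow m g)"
  shows "tr (kpow (m * k + q) Y * kron Z (1\<^sub>m (d ^ q))) = tr (kpow k (twirl \<mu> d u m (kpow m Y)) * Z)"
proof -
  have Yc: "Y \<in> carrier_mat d d" "tr Y = 1" using Y by (auto simp: density_def psd_def)
  have c: "kpow m Y \<in> carrier_mat (d ^ m) (d ^ m)" "kpow q Y \<in> carrier_mat (d ^ q) (d ^ q)"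
    "kpow k (kpow m Y) \<in> carrier_mat ((d ^ m) ^ k) ((d ^ m) ^ k)"
    using Yc kpow_carrier[of "kpow m Y" "d ^ m" k] by auto
  have "kpow (m * k + q) Y * kron Z (1\<^sub>m (d ^ q)) = kron (kpow k (kpow m Y) * Z) (kpow q Y)"
    using c Z by (simp add: kpow_add kpow_kpow[symmetric] right_mult_one_mat[OF c(2)]
        kron_mult[of _ "(d ^ m) ^ k" "(d ^ m) ^ k" _ "d ^ q" "d ^ q" _ "(d ^ m) ^ k" _ "d ^ q"])
  then have "tr (kpow (m * k + q) Y * kron Z (1\<^sub>m (d ^ q))) = tr (kpow k (kpow m Y) * Z)"
    using c Z Yc by (simp add: tr_kron[of _ "(d ^ m) ^ k" _ "d ^ q"] tr_kpow[of _ d])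
  also have "\<dots> = tr (kpow k (twirl \<mu> d u m (kpow m Y)) * Z)"
    using tr_kpow_twirl[OF c(1), of "1\<^sub>m (Suc 0)" "Suc 0" Z k] comm Z by simp
  finally show ?thesis .
qed

end

text \<open>Two-sided bounds fix the rate: the factor \<open>K\<close> adds only
  \<open>ln K / n\<close>, which tends to 0. The lower bound also keeps the error positive, so that
  \<open>elog\<close> is never minus infinity.\<close>

lemma tendsto_rate:
  assumes "\<And>n. exp (- real n * r) \<le> beta1 \<rho> T n" "\<And>n. beta1 \<rho> T n \<le> K * exp (- real n * r)"
  shows "rate \<rho> T \<longlonglongrightarrow> ereal (- r)"
proof -
  have pos: "0 < beta1 \<rho> T n" for n using assms(1)[of n] by (rule less_le_trans[OF exp_gt_zero])
  have K: "0 < K" using less_le_trans[OF pos[of 0] assms(2)[of 0]] by simp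
  \<comment> \<open>This includes \<open>n = 0\<close>, where both sides are 0 by the convention for
    division by zero.\<close>
  have eq: "rate \<rho> T n = ereal (ln (beta1 \<rho> T n) / real n)" for n
    using pos[of n] by (simp add: rate_def elog_def)
  have lo: "- r \<le> ln (beta1 \<rho> T n) / real n" if "n \<ge> 1" for n
  proof -
    have "- real n * r \<le> ln (beta1 \<rho> T n)" using assms(1)[of n] pos[of n] by (metis exp_le_cancel_iff exp_ln)
    then show ?thesis using that by (simp add: pos_le_divide_eq mult.commute)
  qed
  have hi: "ln (beta1 \<rho> T n) / real n \<le> ln K / real n - r" if "n \<ge> 1" for n
  proof -
    have "ln (beta1 \<rho> T n) \<le> ln (K * exp (- real n * r))" using assms(2)[of n] pos[of n] by (rule ln_mono)
    then have "ln (beta1 \<rho> T n) \<le> ln K - real n * r" using K by (simp add: ln_mult)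
    then show ?thesis using that by (simp add: field_simps)
  qed
  have "(\<lambda>n. ln K / real n - r) \<longlonglongrightarrow> 0 - r"
    by (intro tendsto_diff tendsto_const lim_const_over_n)
  then have "(\<lambda>n. ln K / real n - r) \<longlonglongrightarrow> - r" by simp
  then have "(\<lambda>n. ln (beta1 \<rho> T n) / real n) \<longlonglongrightarrow> - r"
    by (rule tendsto_sandwich[rotated 2, OF tendsto_const])
      (auto intro!: eventually_sequentiallyI[of 1] lo hi)
  then show ?thesis unfolding eq by simp
qed

section \<open>Errors and entropy rates of the twirled states\<close>

locale twirled_states = compact_group_rep d u \<mu>
  for d :: nat and u :: "'g::{group_add,topological_space} \<Rightarrow> complex mat" and \<mu> :: "'g measure" +
  fixes \<rho>0 \<rho>1 :: "complex mat"
  assumes dens0: "density d \<rho>0" and dens1: "density d \<rho>1"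
    and supp_le: "\<And>n. loewner_le (d ^ n) (supp (twirl \<mu> d u n (kpow n \<rho>0))) (supp (twirl \<mu> d u n (kpow n \<rho>1)))"
begin

abbreviation "\<omega>0 n \<equiv> twirl \<mu> d u n (kpow n \<rho>0)"
abbreviation "\<omega>1 n \<equiv> twirl \<mu> d u n (kpow n \<rho>1)"

definition "entropy_rate n = finite_rel_entropy (\<omega>0 n) (\<omega>1 n) / real n"

lemma entropy_rate_nonneg: "0 \<le> entropy_rate n"
  unfolding entropy_rate_def
  using stein_converse(1)[OF density_twirl[OF dens0] density_twirl[OF dens1] supp_le] by simp

text \<open>The condition on \<open>entropy_rate n\<close> sits inside the eventual statement, so
  the bound can be used along the indices where the rate is small, before any convergence is
  known.\<close>

lemma test_lower_bound:
  assumes T: "inv_test d u T" and b0: "beta0 d \<rho>0 T \<longlonglongrightarrow> 0" and a: "0 \<le> a" and e: "0 < e"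
  obtains c where "0 < c" "\<forall>\<^sub>F n in sequentially. entropy_rate n \<le> a \<longrightarrow> c * exp (- real n * (a + e)) \<le> beta1 \<rho>1 T n"
proof -
  \<comment> \<open>Chosen so that \<open>\<delta> * ln lam = n * e / 2\<close>. Of the surplus
    \<open>n * e\<close> in \<open>ln lam\<close>, one half absorbs the \<open>+ 1\<close> of the
    converse once \<open>n \<ge> 2 / e\<close>, and the other half leaves the slack
    \<open>\<delta>\<close>. Of the resulting bound \<open>\<delta> / 2\<close> the first error uses
    up at most \<open>\<delta> / 4\<close>.\<close>
  define \<delta> where "\<delta> = (e / 2) / (a + e)"
  have \<delta>: "0 < \<delta>" using a e by (simp add: \<delta>_def)
  have "\<forall>\<^sub>F n in sequentially. beta0 d \<rho>0 T n < \<delta> / 4"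
    using b0 \<delta> by (intro order_tendstoD(2)[of _ 0]) auto
  moreover have "\<forall>\<^sub>F n in sequentially. max 1 (2 / e) \<le> real n"
    using filterlim_real_sequentially unfolding filterlim_at_top by blast
  ultimately have "\<forall>\<^sub>F n in sequentially. entropy_rate n \<le> a \<longrightarrow> \<delta> / 4 * exp (- real n * (a + e)) \<le> beta1 \<rho>1 T n"
  proof eventually_elim
    case (elim n)
    show ?case
    proof
      assume le: "entropy_rate n \<le> a"
      have n: "0 < real n" "2 / e \<le> real n" using elim(2) by auto
      define lam where "lam = exp (real n * (a + e))"
      have lam: "1 < lam" "ln lam = real n * (a + e)" using n a e by (auto simp: lam_def)
      define S where "S = finite_rel_entropy (\<omega>0 n) (\<omega>1 n)"
      have "S \<le> real n * a" using le n by (simp add: entropy_rate_def S_def pos_divide_le_eq mult.commute)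
      moreover have "1 \<le> real n * e / 2" using n e by (simp add: field_simps)
      moreover have "\<delta> * ln lam = real n * e / 2" using a e by (simp add: lam \<delta>_def field_simps)
      ultimately have "S + 1 \<le> (1 - \<delta>) * ln lam"
        using lam(2) by (simp add: algebra_simps)
      then have "(S + 1) / ln lam \<le> 1 - \<delta>" using lam n a e by (subst pos_divide_le_eq) auto
      then have "\<delta> / 2 \<le> (1 - (S + 1) / ln lam) / 2" by simp
      also have "\<dots> \<le> Re (tr (\<omega>0 n * (1\<^sub>m (d ^ n) - T n))) + lam * Re (tr (\<omega>1 n * T n))"
        unfolding S_def using T
        by (intro stein_converse(2)[OF density_twirl[OF dens0] density_twirl[OF dens1] supp_le] lam(1))
           (auto simp: inv_test_def)
      also have "\<dots> = beta0 d \<rho>0 T n + lam * beta1 \<rho>1 T n"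
        by (simp add: beta0_twirl[OF T dens0] beta1_twirl[OF T dens1])
      finally have "\<delta> / 4 \<le> lam * beta1 \<rho>1 T n" using elim(1) by linarith
      then have "\<delta> / 4 * exp (- real n * (a + e)) \<le> lam * beta1 \<rho>1 T n * exp (- real n * (a + e))"
        by (rule mult_right_mono) simp
      also have "\<dots> = beta1 \<rho>1 T n * exp (real n * (a + e) + - real n * (a + e))"
        unfolding lam_def exp_add by simp
      finally show "\<delta> / 4 * exp (- real n * (a + e)) \<le> beta1 \<rho>1 T n" by simp
    qed
  qed
  then show ?thesis using that[of "\<delta> / 4"] \<delta> by simp
qed

text \<open>Covers the case of entropy rate 0, where \<open>block_test\<close> admits no exponent:
  the second error 1 is \<open>exp (- n * 0)\<close>.\<close>

lemma trivial_test:
  "inv_test d u (\<lambda>n. 1\<^sub>m (d ^ n))" "beta0 d \<rho>0 (\<lambda>n. 1\<^sub>m (d ^ n)) \<longlonglongrightarrow> 0" "beta1 \<rho>1 (\<lambda>n. 1\<^sub>m (d ^ n)) n = 1"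
proof -
  have c: "\<rho>0 \<in> carrier_mat d d" "\<rho>1 \<in> carrier_mat d d" "tr \<rho>1 = 1"
    using dens0 dens1 by (auto simp: density_def psd_def)
  have z: "1\<^sub>m (d ^ n) - 1\<^sub>m (d ^ n) = adj (0\<^sub>m (d ^ n) (d ^ n)) * 0\<^sub>m (d ^ n) (d ^ n)" for n
    by (simp add: right_mult_zero_mat[of _ "d ^ n" "d ^ n"])
  have "psd (d ^ n) (1\<^sub>m (d ^ n))" for n using psd_adj_mult_self[of "1\<^sub>m (d ^ n)" "d ^ n" "d ^ n"] by simp
  moreover have "psd (d ^ n) (1\<^sub>m (d ^ n) - 1\<^sub>m (d ^ n))" for n
    unfolding z by (rule psd_adj_mult_self[of _ "d ^ n"]) simp
  ultimately show "inv_test d u (\<lambda>n. 1\<^sub>m (d ^ n))"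
    by (auto simp: inv_test_def loewner_le_def left_mult_one_mat[OF rep_pow_carrier] right_mult_one_mat[OF rep_pow_carrier])
  have "kpow n \<rho>0 * (1\<^sub>m (d ^ n) - 1\<^sub>m (d ^ n)) = 0\<^sub>m (d ^ n) (d ^ n)" for n
  proof -
    have "(1\<^sub>m (d ^ n) - 1\<^sub>m (d ^ n) :: complex mat) = 0\<^sub>m (d ^ n) (d ^ n)" by (intro eq_matI) auto
    then show ?thesis using right_mult_zero_mat[OF kpow_carrier[OF c(1), of n], of "d ^ n"] by (simp only:)
  qed
  then have "beta0 d \<rho>0 (\<lambda>n. 1\<^sub>m (d ^ n)) n = 0" for n by (simp add: beta0_def tr_def)
  then have "beta0 d \<rho>0 (\<lambda>n. 1\<^sub>m (d ^ n)) = (\<lambda>n. 0)" by (rule ext)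
  then show "beta0 d \<rho>0 (\<lambda>n. 1\<^sub>m (d ^ n)) \<longlonglongrightarrow> 0" by simp
  show "beta1 \<rho>1 (\<lambda>n. 1\<^sub>m (d ^ n)) n = 1"
    using c kpow_carrier[OF c(2), of n]
    by (simp add: beta1_def right_mult_one_mat[of _ "d ^ n" "d ^ n"] tr_kpow[of _ d])
qed

text \<open>\<open>n\<close> copies are read as \<open>n div m\<close> blocks and a remainder that
  the block part of the test ignores. Commutation enters in two forms: with the simultaneous action
  of the group, for admissibility, and at each block separately, for the passage between twirled and
  untwirled errors.\<close>

lemma block_test:
  assumes m: "0 < m" and r: "0 \<le> r" "r < entropy_rate m"
  obtains T K where "inv_test d u T" "beta0 d \<rho>0 T \<longlonglongrightarrow> 0"
    "\<forall>n. exp (- real n * r) \<le> beta1 \<rho>1 T n \<and> beta1 \<rho>1 T n \<le> K * exp (- real n * r)"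
proof -
  \<comment> \<open>The solution of \<open>m * entropy_rate m - 2 * e = m * r\<close>, so that the
    exponent gained per block is exactly \<open>m * r\<close>.\<close>
  define e where "e = real m * (entropy_rate m - r) / 2"
  have e: "0 < e" using m r by (simp add: e_def)
  have Se: "finite_rel_entropy (\<omega>0 m) (\<omega>1 m) - 2 * e = real m * r"
    using m by (simp add: e_def entropy_rate_def field_simps)
  obtain C T0 where T0: "\<And>k. psd ((d ^ m) ^ k) (T0 k)" "\<And>k. psd ((d ^ m) ^ k) (1\<^sub>m ((d ^ m) ^ k) - T0 k)"
    and comm: "\<And>k X. X \<in> carrier_mat ((d ^ m) ^ k) ((d ^ m) ^ k) \<Longrightarrow> X * kpow k (\<omega>0 m) = kpow k (\<omega>0 m) * X \<Longrightarrow>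
        X * kpow k (\<omega>1 m) = kpow k (\<omega>1 m) * X \<Longrightarrow> X * T0 k = T0 k * X"
    and err0: "\<And>k. 0 < k \<Longrightarrow> Re (tr (kpow k (\<omega>0 m) * (1\<^sub>m ((d ^ m) ^ k) - T0 k))) \<le> C / real k"
    and err1: "\<And>k. Re (tr (kpow k (\<omega>1 m) * T0 k)) \<le> exp (- real k * (real m * r))"
    using stein_direct[OF density_twirl[OF dens0, of m] density_twirl[OF dens1, of m] e] unfolding Se by metis
  have c: "\<rho>0 \<in> carrier_mat d d" "\<rho>1 \<in> carrier_mat d d" "tr \<rho>1 = 1"
    using dens0 dens1 by (auto simp: density_def psd_def)
  have T0c: "T0 k \<in> carrier_mat ((d ^ m) ^ k) ((d ^ m) ^ k)" for k using T0(1) by (simp add: psd_def)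
  define k where "k n = n div m" for n
  define q where "q n = n mod m" for n
  have n: "m * k n + q n = n" for n by (simp add: k_def q_def)
  have dn: "(d ^ m) ^ k n * d ^ q n = d ^ n" for n
    using n[of n] by (metis power_add power_mult)
  have comm0: "rep_pow m g * \<omega>0 m = \<omega>0 m * rep_pow m g" "rep_pow m g * \<omega>1 m = \<omega>1 m * rep_pow m g" for g
    using twirl_commute[of "kpow m \<rho>0" m g] twirl_commute[of "kpow m \<rho>1" m g] c by auto
  have site_comm: "site (d ^ m) k i (rep_pow m g) * T0 k = T0 k * site (d ^ m) k i (rep_pow m g)" if "i < k" for i k g
    using that comm0 by (intro comm site_carrier site_commute_kpow) auto
  define \<tau> where "\<tau> n = kron (T0 (k n)) (1\<^sub>m (d ^ q n))" for n
  have \<tau>c: "\<tau> n \<in> carrier_mat (d ^ n) (d ^ n)" for n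
    using kron_carrier[OF T0c[of "k n"], of "1\<^sub>m (d ^ q n)" "d ^ q n" "d ^ q n"] by (simp add: \<tau>_def dn)
  have \<tau>': "1\<^sub>m (d ^ n) - \<tau> n = kron (1\<^sub>m ((d ^ m) ^ k n) - T0 (k n)) (1\<^sub>m (d ^ q n))" for n
    unfolding \<tau>_def kron_minus_left[OF one_carrier_mat T0c] kron_one_one dn ..
  have \<tau>psd: "psd (d ^ n) (\<tau> n)" "psd (d ^ n) (1\<^sub>m (d ^ n) - \<tau> n)" for n
    using psd_kron_one[OF T0(1), of "k n" "d ^ q n"] psd_kron_one[OF T0(2), of "k n" "d ^ q n"]
    unfolding \<tau>' by (simp_all add: \<tau>_def dn)
  have \<tau>comm: "\<tau> n * rep_pow n g = rep_pow n g * \<tau> n" for n g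
  proof -
    have Vc: "kpow (k n) (rep_pow m g) \<in> carrier_mat ((d ^ m) ^ k n) ((d ^ m) ^ k n)"
      "rep_pow (q n) g \<in> carrier_mat (d ^ q n) (d ^ q n)"
      using kpow_carrier[of "rep_pow m g" "d ^ m" "k n"] by auto
    have "rep_pow n g = rep_pow (m * k n + q n) g" by (simp only: n)
    then have V: "rep_pow n g = kron (kpow (k n) (rep_pow m g)) (rep_pow (q n) g)"
      by (simp only: kpow_add kpow_kpow)
    have "kpow (k n) (rep_pow m g) * T0 (k n) = T0 (k n) * kpow (k n) (rep_pow m g)"
      using comm0[of g] by (intro comm Vc) (simp_all add: kpow_mult[of _ "d ^ m", symmetric])
    then show ?thesis
      unfolding V \<tau>_def using T0c[of "k n"] Vc
      by (simp add: kron_mult[of _ "(d ^ m) ^ k n" "(d ^ m) ^ k n" _ "d ^ q n" "d ^ q n" _ "(d ^ m) ^ k n" _ "d ^ q n"]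
          left_mult_one_mat[OF Vc(2)] right_mult_one_mat[OF Vc(2)])
  qed
  have tr\<tau>: "tr (kpow n Y * \<tau> n) = tr (kpow (k n) (twirl \<mu> d u m (kpow m Y)) * T0 (k n))" if "density d Y" for n Y
    using tr_kpow_block[OF that T0c site_comm, of "k n" "q n"] by (simp only: n \<tau>_def)
  have tr\<tau>': "tr (kpow n Y * (1\<^sub>m (d ^ n) - \<tau> n))
      = tr (kpow (k n) (twirl \<mu> d u m (kpow m Y)) * (1\<^sub>m ((d ^ m) ^ k n) - T0 (k n)))" if "density d Y" for n Y
  proof -
    have "site (d ^ m) k i (rep_pow m g) * (1\<^sub>m ((d ^ m) ^ k) - T0 k) = (1\<^sub>m ((d ^ m) ^ k) - T0 k) * site (d ^ m) k i (rep_pow m g)"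
      if "i < k" for i k g
    proof -
      have s: "site (d ^ m) k i (rep_pow m g) \<in> carrier_mat ((d ^ m) ^ k) ((d ^ m) ^ k)"
        using that by (intro site_carrier) auto
      show ?thesis
        using s T0c[of k] site_comm[OF that, of g]
        by (simp add: mult_minus_distrib_mat[OF s one_carrier_mat T0c] minus_mult_distrib_mat[OF one_carrier_mat T0c s]
            left_mult_one_mat[OF s] right_mult_one_mat[OF s])
    qed
    from tr_kpow_block[OF that _ this, of "k n" "q n"] show ?thesis
      unfolding \<tau>' using T0c[of "k n"] by (simp only: n minus_carrier_mat)
  qed
  \<comment> \<open>Weight of the identity in the mixture, a probability because
    \<open>r \<ge> 0\<close>. It forces the second error up to at least \<open>x n\<close>, while
    the first error only shrinks, by the factor \<open>1 - x n\<close>.\<close>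
  define x where "x n = exp (- real n * r)" for n
  have x: "0 < x n" "x n \<le> 1" for n using r by (auto simp: x_def)
  define T where "T n = complex_of_real (x n) \<cdot>\<^sub>m 1\<^sub>m (d ^ n) + complex_of_real (1 - x n) \<cdot>\<^sub>m \<tau> n" for n
  have Tc: "T n \<in> carrier_mat (d ^ n) (d ^ n)" for n using \<tau>c[of n] by (simp add: T_def)
  have T1: "1\<^sub>m (d ^ n) - T n = complex_of_real (1 - x n) \<cdot>\<^sub>m (1\<^sub>m (d ^ n) - \<tau> n)" for n
    using \<tau>c[of n] unfolding T_def by (intro eq_matI) (auto simp: algebra_simps)
  have one: "psd (d ^ n) (1\<^sub>m (d ^ n))" for n using psd_adj_mult_self[of "1\<^sub>m (d ^ n)" "d ^ n" "d ^ n"] by simp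
  have inv: "inv_test d u T"
    unfolding inv_test_def loewner_le_def
  proof (intro allI conjI)
    fix n g
    show "T n * rep_pow n g = rep_pow n g * T n"
      unfolding T_def using \<tau>c[of n] \<tau>comm[of n g] rep_pow_carrier[of n g]
      by (simp add: add_mult_distrib_mat[of _ "d ^ n" "d ^ n" _ _ "d ^ n"] mult_add_distrib_mat[of _ "d ^ n" "d ^ n" _ "d ^ n"]
          mult_smult_assoc_mat[of _ "d ^ n" "d ^ n" _ "d ^ n"] mult_smult_distrib[of _ "d ^ n" "d ^ n" _ "d ^ n"]
          left_mult_one_mat[OF rep_pow_carrier] right_mult_one_mat[OF rep_pow_carrier])
    show "psd (d ^ n) (T n)" unfolding T_def using x[of n] by (intro psd_add psd_smult one \<tau>psd) auto
    show "psd (d ^ n) (1\<^sub>m (d ^ n) - T n)" unfolding T1 using x[of n] by (intro psd_smult \<tau>psd) auto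
  qed (use Tc in auto)
  have psdk: "psd (d ^ n) (kpow n \<rho>0)" "psd (d ^ n) (kpow n \<rho>1)" for n
    using dens0 dens1 by (auto simp: density_def intro: psd_kpow)
  define t0 where "t0 n = Re (tr (kpow n \<rho>0 * (1\<^sub>m (d ^ n) - \<tau> n)))" for n
  have t0: "0 \<le> t0 n" for n unfolding t0_def by (intro tr_psd_mult_nonneg[of "d ^ n"] psdk \<tau>psd)
  have b0: "beta0 d \<rho>0 T n = (1 - x n) * t0 n" for n
  proof -
    have "kpow n \<rho>0 * (1\<^sub>m (d ^ n) - T n) = complex_of_real (1 - x n) \<cdot>\<^sub>m (kpow n \<rho>0 * (1\<^sub>m (d ^ n) - \<tau> n))"
      unfolding T1 using c \<tau>c[of n] kpow_carrier[OF c(1), of n]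
      by (simp add: mult_smult_distrib[of _ "d ^ n" "d ^ n" _ "d ^ n"] minus_carrier_mat[of _ "d ^ n" "d ^ n"])
    moreover have "kpow n \<rho>0 * (1\<^sub>m (d ^ n) - \<tau> n) \<in> carrier_mat (d ^ n) (d ^ n)"
      using c \<tau>c[of n] by (simp add: minus_carrier_mat[of _ "d ^ n" "d ^ n"])
    ultimately show ?thesis by (simp add: beta0_def t0_def tr_smult)
  qed
  have "beta0 d \<rho>0 T \<longlonglongrightarrow> 0"
  proof (rule tendsto_sandwich[OF _ _ tendsto_const])
    show "\<forall>\<^sub>F n in sequentially. 0 \<le> beta0 d \<rho>0 T n" using t0 x by (simp add: b0)
    show "\<forall>\<^sub>F n in sequentially. beta0 d \<rho>0 T n \<le> C / real (k n)"
    proof (rule eventually_sequentiallyI[of m])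
      fix n assume "m \<le> n"
      then have "0 < k n" using m by (simp add: k_def div_greater_zero_iff)
      then have "t0 n \<le> C / real (k n)" using err0 by (simp add: t0_def tr\<tau>'[OF dens0])
      moreover have "beta0 d \<rho>0 T n \<le> t0 n" using t0[of n] x[of n] by (simp add: b0 mult_left_le_one_le)
      ultimately show "beta0 d \<rho>0 T n \<le> C / real (k n)" by simp
    qed
    have "filterlim k at_top sequentially"
      unfolding filterlim_at_top
    proof
      fix N
      show "\<forall>\<^sub>F n in sequentially. N \<le> k n"
      proof (rule eventually_sequentiallyI[of "N * m"])
        fix n assume "N * m \<le> n"
        then show "N \<le> k n" using m by (simp add: k_def less_eq_div_iff_mult_less_eq)
      qed
    qed
    then show "(\<lambda>n. C / real (k n)) \<longlonglongrightarrow> 0"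
      by (rule filterlim_compose[OF lim_const_over_n])
  qed
  define t1 where "t1 n = Re (tr (kpow n \<rho>1 * \<tau> n))" for n
  have t1: "0 \<le> t1 n" for n unfolding t1_def by (intro tr_psd_mult_nonneg[of "d ^ n"] psdk \<tau>psd)
  have t1': "t1 n \<le> exp (real m * r) * x n" for n
  proof -
    have "t1 n \<le> exp (- real (k n) * (real m * r))" unfolding t1_def tr\<tau>[OF dens1] by (rule err1)
    \<comment> \<open>The remainder is shorter than \<open>m\<close>, so ignoring it costs at most
      the factor \<open>exp (m * r)\<close>, which ends up in the constant \<open>K\<close>.\<close>
    also have "\<dots> \<le> exp (real m * r - real n * r)"
    proof -
      have "real n \<le> real m * real (k n) + real m"
      proof -
        have "q n \<le> m" using m by (simp add: q_def)
        then have "n \<le> m * k n + m" using n[of n] by linarith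
        then show ?thesis by (metis of_nat_add of_nat_le_iff of_nat_mult)
      qed
      then have "real n * r \<le> (real m * real (k n) + real m) * r" using r by (intro mult_right_mono) auto
      then show ?thesis by (simp add: algebra_simps)
    qed
    finally show ?thesis by (simp add: x_def exp_add[symmetric])
  qed
  have b1: "beta1 \<rho>1 T n = x n + (1 - x n) * t1 n" for n
  proof -
    have kc: "kpow n \<rho>1 \<in> carrier_mat (d ^ n) (d ^ n)" using c by simp
    have "kpow n \<rho>1 * T n = complex_of_real (x n) \<cdot>\<^sub>m kpow n \<rho>1 + complex_of_real (1 - x n) \<cdot>\<^sub>m (kpow n \<rho>1 * \<tau> n)"
      unfolding T_def using kc \<tau>c[of n]
      by (simp add: mult_add_distrib_mat[of _ "d ^ n" "d ^ n" _ "d ^ n"] mult_smult_distrib[of _ "d ^ n" "d ^ n" _ "d ^ n"]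
          right_mult_one_mat[of _ "d ^ n" "d ^ n"])
    then show ?thesis
      using kc \<tau>c[of n] c by (simp add: beta1_def t1_def tr_add[of _ "d ^ n"] tr_smult[of _ "d ^ n"] tr_kpow[of _ d])
  qed
  have "x n \<le> beta1 \<rho>1 T n" for n using t1[of n] x[of n] by (simp add: b1)
  moreover have "beta1 \<rho>1 T n \<le> (1 + exp (real m * r)) * x n" for n
  proof -
    have "(1 - x n) * t1 n \<le> t1 n" using t1[of n] x[of n] by (simp add: mult_left_le_one_le)
    then show ?thesis using t1'[of n] by (simp add: b1 algebra_simps)
  qed
  ultimately show ?thesis
    using that[OF inv \<open>beta0 d \<rho>0 T \<longlonglongrightarrow> 0\<close>, of "1 + exp (real m * r)"] by (simp add: x_def)
qed

text \<open>The block test of fixed size \<open>m\<close> has second error at most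
  \<open>K * exp (- n * r)\<close> for all \<open>n\<close>, while at infinitely many
  \<open>n\<close> the converse keeps it above \<open>c * exp (- n * (a + e'))\<close>. The
  entropies at different \<open>n\<close> are thus compared through the errors of a single
  test.\<close>

lemma entropy_rate_frequently_le:
  assumes m: "0 < m" and r: "0 \<le> r" "r < entropy_rate m" and a: "0 \<le> a"
    and freq: "\<exists>\<^sub>F n in sequentially. entropy_rate n \<le> a"
  shows "r \<le> a"
proof (rule field_le_epsilon)
  fix e :: real assume "0 < e"
  \<comment> \<open>One half of \<open>e\<close> is spent in the converse; the other half is the gap
    that lets \<open>exp (n * e')\<close> outgrow the constant \<open>|K| / c\<close>.\<close>
  define e' where "e' = e / 2"
  have e': "0 < e'" using \<open>0 < e\<close> by (simp add: e'_def)
  obtain T K where T: "inv_test d u T" "beta0 d \<rho>0 T \<longlonglongrightarrow> 0"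
    and "\<forall>n. exp (- real n * r) \<le> beta1 \<rho>1 T n \<and> beta1 \<rho>1 T n \<le> K * exp (- real n * r)"
    by (rule block_test[OF m r])
  then have up: "beta1 \<rho>1 T n \<le> K * exp (- real n * r)" for n by simp
  obtain c where c: "0 < c" 
    and lo: "\<forall>\<^sub>F n in sequentially. entropy_rate n \<le> a \<longrightarrow> c * exp (- real n * (a + e')) \<le> beta1 \<rho>1 T n"
    by (rule test_lower_bound[OF T a e'])
  show "r \<le> a + e"
  proof (rule ccontr)
    assume "\<not> r \<le> a + e"
    then have gap: "e' < r - (a + e')" by (simp add: e'_def)
    have "\<forall>\<^sub>F n in sequentially. \<bar>K\<bar> / c / e' < real n"
      using filterlim_real_sequentially unfolding filterlim_at_top_dense by blast
    then have "\<forall>\<^sub>F n in sequentially. \<bar>K\<bar> / c < exp (real n * e')"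
    proof eventually_elim
      case (elim n)
      then have "\<bar>K\<bar> / c < real n * e'" using e' by (simp only: pos_divide_less_eq)
      then show ?case using exp_ge_add_one_self[of "real n * e'"] by linarith
    qed
    then have "\<exists>\<^sub>F n in sequentially. entropy_rate n \<le> a \<and>
        (entropy_rate n \<le> a \<longrightarrow> c * exp (- real n * (a + e')) \<le> beta1 \<rho>1 T n) \<and> \<bar>K\<bar> / c < exp (real n * e')"
      by (intro frequently_eventually_frequently[OF freq eventually_conj[OF lo]])
    then have "\<exists>n. entropy_rate n \<le> a \<and>
        (entropy_rate n \<le> a \<longrightarrow> c * exp (- real n * (a + e')) \<le> beta1 \<rho>1 T n) \<and> \<bar>K\<bar> / c < exp (real n * e')"
      by (rule frequently_ex)
    then obtain n where n: "c * exp (- real n * (a + e')) \<le> beta1 \<rho>1 T n" "\<bar>K\<bar> / c < exp (real n * e')"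
      by blast
    have "c * exp (- real n * (a + e')) \<le> K * exp (- real n * r)" using n(1) up[of n] by linarith
    then have "c * exp (- real n * (a + e')) * exp (real n * r) \<le> K * exp (- real n * r) * exp (real n * r)"
      by (intro mult_right_mono) auto
    then have "c * exp (real n * (r - (a + e'))) \<le> K"
      by (simp add: mult.assoc exp_add[symmetric] algebra_simps)
    moreover have "exp (real n * e') \<le> exp (real n * (r - (a + e')))"
      using gap by (simp add: mult_left_mono)
    moreover have "\<bar>K\<bar> < c * exp (real n * e')" using n(2) c by (simp add: pos_divide_less_eq mult.commute)
    ultimately show False using c mult_left_mono[of "exp (real n * e')" "exp (real n * (r - (a + e')))" c] by linarith
  qed
qed

section \<open>Convergence of the rates and the three error exponents\<close>

definition "max_rate = (SUP m\<in>{0<..}. ereal (entropy_rate m))"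

lemma entropy_rate_le_max: "0 < n \<Longrightarrow> ereal (entropy_rate n) \<le> max_rate"
  unfolding max_rate_def by (rule SUP_upper) simp

text \<open>The upper half is immediate for a supremum. For the lower half, suppose the rates were
  at most \<open>a\<close> infinitely often, with \<open>a\<close> below the rate at some
  \<open>m\<close>: an exponent \<open>r\<close> strictly between the two would violate
  \<open>entropy_rate_frequently_le\<close>.\<close>

lemma entropy_rate_tendsto: "(\<lambda>n. ereal (entropy_rate n)) \<longlonglongrightarrow> max_rate"
proof (rule order_tendstoI)
  fix y assume "max_rate < y"
  then have "ereal (entropy_rate n) < y" if "0 < n" for n
    using entropy_rate_le_max[OF that] by (rule le_less_trans[rotated])
  then show "\<forall>\<^sub>F n in sequentially. ereal (entropy_rate n) < y"
    by (intro eventually_sequentiallyI[of 1]) simp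
next
  fix y assume "y < max_rate"
  then have "\<exists>m\<in>{0<..}. y < ereal (entropy_rate m)" unfolding max_rate_def less_SUP_iff .
  then obtain m where m: "0 < m" "y < ereal (entropy_rate m)" by blast
  show "\<forall>\<^sub>F n in sequentially. y < ereal (entropy_rate n)"
  proof (cases "y < 0")
    case True
    have "y < ereal (entropy_rate n)" for n
      using entropy_rate_nonneg[of n] by (intro order.strict_trans2[OF True]) simp
    then show ?thesis by simp
  next
    case False
    then obtain a where a: "y = ereal a" "0 \<le> a" using m(2) by (cases y) auto
    then have "a < entropy_rate m" using m by simp
    then obtain r where r: "a < r" "r < entropy_rate m" using dense by blast
    show ?thesis
    proof (rule ccontr)
      assume "\<not> ?thesis"
      then have "\<exists>\<^sub>F n in sequentially. entropy_rate n \<le> a" by (simp add: frequently_def a(1) not_le)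
      then have "r \<le> a" using entropy_rate_frequently_le[OF m(1) _ r(2) a(2)] a r by simp
      then show False using r by simp
    qed
  qed
qed

text \<open>The hypothesis on supports selects the finite branch of \<open>rel_entropy\<close> for
  every \<open>n\<close>, and the convergence just shown gives \<open>lim\<close> its value.\<close>

lemma S_M_eq: "S_M \<mu> d u \<rho>0 \<rho>1 = max_rate"
proof -
  have "ereal (1 / real n) * rel_entropy (\<omega>0 n) (\<omega>1 n) = ereal (entropy_rate n)" for n
    using supp_le[of n] carrier_matD(1)[OF twirl_carrier[of n "kpow n \<rho>0"]]
    by (simp add: rel_entropy_def entropy_rate_def finite_rel_entropy_def)
  then show ?thesis
    unfolding S_M_def using entropy_rate_tendsto by (simp add: limI)
qed

text \<open>Phrased as a lower bound on \<open>- s_lim\<close>, so that the attainable exponents can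
  be collected under the supremum \<open>max_rate\<close>.\<close>

lemma s_lim_le:
  assumes "inv_test d u T" "beta0 d \<rho>0 T \<longlonglongrightarrow> 0"
    "\<And>n. exp (- real n * r) \<le> beta1 \<rho>1 T n" "\<And>n. beta1 \<rho>1 T n \<le> K * exp (- real n * r)"
  shows "ereal r \<le> - s_lim d u \<rho>0 \<rho>1"
proof -
  have "s_lim d u \<rho>0 \<rho>1 \<le> ereal (- r)"
    unfolding s_lim_def using assms(1,2) tendsto_rate[OF assms(3,4)] by (intro Inf_lower) blast
  then have "- ereal (- r) \<le> - s_lim d u \<rho>0 \<rho>1" by (simp only: ereal_minus_le_minus)
  then show ?thesis by simp
qed

lemma s_lim_upper: "s_lim d u \<rho>0 \<rho>1 \<le> - max_rate"
proof -
  have "max_rate \<le> - s_lim d u \<rho>0 \<rho>1"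
    unfolding max_rate_def
  proof (rule SUP_least)
    fix m :: nat assume "m \<in> {0<..}"
    then have m: "0 < m" by simp
    show "ereal (entropy_rate m) \<le> - s_lim d u \<rho>0 \<rho>1"
    proof (cases "entropy_rate m = 0")
      case True
      then show ?thesis using s_lim_le[OF trivial_test(1,2), of 0 1] trivial_test(3) by simp
    next
      case False
      then have "ereal 0 < ereal (entropy_rate m)" using entropy_rate_nonneg[of m] by simp
      then show ?thesis
      \<comment> \<open>\<open>block_test\<close> takes nonnegative exponents strictly below the
        rate; approaching the rate from inside the open interval above 0 meets both
        requirements.\<close>
      proof (rule dense_le_bounded)
        fix w assume w: "ereal 0 < w" "w < ereal (entropy_rate m)"
        then obtain r where r: "w = ereal r" by (cases w) auto
        then have rr: "0 \<le> r" "r < entropy_rate m" using w by auto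
        obtain T K where "inv_test d u T" "beta0 d \<rho>0 T \<longlonglongrightarrow> 0"
          "\<forall>n. exp (- real n * r) \<le> beta1 \<rho>1 T n \<and> beta1 \<rho>1 T n \<le> K * exp (- real n * r)"
          by (rule block_test[OF m rr])
        then show "w \<le> - s_lim d u \<rho>0 \<rho>1" unfolding r by (intro s_lim_le) auto
      qed
    qed
  qed
  then have "- (- s_lim d u \<rho>0 \<rho>1) \<le> - max_rate" by (simp only: ereal_minus_le_minus)
  then show ?thesis by simp
qed

text \<open>With \<open>a\<close> equal to a finite supremum, the condition in
  \<open>test_lower_bound\<close> holds for all \<open>n > 0\<close>, and the constant
  \<open>c\<close> disappears in the limit. For an infinite supremum the claimed bound is minus
  infinity.\<close>

lemma liminf_rate_ge:
  assumes T: "inv_test d u T" "beta0 d \<rho>0 T \<longlonglongrightarrow> 0"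
  shows "- max_rate \<le> liminf (rate \<rho>1 T)"
proof (cases max_rate)
  case (real a)
  have le: "entropy_rate n \<le> a" if "0 < n" for n
    using entropy_rate_le_max[OF that] by (simp add: real)
  have a: "0 \<le> a" using le[of 1] entropy_rate_nonneg[of 1] by simp
  have *: "ereal (- a - e) \<le> liminf (rate \<rho>1 T)" if e: "0 < e" for e :: real
  proof -
    obtain c where c: "0 < c" 
      and lo: "\<forall>\<^sub>F n in sequentially. entropy_rate n \<le> a \<longrightarrow> c * exp (- real n * (a + e)) \<le> beta1 \<rho>1 T n"
      by (rule test_lower_bound[OF T a e])
    have "\<forall>\<^sub>F n in sequentially. ereal (ln c / real n - (a + e)) \<le> rate \<rho>1 T n"
      using lo eventually_gt_at_top[of 0]
    proof eventually_elim
      case (elim n)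
      then have b: "c * exp (- real n * (a + e)) \<le> beta1 \<rho>1 T n" using le by simp
      then have pos: "0 < beta1 \<rho>1 T n" using c by (intro less_le_trans[OF _ b]) simp
      have "ln (c * exp (- real n * (a + e))) \<le> ln (beta1 \<rho>1 T n)" using b c by (intro ln_mono) auto
      then have "ln c - real n * (a + e) \<le> ln (beta1 \<rho>1 T n)" using c by (simp add: ln_mult)
      then have "(ln c - real n * (a + e)) / real n \<le> ln (beta1 \<rho>1 T n) / real n" by (rule divide_right_mono) simp
      then have "ln c / real n - (a + e) \<le> ln (beta1 \<rho>1 T n) / real n" using elim(2) by (simp add: diff_divide_distrib)
      then show ?case using pos by (simp add: rate_def elog_def)
    qed
    then have "liminf (\<lambda>n. ereal (ln c / real n - (a + e))) \<le> liminf (rate \<rho>1 T)" by (rule Liminf_mono)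
    moreover have "(\<lambda>n. ln c / real n - (a + e)) \<longlonglongrightarrow> 0 - (a + e)"
      by (intro tendsto_diff tendsto_const lim_const_over_n)
    then have "liminf (\<lambda>n. ereal (ln c / real n - (a + e))) = ereal (0 - (a + e))"
      by (intro lim_imp_Liminf) auto
    ultimately show ?thesis by simp
  qed
  have "ereal (- a) \<le> liminf (rate \<rho>1 T)"
  proof (rule dense_le)
    fix y assume y: "y < ereal (- a)"
    show "y \<le> liminf (rate \<rho>1 T)"
    proof (cases y)
      case (real b)
      then show ?thesis using *[of "- a - b"] y by simp
    qed (use y in auto)
  qed
  then show ?thesis by (simp add: real)
next
  case MInf
  then show ?thesis using entropy_rate_le_max[of 1] by simp
qed simp

text \<open>Closes the circle \<open>- max_rate \<le> s_lower \<le> s_upper \<le> s_lim \<le> -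
  max_rate\<close>. The comparison of \<open>s_upper\<close> with \<open>s_lim\<close> holds because
  a limit is its own limes superior, so the infimum defining \<open>s_lim\<close> runs over a
  subset.\<close>

lemma stein_symmetric:
  "s_lower d u \<rho>0 \<rho>1 = s_upper d u \<rho>0 \<rho>1 \<and> s_upper d u \<rho>0 \<rho>1 = s_lim d u \<rho>0 \<rho>1
    \<and> s_lim d u \<rho>0 \<rho>1 = - S_M \<mu> d u \<rho>0 \<rho>1"
proof -
  have 1: "s_lower d u \<rho>0 \<rho>1 \<le> s_upper d u \<rho>0 \<rho>1"
    unfolding s_lower_def s_upper_def
  proof (rule Inf_greatest)
    fix L assume "L \<in> {limsup (rate \<rho>1 T) |T. inv_test d u T \<and> beta0 d \<rho>0 T \<longlonglongrightarrow> 0}"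
    then obtain T where T: "inv_test d u T" "beta0 d \<rho>0 T \<longlonglongrightarrow> 0" "L = limsup (rate \<rho>1 T)" by blast
    have "Inf {liminf (rate \<rho>1 T) |T. inv_test d u T \<and> beta0 d \<rho>0 T \<longlonglongrightarrow> 0} \<le> liminf (rate \<rho>1 T)"
      using T by (intro Inf_lower) blast
    also have "\<dots> \<le> L" unfolding T(3) by (rule Liminf_le_Limsup) simp
    finally show "Inf {liminf (rate \<rho>1 T) |T. inv_test d u T \<and> beta0 d \<rho>0 T \<longlonglongrightarrow> 0} \<le> L" .
  qed
  have 2: "s_upper d u \<rho>0 \<rho>1 \<le> s_lim d u \<rho>0 \<rho>1"
    unfolding s_lim_def s_upper_def
  proof (rule Inf_superset_mono, rule subsetI)
    fix L assume "L \<in> {L. \<exists>T. inv_test d u T \<and> beta0 d \<rho>0 T \<longlonglongrightarrow> 0 \<and> rate \<rho>1 T \<longlonglongrightarrow> L}"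
    then obtain T where T: "inv_test d u T" "beta0 d \<rho>0 T \<longlonglongrightarrow> 0" "rate \<rho>1 T \<longlonglongrightarrow> L" by blast
    have "L = limsup (rate \<rho>1 T)" using lim_imp_Limsup[OF _ T(3)] by simp
    then show "L \<in> {limsup (rate \<rho>1 T) |T. inv_test d u T \<and> beta0 d \<rho>0 T \<longlonglongrightarrow> 0}" using T by blast
  qed
  have 3: "- max_rate \<le> s_lower d u \<rho>0 \<rho>1"
    unfolding s_lower_def using liminf_rate_ge by (intro Inf_greatest) blast
  show ?thesis unfolding S_M_eq using 1 2 3 s_lim_upper by (auto intro: antisym order_trans)
qed

end

theorem theorem4p4:
  fixes d :: nat and u :: "'g::{group_add,topological_space} \<Rightarrow> complex mat"
    and \<mu> :: "'g measure" and \<rho>0 \<rho>1 :: "complex mat"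
  assumes "compact_group TYPE('g)"
    and "haar_prob \<mu>"
    and "cont_unitary_rep d u"
    and "density d \<rho>0" and "density d \<rho>1"
    and "\<forall>n. loewner_le (d^n) (supp (twirl \<mu> d u n (kpow n \<rho>0))) (supp (twirl \<mu> d u n (kpow n \<rho>1)))"
  shows "s_lower d u \<rho>0 \<rho>1 = s_upper d u \<rho>0 \<rho>1
       \<and> s_upper d u \<rho>0 \<rho>1 = s_lim d u \<rho>0 \<rho>1
       \<and> s_lim d u \<rho>0 \<rho>1 = - S_M \<mu> d u \<rho>0 \<rho>1"
proof -
  interpret twirled_states d u \<mu> \<rho>0 \<rho>1
    using assms by unfold_locales auto
  show ?thesis by (rule stein_symmetric)
qed

end
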